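(* Let $\mathcal{A}$ be an optimization problem on pairs of inputs $a,b$ of length $n$ whose answer always lies in $[-O(\mathrm{poly}(n)),O(\mathrm{poly}(n))]$, and suppose its decision version (given $a,b,k$, decide whether the answer is greater than $k$) is in $\mathsf{NSPACE}[\mathrm{polylog}(n)]$. Then Max-$\mathcal{A}$-Pair (and likewise Min-$\mathcal{A}$-Pair), on two sets of $N$ strings of length $2^{(\log N)^{o(1)}}$, can be reduced in near-linear time ($N^{1+o(1)}$) to $2^{(\log N)^{o(1)}}$ instances of BP-Satisfying-Pair with branching programs of size $2^{(\log N)^{o(1)}}$.
   Context: Max-$\mathcal{A}$-Pair (resp. Min-$\mathcal{A}$-Pair): given two sets $A,B$ of $N$ strings, compute the maximum (resp. minimum) over $(a,b)\in A\times B$ of the answer of $\mathcal{A}$ on $(a,b)$. A (nondeterministic) branching program (BP) of length $T$ and width $W$ on Boolean inputs $x_1,\dots,x_n$ is a layered directed graph with $T$ layers of $W$ nodes; all nodes of layer $i<T$ are labelled by one variable $x_{f(i)}$; edges go between consecutive layers and are marked $0$ or $1$; size is the number of edges; it accepts $x$ iff there is a path from the first node of layer $1$ to the first node of layer $T$ using only edges whose mark equals the value of the variable labelling their starting node. BP-Satisfying-Pair: given a BP $P$ on $n$ inputs and $A,B\subseteq\{0,1\}^{n/2}$ of size $N$, decide whether $P$ accepts the concatenation of some $a\in A$, $b\in B$. *)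

theory Defs
  imports Complex_Main "HOL-Library.Log_Nat"
begin

section \<open>Growth classes\<close>

text \<open>The classes $2^{(\log N)^{o(1)}}$ and $N^{1+o(1)}$, as asymptotic upper bounds.\<close>

definition quasi_const_exp :: "(nat \<Rightarrow> nat) \<Rightarrow> bool" where
  "quasi_const_exp f \<longleftrightarrow> (\<exists>\<epsilon> :: nat \<Rightarrow> real. \<epsilon> \<longlonglongrightarrow> 0 \<and>
     (\<forall>\<^sub>F N in sequentially. real (f N) \<le> 2 powr (log 2 (real N) powr \<epsilon> N)))"

definition near_linear :: "(nat \<Rightarrow> nat) \<Rightarrow> bool" where
  "near_linear f \<longleftrightarrow> (\<exists>\<epsilon> :: nat \<Rightarrow> real. \<epsilon> \<longlonglongrightarrow> 0 \<and>
     (\<forall>\<^sub>F N in sequentially. real (f N) \<le> real N powr (1 + \<epsilon> N)))"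


section \<open>Nondeterministic space\<close>

text \<open>Nondeterministic Turing machines with a two-way read-only input tape and one
  read-write work tape that is infinite to the right. A machine is a finite set of transitions
  (state, scanned input cell, scanned work symbol, new state, written work symbol, input move,
  work move). States and work symbols are natural numbers (finitely many occur in a finite
  transition set); 0 is the initial state, 1 the accepting state, and 0 the blank work symbol.\<close>

datatype sym = Bit bool | Hash

datatype cell = LeftEnd | Sym sym | RightEnd

datatype move = MLeft | MStay | MRight

type_synonym ntm = "(nat \<times> cell \<times> nat \<times> nat \<times> nat \<times> move \<times> move) set"

record config =
  cstate :: nat
  ihead :: nat
  whead :: nat
  wtape :: "nat \<Rightarrow> nat"

definition input_cell :: "sym list \<Rightarrow> nat \<Rightarrow> cell" where
  "input_cell x i =
     (if i = 0 then LeftEnd else if i \<le> length x then Sym (x ! (i - 1)) else RightEnd)"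

fun move_head :: "move \<Rightarrow> nat \<Rightarrow> nat" where
  "move_head MLeft i = i - 1"
| "move_head MStay i = i"
| "move_head MRight i = i + 1"

definition init_config :: config where
  "init_config = \<lparr>cstate = 0, ihead = 0, whead = 0, wtape = (\<lambda>_. 0)\<rparr>"

text \<open>The input head cannot leave the positions 0, \dots, |x| + 1.\<close>

definition ntm_step :: "ntm \<Rightarrow> sym list \<Rightarrow> config \<Rightarrow> config \<Rightarrow> bool" where
  "ntm_step M x c c' \<longleftrightarrow> (\<exists>q' s' di dw.
     (cstate c, input_cell x (ihead c), wtape c (whead c), q', s', di, dw) \<in> M \<and>
     c' = \<lparr>cstate = q', ihead = min (length x + 1) (move_head di (ihead c)),
           whead = move_head dw (whead c), wtape = (wtape c)(whead c := s')\<rparr>)"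

definition ntm_reach :: "ntm \<Rightarrow> sym list \<Rightarrow> config \<Rightarrow> bool" where
  "ntm_reach M x c \<longleftrightarrow> (ntm_step M x)\<^sup>*\<^sup>* init_config c"

definition ntm_accepts :: "ntm \<Rightarrow> sym list \<Rightarrow> bool" where
  "ntm_accepts M x \<longleftrightarrow> (\<exists>c. ntm_reach M x c \<and> cstate c = 1)"

text \<open>The head moves by at most one cell per step, so the work cells visited on a
  computation path are exactly those up to the maximal position of the work head. The space
  bound $O(s)$ is imposed on all paths and all inputs.\<close>

definition NSPACE :: "(nat \<Rightarrow> real) \<Rightarrow> sym list set set" where
  "NSPACE s = {L. \<exists>M (C :: nat). finite M \<and>
     (\<forall>x. (x \<in> L \<longleftrightarrow> ntm_accepts M x) \<and>
          (\<forall>c. ntm_reach M x c \<longrightarrow> real (whead c + 1) \<le> real C * s (length x) + real C))}"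

definition NSPACE_polylog :: "sym list set set" where
  "NSPACE_polylog = (\<Union>d :: nat. NSPACE (\<lambda>m. log 2 (real m) ^ d))"


section \<open>Optimization problems on pairs\<close>

type_synonym pair_problem = "bool list \<Rightarrow> bool list \<Rightarrow> int"

definition poly_bounded :: "pair_problem \<Rightarrow> bool" where
  "poly_bounded \<A> \<longleftrightarrow> (\<exists>c d :: nat. \<forall>n a b. length a = n \<longrightarrow> length b = n \<longrightarrow>
     - int (c * n ^ d + c) \<le> \<A> a b \<and> \<A> a b \<le> int (c * n ^ d + c))"

text \<open>Binary representation, most significant bit first, without leading zeros.\<close>

fun bin_rep :: "nat \<Rightarrow> bool list" where
  "bin_rep n = (if n = 0 then [] else bin_rep (n div 2) @ [odd n])"

declare bin_rep.simps [simp del]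

definition enc_query :: "bool list \<Rightarrow> bool list \<Rightarrow> int \<Rightarrow> sym list" where
  "enc_query a b k = map Bit a @ [Hash] @ map Bit b @ [Hash] @
     [Bit (k < 0)] @ map Bit (bin_rep (nat \<bar>k\<bar>))"

definition decision_version :: "pair_problem \<Rightarrow> sym list set" where
  "decision_version \<A> = {enc_query a b k | a b k. length a = length b \<and> \<A> a b > k}"

definition max_pair :: "pair_problem \<Rightarrow> bool list set \<Rightarrow> bool list set \<Rightarrow> int" where
  "max_pair \<A> A B = Max {\<A> a b | a b. a \<in> A \<and> b \<in> B}"

definition min_pair :: "pair_problem \<Rightarrow> bool list set \<Rightarrow> bool list set \<Rightarrow> int" where
  "min_pair \<A> A B = Min {\<A> a b | a b. a \<in> A \<and> b \<in> B}"


section \<open>Branching programs\<close>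

text \<open>Layers, the nodes of a layer and the variables are numbered from 0; an edge
  (i, u, v, m) leads from node u of layer i to node v of layer i + 1 and is marked m.\<close>

record bp =
  bp_vars :: nat
  bp_length :: nat
  bp_width :: nat
  bp_labels :: "nat list"
  bp_edges :: "(nat \<times> nat \<times> nat \<times> bool) list"

definition bp_wf :: "bp \<Rightarrow> bool" where
  "bp_wf P \<longleftrightarrow> bp_length P \<ge> 1 \<and> bp_width P \<ge> 1 \<and>
     length (bp_labels P) = bp_length P - 1 \<and>
     (\<forall>j \<in> set (bp_labels P). j < bp_vars P) \<and>
     distinct (bp_edges P) \<and>
     (\<forall>(i, u, v, m) \<in> set (bp_edges P).
        i < bp_length P - 1 \<and> u < bp_width P \<and> v < bp_width P)"

definition bp_size :: "bp \<Rightarrow> nat" where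
  "bp_size P = length (bp_edges P)"

definition bp_accepts :: "bp \<Rightarrow> bool list \<Rightarrow> bool" where
  "bp_accepts P x \<longleftrightarrow> (\<exists>p :: nat \<Rightarrow> nat. p 0 = 0 \<and> p (bp_length P - 1) = 0 \<and>
     (\<forall>i < bp_length P - 1. (i, p i, p (i + 1), x ! (bp_labels P ! i)) \<in> set (bp_edges P)))"

text \<open>Sets of strings are presented to algorithms as duplicate-free lists.\<close>

definition string_set :: "nat \<Rightarrow> nat \<Rightarrow> bool list list \<Rightarrow> bool" where
  "string_set N n as \<longleftrightarrow> distinct as \<and> length as = N \<and> (\<forall>a \<in> set as. length a = n)"

type_synonym bp_instance = "bp \<times> bool list list \<times> bool list list"

fun bp_instance_wf :: "nat \<Rightarrow> bp_instance \<Rightarrow> bool" where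
  "bp_instance_wf N (P, as, bs) \<longleftrightarrow> bp_wf P \<and> even (bp_vars P) \<and>
     string_set N (bp_vars P div 2) as \<and> string_set N (bp_vars P div 2) bs"

fun bp_satisfying_pair :: "bp_instance \<Rightarrow> bool" where
  "bp_satisfying_pair (P, as, bs) \<longleftrightarrow> (\<exists>a \<in> set as. \<exists>b \<in> set bs. bp_accepts P (a @ b))"


section \<open>Random access machines with logarithmic cost\<close>

text \<open>Structured RAM programs over natural numbers with a read-only random-access input, a
  memory accessed by indirect addressing, finitely many directly addressed registers and a
  write-only output. Every instruction is charged the bit lengths of the numbers and addresses
  it handles (logarithmic cost). This differs only by logarithmic factors from unit cost on a
  word RAM with logarithmic word size, hence yields the same notion of time $N^{1+o(1)}$.
  Subtraction is truncated and division by 0 yields 0.\<close>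

datatype com =
    Const nat nat
  | Add nat nat nat
  | Sub nat nat nat
  | Mul nat nat nat
  | Div nat nat nat
  | Load nat nat
  | Store nat nat
  | Input nat nat
  | InputLength nat
  | Emit nat
  | Skip
  | Seq com com
  | IfNZ nat com com
  | WhileNZ nat com

record ram =
  reg :: "nat \<Rightarrow> nat"
  mem :: "nat \<Rightarrow> nat"
  out :: "nat list"

definition lcost :: "nat \<Rightarrow> nat" where
  "lcost v = 1 + floorlog 2 v"

definition input_at :: "nat list \<Rightarrow> nat \<Rightarrow> nat" where
  "input_at xs i = (if i < length xs then xs ! i else 0)"

definition set_reg :: "nat \<Rightarrow> nat \<Rightarrow> ram \<Rightarrow> ram" where
  "set_reg r v s = s\<lparr>reg := (reg s)(r := v)\<rparr>"

text \<open>exec xs c s t s': on input xs, program c started in s halts in s' with total cost t.\<close>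

inductive exec :: "nat list \<Rightarrow> com \<Rightarrow> ram \<Rightarrow> nat \<Rightarrow> ram \<Rightarrow> bool" for xs where
  Const: "exec xs (Const r k) s (lcost k) (set_reg r k s)"
| Add: "exec xs (Add r p q) s (lcost (reg s p) + lcost (reg s q))
          (set_reg r (reg s p + reg s q) s)"
| Sub: "exec xs (Sub r p q) s (lcost (reg s p) + lcost (reg s q))
          (set_reg r (reg s p - reg s q) s)"
| Mul: "exec xs (Mul r p q) s (lcost (reg s p) + lcost (reg s q))
          (set_reg r (reg s p * reg s q) s)"
| Div: "exec xs (Div r p q) s (lcost (reg s p) + lcost (reg s q))
          (set_reg r (reg s p div reg s q) s)"
| Load: "exec xs (Load r p) s (lcost (reg s p) + lcost (mem s (reg s p)))
          (set_reg r (mem s (reg s p)) s)"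
| Store: "exec xs (Store p q) s (lcost (reg s p) + lcost (reg s q))
          (s\<lparr>mem := (mem s)(reg s p := reg s q)\<rparr>)"
| Input: "exec xs (Input r p) s (lcost (reg s p) + lcost (input_at xs (reg s p)))
          (set_reg r (input_at xs (reg s p)) s)"
| InputLength: "exec xs (InputLength r) s (lcost (length xs)) (set_reg r (length xs) s)"
| Emit: "exec xs (Emit p) s (lcost (reg s p)) (s\<lparr>out := out s @ [reg s p]\<rparr>)"
| Skip: "exec xs Skip s 1 s"
| Seq: "\<lbrakk>exec xs c s t s'; exec xs d s' t' s''\<rbrakk> \<Longrightarrow> exec xs (Seq c d) s (t + t') s''"
| IfTrue: "\<lbrakk>reg s p \<noteq> 0; exec xs c s t s'\<rbrakk>
    \<Longrightarrow> exec xs (IfNZ p c d) s (lcost (reg s p) + t) s'"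
| IfFalse: "\<lbrakk>reg s p = 0; exec xs d s t s'\<rbrakk>
    \<Longrightarrow> exec xs (IfNZ p c d) s (lcost (reg s p) + t) s'"
| WhileFalse: "reg s p = 0 \<Longrightarrow> exec xs (WhileNZ p c) s (lcost (reg s p)) s"
| WhileTrue: "\<lbrakk>reg s p \<noteq> 0; exec xs c s t s'; exec xs (WhileNZ p c) s' t' s''\<rbrakk>
    \<Longrightarrow> exec xs (WhileNZ p c) s (lcost (reg s p) + t + t') s''"

definition computes :: "com \<Rightarrow> nat list \<Rightarrow> nat list \<Rightarrow> nat \<Rightarrow> bool" where
  "computes c xs ys t \<longleftrightarrow>
     (\<exists>s. exec xs c \<lparr>reg = (\<lambda>_. 0), mem = (\<lambda>_. 0), out = []\<rparr> t s \<and> out s = ys)"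


section \<open>Reductions to BP-Satisfying-Pair\<close>

text \<open>Self-delimiting encodings of inputs and outputs of RAM programs.\<close>

definition enc_bools :: "bool list \<Rightarrow> nat list" where
  "enc_bools x = length x # map of_bool x"

definition enc_strings :: "bool list list \<Rightarrow> nat list" where
  "enc_strings as = length as # concat (map enc_bools as)"

definition enc_bp :: "bp \<Rightarrow> nat list" where
  "enc_bp P = [bp_vars P, bp_length P, bp_width P] @ bp_labels P @ [length (bp_edges P)] @
     concat (map (\<lambda>(i, u, v, m). [i, u, v, of_bool m]) (bp_edges P))"

fun enc_bp_instance :: "bp_instance \<Rightarrow> nat list" where
  "enc_bp_instance (P, as, bs) = enc_bp P @ enc_strings as @ enc_strings bs"

definition enc_bp_instances :: "bp_instance list \<Rightarrow> nat list" where
  "enc_bp_instances Is = length Is # concat (map enc_bp_instance Is)"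

definition enc_int :: "int \<Rightarrow> nat list" where
  "enc_int z = [of_bool (z < 0), nat \<bar>z\<bar>]"

text \<open>A reduction of the problem of computing F on two sets of N strings of length at most
  l N: a program G produces the list of instances, and a program D computes the value of F from
  the answers to these instances (and the original input). Both together run in time t N; at
  most q N instances with branching programs of size at most sz N are produced.\<close>

definition bp_reduction ::
  "(bool list set \<Rightarrow> bool list set \<Rightarrow> int) \<Rightarrow> (nat \<Rightarrow> nat) \<Rightarrow> com \<Rightarrow> com \<Rightarrow>
   (nat \<Rightarrow> nat) \<Rightarrow> (nat \<Rightarrow> nat) \<Rightarrow> (nat \<Rightarrow> nat) \<Rightarrow> bool" where
  "bp_reduction F l G D t q sz \<longleftrightarrow>
     (\<forall>N n as bs. N \<ge> 1 \<longrightarrow> n \<le> l N \<longrightarrow> string_set N n as \<longrightarrow> string_set N n bs \<longrightarrow>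
        (\<exists>Is t\<^sub>1 t\<^sub>2.
           computes G (enc_strings as @ enc_strings bs) (enc_bp_instances Is) t\<^sub>1 \<and>
           length Is \<le> q N \<and>
           (\<forall>I \<in> set Is. bp_instance_wf N I \<and> bp_size (fst I) \<le> sz N) \<and>
           computes D (enc_bools (map bp_satisfying_pair Is) @ enc_strings as @ enc_strings bs)
             (enc_int (F (set as) (set bs))) t\<^sub>2 \<and>
           t\<^sub>1 + t\<^sub>2 \<le> t N))"

definition near_linear_reducible_to_bp ::
  "(bool list set \<Rightarrow> bool list set \<Rightarrow> int) \<Rightarrow> (nat \<Rightarrow> nat) \<Rightarrow> bool" where
  "near_linear_reducible_to_bp F l \<longleftrightarrow>
     (\<exists>G D t q sz. near_linear t \<and> quasi_const_exp q \<and> quasi_const_exp sz \<and>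
        bp_reduction F l G D t q sz)"

end

theory Submission
  imports Defs "HOL-Library.Transitive_Closure_Table" "HOL-Real_Asymp.Real_Asymp"
begin

text \<open>
  Prepend a 0 to every string. Then the input of the branching program and the input tape of the
  machine for the decision version have the same positions, up to the encoding of \<open>k\<close>. If all
  answers lie in \<open>{-K..K}\<close>, there is one instance for each \<open>k\<close> in \<open>{-K..<K}\<close>, and counting the
  accepted ones gives the optimum.

  Configurations of the machine are numbers below \<open>S = 2 ^ L\<close> with \<open>L\<close> polylogarithmic in \<open>n\<close>.
  For the maximum, the branching program walks from one configuration to the next and sweeps over
  all variables between two steps. For the minimum it must certify that no accepting configuration
  is reachable. Savitch's recursion reads: \<open>v\<close> is not reachable from \<open>u\<close> in \<open>2 ^ (k + 1)\<close> steps iff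
  for every midpoint \<open>w\<close> one of the two halves is impossible in \<open>2 ^ k\<close> steps. Unfolded \<open>L\<close> times
  this is a game in which the midpoints are enumerated by time, while the claims about the
  impossible halves form an \<open>L\<close>-bit string that is the state of the program. The program thus has
  about \<open>S ^ L\<close> layers of width \<open>O(S)\<close>, which is still quasi-polynomial in \<open>n\<close>.

  The generating program is written in a small language of expressions with bounded folds, whose
  compilation to RAM programs comes with a generic cost bound.
\<close>

section \<open>A bounded-loop language on the RAM\<close>

text \<open>A query has an end marker at position 0 of its tape and a separator at position n + 1;
  the two prepended zeros fill exactly these places. All cells outside the two strings are known
  when the program is generated.

  Reachability is immediate for a nondeterministic program, since its path is a guess checked
  against the bits it reads. The obstacle is the minimum: it asks for a pair on which the machine
  fails to accept. Savitch's recursion suits layered programs because the universally quantified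
  midpoints can be turned into time and the existential choices into nodes. Taking S = 2 ^ L lets
  one number bound the configurations, the path lengths and the claim strings.

  The generator handles numbers as large as 2 ^ n, while n may exceed every power of log N. This is
  harmless because values are charged by their bit length, here about n; what has to be controlled
  is the number of loop iterations, linear in N and quasi-polynomial in n.\<close>

datatype bop = Plus | Minus | Times | Divide

fun bopf :: "bop \<Rightarrow> nat \<Rightarrow> nat \<Rightarrow> nat" where
  "bopf Plus a b = a + b"
| "bopf Minus a b = a - b"
| "bopf Times a b = a * b"
| "bopf Divide a b = a div b"

fun bopc :: "bop \<Rightarrow> nat \<Rightarrow> nat \<Rightarrow> nat \<Rightarrow> com" where
  "bopc Plus = Add"
| "bopc Minus = Sub"
| "bopc Times = Mul"
| "bopc Divide = Div"

datatype exp =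
    EVar nat
  | ECst nat
  | EBin bop exp exp
  | EIn exp
  | EFold nat nat exp exp exp

primrec eval :: "nat list \<Rightarrow> exp \<Rightarrow> (nat \<Rightarrow> nat) \<Rightarrow> nat" where
  "eval xs (EVar x) env = env x"
| "eval xs (ECst k) env = k"
| "eval xs (EBin f a b) env = bopf f (eval xs a env) (eval xs b env)"
| "eval xs (EIn a) env = input_at xs (eval xs a env)"
| "eval xs (EFold r i cnt ini body) env =
     fold (\<lambda>k a. eval xs body (env(r := a, i := k))) [0..<eval xs cnt env] (eval xs ini env)"

datatype stm =
    SEmit exp
  | SSeq stm stm
  | SLet nat exp stm
  | SFor nat exp stm

primrec outp :: "nat list \<Rightarrow> stm \<Rightarrow> (nat \<Rightarrow> nat) \<Rightarrow> nat list" where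
  "outp xs (SEmit e) env = [eval xs e env]"
| "outp xs (SSeq c d) env = outp xs c env @ outp xs d env"
| "outp xs (SLet r e c) env = outp xs c (env(r := eval xs e env))"
| "outp xs (SFor i e c) env = concat (map (\<lambda>k. outp xs c (env(i := k))) [0..<eval xs e env])"

text \<open>Register allocation: a variable \<open>x\<close> lives in register \<open>\<rho> x < d\<close>, and only registers from
  \<open>d\<close> on are overwritten, so that scopes can shadow each other freely.\<close>

primrec compile_exp :: "exp \<Rightarrow> (nat \<Rightarrow> nat) \<Rightarrow> nat \<Rightarrow> com" where
  "compile_exp (EVar x) \<rho> d = Seq (Const (d + 1) 0) (Add d (\<rho> x) (d + 1))"
| "compile_exp (ECst k) \<rho> d = Const d k"
| "compile_exp (EBin f a b) \<rho> d = Seq (compile_exp a \<rho> d) (Seq (compile_exp b \<rho> (d + 1)) (bopc f d d (d + 1)))"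
| "compile_exp (EIn a) \<rho> d = Seq (compile_exp a \<rho> d) (Input d d)"
| "compile_exp (EFold r i cnt ini body) \<rho> d =
     Seq (compile_exp ini \<rho> d) (Seq (compile_exp cnt \<rho> (d + 2)) (Seq (Const (d + 1) 0)
       (WhileNZ (d + 2) (Seq (compile_exp body (\<rho>(r := d, i := d + 1)) (d + 3))
          (Seq (Seq (Const (d + 4) 0) (Add d (d + 3) (d + 4)))
          (Seq (Const (d + 3) 1) (Seq (Add (d + 1) (d + 1) (d + 3)) (Sub (d + 2) (d + 2) (d + 3)))))))))"

primrec compile_stm :: "stm \<Rightarrow> (nat \<Rightarrow> nat) \<Rightarrow> nat \<Rightarrow> com" where
  "compile_stm (SEmit e) \<rho> d = Seq (compile_exp e \<rho> d) (Emit d)"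
| "compile_stm (SSeq b c) \<rho> d = Seq (compile_stm b \<rho> d) (compile_stm c \<rho> d)"
| "compile_stm (SLet r e c) \<rho> d = Seq (compile_exp e \<rho> d) (compile_stm c (\<rho>(r := d)) (d + 1))"
| "compile_stm (SFor i e c) \<rho> d = Seq (compile_exp e \<rho> (d + 1)) (Seq (Const d 0)
     (WhileNZ (d + 1) (Seq (compile_stm c (\<rho>(i := d)) (d + 2))
        (Seq (Const (d + 2) 1) (Seq (Add d d (d + 2)) (Sub (d + 1) (d + 1) (d + 2)))))))"

text \<open>If all variables, inputs and fold accumulators are at most \<open>X\<close>, then \<open>e\<close> evaluates to at
  most \<open>X ^ weight e\<close>, so that only loops need individual bounds on the values computed.\<close>

primrec weight :: "exp \<Rightarrow> nat" where
  "weight (EVar x) = 1"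
| "weight (ECst k) = k"
| "weight (EBin f a b) = weight a + weight b + 1"
| "weight (EIn a) = 1"
| "weight (EFold r i cnt ini body) = 1"

text \<open>Replacing the count of a fold by the constant \<open>k\<close> gives its accumulator
  after \<open>k\<close> iterations, so all intermediate accumulators are bounded without a separate
  notion of loop state. \<open>C\<close> bounds the numbers of iterations of folds only.\<close>

primrec vbound :: "nat list \<Rightarrow> nat \<Rightarrow> nat \<Rightarrow> exp \<Rightarrow> (nat \<Rightarrow> nat) \<Rightarrow> bool" where
  "vbound xs X C (EVar x) env \<longleftrightarrow> True"
| "vbound xs X C (ECst k) env \<longleftrightarrow> True"
| "vbound xs X C (EBin f a b) env \<longleftrightarrow> vbound xs X C a env \<and> vbound xs X C b env"
| "vbound xs X C (EIn a) env \<longleftrightarrow> vbound xs X C a env"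
| "vbound xs X C (EFold r i cnt ini body) env \<longleftrightarrow>
     vbound xs X C cnt env \<and> vbound xs X C ini env \<and> eval xs cnt env \<le> C \<and>
     (\<forall>k \<le> eval xs cnt env. eval xs (EFold r i (ECst k) ini body) env \<le> X) \<and>
     (\<forall>k < eval xs cnt env. vbound xs X C body
        (env(r := eval xs (EFold r i (ECst k) ini body) env, i := k)))"

primrec tcoef :: "nat \<Rightarrow> exp \<Rightarrow> nat" where
  "tcoef C (EVar x) = 3"
| "tcoef C (ECst k) = k + 1"
| "tcoef C (EBin f a b) = tcoef C a + tcoef C b + weight a + weight b + 2"
| "tcoef C (EIn a) = tcoef C a + weight a + 2"
| "tcoef C (EFold r i cnt ini body) = tcoef C ini + tcoef C cnt + 2 + C * (tcoef C body + 12)"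

primrec svbound :: "nat list \<Rightarrow> nat \<Rightarrow> nat \<Rightarrow> stm \<Rightarrow> (nat \<Rightarrow> nat) \<Rightarrow> bool" where
  "svbound xs X C (SEmit e) env \<longleftrightarrow> vbound xs X C e env"
| "svbound xs X C (SSeq b c) env \<longleftrightarrow> svbound xs X C b env \<and> svbound xs X C c env"
| "svbound xs X C (SLet r e c) env \<longleftrightarrow> vbound xs X C e env \<and> eval xs e env \<le> X \<and>
     svbound xs X C c (env(r := eval xs e env))"
| "svbound xs X C (SFor i e c) env \<longleftrightarrow> vbound xs X C e env \<and> eval xs e env \<le> X \<and>
     (\<forall>k < eval xs e env. svbound xs X C c (env(i := k)))"

primrec scoef :: "nat \<Rightarrow> stm \<Rightarrow> nat" where
  "scoef C (SEmit e) = tcoef C e + weight e + 1"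
| "scoef C (SSeq b c) = scoef C b + scoef C c"
| "scoef C (SLet r e c) = tcoef C e + scoef C c"
| "scoef C (SFor i e c) = tcoef C e + scoef C c + 11"

text \<open>Loops of statements range over strings, bits or edges, and a uniform bound like the
  \<open>C\<close> of folds would cost a power of \<open>N\<close> when they are nested. So their
  iterations are counted exactly, and \<open>scoef\<close> is the price of one counted step in units
  of \<open>lcost X\<close>.\<close>

primrec ssteps :: "nat list \<Rightarrow> stm \<Rightarrow> (nat \<Rightarrow> nat) \<Rightarrow> nat" where
  "ssteps xs (SEmit e) env = 1"
| "ssteps xs (SSeq b c) env = ssteps xs b env + ssteps xs c env"
| "ssteps xs (SLet r e c) env = 1 + ssteps xs c (env(r := eval xs e env))"
| "ssteps xs (SFor i e c) env = 1 + (\<Sum>k < eval xs e env. 1 + ssteps xs c (env(i := k)))"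

section \<open>Correctness and cost of compiled programs\<close>

lemma lcost_mono: "a \<le> b \<Longrightarrow> lcost a \<le> lcost b"
  unfolding lcost_def by (simp add: floorlog_mono)

lemma lcost_pos: "1 \<le> lcost a"
  unfolding lcost_def by simp

lemma lcost_0 [simp]: "lcost 0 = 1"
  unfolding lcost_def by (simp add: floorlog_def)

lemma lcost_1 [simp]: "lcost (Suc 0) = 2"
  unfolding lcost_def by (simp add: floorlog_def)

lemma lcost_power:
  assumes "X \<ge> 1"
  shows "lcost (X ^ k) \<le> (k + 1) * lcost X"
proof -
  have "X < 2 ^ floorlog 2 X" using assms by (simp add: floorlog_bounds)
  then have "X ^ k \<le> (2 ^ floorlog 2 X) ^ k"
    by (intro power_mono) auto
  then have "X ^ k < 2 ^ (floorlog 2 X * k + 1)"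
    by (simp add: power_mult le_less_trans)
  then have "floorlog 2 (X ^ k) \<le> floorlog 2 X * k + 1"
    by (intro floorlog_leI) auto
  moreover have "floorlog 2 X \<ge> 1"
    using assms floorlog_eq_zero_iff[of 2 X] by linarith
  ultimately show ?thesis by (simp add: lcost_def algebra_simps)
qed

text \<open>For positive p and q, p + q <= 2 * p * q, so a sum needs at most one factor
  \<open>X\<close> >= 2 more than a product; this is the \<open>+ 1\<close> in the weight of
  \<open>EBin\<close>.\<close>

lemma eval_le_weight:
  assumes "X \<ge> 2" "\<forall>v \<in> set xs. v \<le> X" "\<forall>x. env x \<le> X" "vbound xs X C e env"
  shows "eval xs e env \<le> X ^ weight e"
  using assms(4)
proof (induction e)
  case (EVar x)
  then show ?case using assms by simp
next
  case (ECst k)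
  have "k \<le> 2 ^ k" by (simp add: less_imp_le)
  also have "\<dots> \<le> X ^ k" using assms(1) by (rule power_mono) simp
  finally show ?case by simp
next
  case (EBin f a b)
  define p q where "p = X ^ weight a" and "q = X ^ weight b"
  have pq: "eval xs a env \<le> p" "eval xs b env \<le> q" using EBin p_def q_def by auto
  have pos: "p \<ge> 1" "q \<ge> 1" using assms(1) by (auto simp: p_def q_def)
  have "p + q \<le> 2 * (p * q)"
    using pos by (metis add_mono mult.commute mult_2 mult_le_mono1 nat_mult_1)
  also have "\<dots> \<le> X * (p * q)" using assms(1) by (rule mult_le_mono1)
  finally have s: "p + q \<le> X * (p * q)" .
  have m: "p * q \<le> X * (p * q)" using assms(1) by simp
  have "bopf f (eval xs a env) (eval xs b env) \<le> X * (p * q)"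
  proof (cases f)
    case Plus then show ?thesis using pq s by simp
  next
    case Minus then show ?thesis using pq s by simp
  next
    case Times then show ?thesis using le_trans[OF mult_le_mono[OF pq] m] by simp
  next
    case Divide then show ?thesis using pq s
      by simp (meson div_le_dividend le_add1 le_trans)
  qed
  then show ?case by (simp add: p_def q_def power_add mult_ac)
next
  case (EIn a)
  then show ?case using assms by (auto simp: input_at_def)
next
  case (EFold r i cnt ini body)
  then show ?case using assms(1) by simp
qed

text \<open>The only loop of the machine tests a register for zero, so counted loops run a register
  down from \<open>cnt\<close> while \<open>k\<close> counts completed iterations.
  \<open>P k\<close> is the invariant and \<open>B k\<close> the cost of one iteration; the final
  \<open>+ 1\<close> pays for the last test, on the value 0.\<close>

lemma while_count_exec:
  assumes body: "\<And>k s. k < cnt \<Longrightarrow> P k s \<Longrightarrow> \<exists>t s'. exec xs body s t s' \<and> t \<le> B k \<and> P (Suc k) s'"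
    and ctr: "\<And>k s. k \<le> cnt \<Longrightarrow> P k s \<Longrightarrow> reg s p = cnt - k"
    and "P 0 s"
  shows "\<exists>t s'. exec xs (WhileNZ p body) s t s' \<and> t \<le> (\<Sum>k < cnt. lcost cnt + B k) + 1 \<and> P cnt s'"
proof -
  have "\<exists>t s'. exec xs (WhileNZ p body) s t s' \<and> t \<le> (\<Sum>k = j..<cnt. lcost cnt + B k) + 1 \<and> P cnt s'"
    if "P j s" "j \<le> cnt" for j s
    using that
  proof (induction "cnt - j" arbitrary: j s)
    case 0
    then show ?case using ctr[of j s] exec.WhileFalse[of s p xs body] by auto
  next
    case (Suc m)
    then have j: "j < cnt" by simp
    obtain t s' where e: "exec xs body s t s'" "t \<le> B j" "P (Suc j) s'"
      using body j Suc.prems by blast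
    obtain t' s'' where e': "exec xs (WhileNZ p body) s' t' s''"
      "t' \<le> (\<Sum>k = Suc j..<cnt. lcost cnt + B k) + 1" "P cnt s''"
      using Suc.hyps(1)[of "Suc j" s'] Suc.hyps(2) j e by fastforce
    have r: "reg s p = cnt - j" using ctr[of j s] Suc.prems by simp
    then have "exec xs (WhileNZ p body) s (lcost (reg s p) + t + t') s''"
      using exec.WhileTrue[of s p xs body t s' t' s''] e e' j by simp
    moreover have "lcost (reg s p) \<le> lcost cnt" using r by (simp add: lcost_mono)
    moreover have "(\<Sum>k = j..<cnt. lcost cnt + B k) = (lcost cnt + B j) + (\<Sum>k = Suc j..<cnt. lcost cnt + B k)"
      using j by (rule sum.atLeast_Suc_lessThan)
    ultimately show ?case using e e'
      by (intro exI[of _ "lcost (reg s p) + t + t'"] exI[of _ s'']) auto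
  qed
  from this[of 0] assms(3) show ?thesis by (simp add: atLeast0LessThan)
qed

lemma exec_bopc:
  "exec xs (bopc f r p q) s (lcost (reg s p) + lcost (reg s q)) (set_reg r (bopf f (reg s p) (reg s q)) s)"
  by (cases f) (auto intro: exec.intros)

lemma reg_set_reg [simp]: "reg (set_reg r v s) = (reg s)(r := v)" "out (set_reg r v s) = out s"
  by (simp_all add: set_reg_def)

definition env_stored :: "nat \<Rightarrow> (nat \<Rightarrow> nat) \<Rightarrow> nat \<Rightarrow> (nat \<Rightarrow> nat) \<Rightarrow> ram \<Rightarrow> bool" where
  "env_stored X \<rho> d env s \<longleftrightarrow> (\<forall>x. \<rho> x < d \<and> reg s (\<rho> x) = env x \<and> env x \<le> X)"

lemma env_stored_cong:
  assumes "env_stored X \<rho> d env s" "d \<le> d'" "\<And>r. r < d \<Longrightarrow> reg s' r = reg s r"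
  shows "env_stored X \<rho> d' env s'"
  using assms unfolding env_stored_def by (metis less_le_trans)

lemma env_stored_upd:
  assumes "env_stored X \<rho> d env s" "reg s d = v" "v \<le> X"
  shows "env_stored X (\<rho>(r := d)) (d + 1) (env(r := v)) s"
  using assms unfolding env_stored_def by (auto simp: less_Suc_eq)

text \<open>There are no immediate operands, so register \<open>c\<close> holds the 1 that is added
  to the index \<open>a\<close> and subtracted from the countdown \<open>b\<close>. Loading it costs
  2, and so does each use.\<close>

lemma loop_step_exec:
  assumes "a \<noteq> b" "a \<noteq> c" "b \<noteq> c" "reg s a = k" "reg s b = m"
  shows "exec xs (Seq (Const c 1) (Seq (Add a a c) (Sub b b c))) s
           (2 + ((lcost k + 2) + (lcost m + 2)))
           (s\<lparr>reg := (reg s)(c := 1, a := k + 1, b := m - 1)\<rparr>)"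
proof -
  define s1 where "s1 = set_reg c 1 s"
  define s2 where "s2 = set_reg a (reg s1 a + reg s1 c) s1"
  define s3 where "s3 = set_reg b (reg s2 b - reg s2 c) s2"
  have 1: "exec xs (Const c 1) s (lcost 1) s1" unfolding s1_def by (rule exec.Const)
  have 2: "exec xs (Add a a c) s1 (lcost (reg s1 a) + lcost (reg s1 c)) s2"
    unfolding s2_def by (rule exec.Add)
  have 3: "exec xs (Sub b b c) s2 (lcost (reg s2 b) + lcost (reg s2 c)) s3"
    unfolding s3_def by (rule exec.Sub)
  have "s3 = s\<lparr>reg := (reg s)(c := 1, a := k + 1, b := m - 1)\<rparr>"
    using assms unfolding s3_def s2_def s1_def by (simp add: set_reg_def)
  moreover have "reg s1 a = k" "reg s1 c = 1" "reg s2 b = m" "reg s2 c = 1"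
    using assms by (auto simp: s1_def s2_def)
  ultimately show ?thesis using exec.Seq[OF 1 exec.Seq[OF 2 3]] by simp
qed

lemma compile_exp_exec:
  assumes X: "X \<ge> 2" "C \<le> X" "\<forall>v \<in> set xs. v \<le> X"
  shows "env_stored X \<rho> d env s \<Longrightarrow> vbound xs X C e env \<Longrightarrow>
    \<exists>t s'. exec xs (compile_exp e \<rho> d) s t s' \<and> t \<le> tcoef C e * lcost X \<and>
      (\<forall>r < d. reg s' r = reg s r) \<and> reg s' d = eval xs e env \<and> out s' = out s"
proof (induction e arbitrary: \<rho> d env s)
  case (EVar x)
  define s1 where "s1 = set_reg (d + 1) 0 s"
  have 1: "exec xs (Const (d + 1) 0) s (lcost 0) s1" unfolding s1_def by (rule exec.Const)
  have 2: "exec xs (Add d (\<rho> x) (d + 1)) s1 (lcost (reg s1 (\<rho> x)) + lcost (reg s1 (d + 1)))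
     (set_reg d (reg s1 (\<rho> x) + reg s1 (d + 1)) s1)" by (rule exec.Add)
  have v: "\<rho> x < d" "reg s (\<rho> x) = env x" "env x \<le> X" using EVar by (auto simp: env_stored_def)
  have "lcost (env x) \<le> lcost X" "1 \<le> lcost X" using v lcost_mono lcost_pos by auto
  then show ?case using exec.Seq[OF 1 2] v by (auto simp: s1_def intro!: exI)
next
  case (ECst k)
  have "lcost k \<le> lcost (X ^ k)"
  proof (rule lcost_mono)
    have "k \<le> 2 ^ k" by (simp add: less_imp_le)
    also have "\<dots> \<le> X ^ k" using X(1) by (rule power_mono) simp
    finally show "k \<le> X ^ k" .
  qed
  also have "\<dots> \<le> (k + 1) * lcost X" using X(1) by (intro lcost_power) simp
  finally have "lcost k \<le> (k + 1) * lcost X" .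
  then show ?case using exec.Const[of xs d k s] by (auto intro!: exI)
next
  case (EBin f a b)
  have env: "\<forall>x. env x \<le> X" using EBin.prems by (auto simp: env_stored_def)
  obtain t1 s1 where 1: "exec xs (compile_exp a \<rho> d) s t1 s1" "t1 \<le> tcoef C a * lcost X"
      "\<forall>r < d. reg s1 r = reg s r" "reg s1 d = eval xs a env" "out s1 = out s"
    using EBin.IH(1)[of \<rho> d env s] EBin.prems by auto
  have "env_stored X \<rho> (d + 1) env s1"
    using EBin.prems(1) by (rule env_stored_cong) (use 1 in auto)
  then obtain t2 s2 where 2: "exec xs (compile_exp b \<rho> (d + 1)) s1 t2 s2" "t2 \<le> tcoef C b * lcost X"
      "\<forall>r < d + 1. reg s2 r = reg s1 r" "reg s2 (d + 1) = eval xs b env" "out s2 = out s1"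
    using EBin.IH(2)[of \<rho> "d + 1" env s1] EBin.prems by auto
  have va: "lcost (eval xs a env) \<le> (weight a + 1) * lcost X"
    using lcost_mono[OF eval_le_weight[OF X(1,3) env, of C a]] EBin.prems
      lcost_power[of X "weight a"] X(1) by simp
  have vb: "lcost (eval xs b env) \<le> (weight b + 1) * lcost X"
    using lcost_mono[OF eval_le_weight[OF X(1,3) env, of C b]] EBin.prems
      lcost_power[of X "weight b"] X(1) by simp
  have r: "reg s2 d = eval xs a env" using 1 2 by simp
  note e = exec.Seq[OF 1(1) exec.Seq[OF 2(1) exec_bopc[of xs f d d "d + 1" s2]]]
  show ?case
    using e 1 2 va vb r by (auto simp: algebra_simps intro!: exI)
next
  case (EIn a)
  have env: "\<forall>x. env x \<le> X" using EIn.prems by (auto simp: env_stored_def)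
  obtain t1 s1 where 1: "exec xs (compile_exp a \<rho> d) s t1 s1" "t1 \<le> tcoef C a * lcost X"
      "\<forall>r < d. reg s1 r = reg s r" "reg s1 d = eval xs a env" "out s1 = out s"
    using EIn.IH(1)[of \<rho> d env s] EIn.prems by auto
  have va: "lcost (eval xs a env) \<le> (weight a + 1) * lcost X"
    using lcost_mono[OF eval_le_weight[OF X(1,3) env, of C a]] EIn.prems
      lcost_power[of X "weight a"] X(1) by simp
  have "lcost (input_at xs (eval xs a env)) \<le> lcost X"
    using X lcost_pos by (auto simp: input_at_def intro!: lcost_mono)
  then show ?case
    using exec.Seq[OF 1(1) exec.Input[of xs d d s1]] 1 va by (auto simp: algebra_simps intro!: exI)
next
  case (EFold r i cnt ini body)
  define n where "n = eval xs cnt env"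
  define acc where "acc k = eval xs (EFold r i (ECst k) ini body) env" for k
  have nC: "n \<le> C" using EFold.prems by (simp add: n_def)
  have accX: "acc k \<le> X" if "k \<le> n" for k using EFold.prems that by (simp add: acc_def n_def)
  have acc_Suc: "acc (Suc k) = eval xs body (env(r := acc k, i := k))" for k
    by (simp add: acc_def)
  have LX: "1 \<le> lcost X" by (rule lcost_pos)
  obtain t1 s1 where 1: "exec xs (compile_exp ini \<rho> d) s t1 s1" "t1 \<le> tcoef C ini * lcost X"
      "\<forall>r < d. reg s1 r = reg s r" "reg s1 d = acc 0" "out s1 = out s"
    using EFold.IH(2)[of \<rho> d env s] EFold.prems by (auto simp: acc_def)
  have "env_stored X \<rho> (d + 2) env s1"
    using EFold.prems(1) by (rule env_stored_cong) (use 1 in auto)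
  then obtain t2 s2 where 2: "exec xs (compile_exp cnt \<rho> (d + 2)) s1 t2 s2" "t2 \<le> tcoef C cnt * lcost X"
      "\<forall>r < d + 2. reg s2 r = reg s1 r" "reg s2 (d + 2) = n" "out s2 = out s1"
    using EFold.IH(1)[of \<rho> "d + 2" env s1] EFold.prems by (auto simp: n_def)
  define s3 where "s3 = set_reg (d + 1) 0 s2"
  have 3: "exec xs (Const (d + 1) 0) s2 1 s3"
    using exec.Const[of xs "d + 1" 0 s2] by (simp add: s3_def)
  define P where "P k s' \<longleftrightarrow> (\<forall>r < d. reg s' r = reg s r) \<and> reg s' d = acc k \<and>
     reg s' (d + 1) = k \<and> reg s' (d + 2) = n - k \<and> out s' = out s" for k :: nat and s' :: ram
  have P0: "P 0 s3" using 1 2 by (simp add: P_def s3_def)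
  let ?body = "Seq (compile_exp body (\<rho>(r := d, i := d + 1)) (d + 3))
          (Seq (Seq (Const (d + 4) 0) (Add d (d + 3) (d + 4)))
          (Seq (Const (d + 3) 1) (Seq (Add (d + 1) (d + 1) (d + 3)) (Sub (d + 2) (d + 2) (d + 3)))))"
  \<comment> \<open>Outside the body, one iteration takes 8 fixed units (copying the result by
    adding a zero register, increment, decrement) and the lengths of three numbers bounded by
    \<open>X\<close>, hence 11. The loop test makes it the 12 of \<open>tcoef\<close>.\<close>
  have "\<exists>t s'. exec xs ?body u t s' \<and> t \<le> (tcoef C body + 11) * lcost X \<and> P (Suc k) s'"
    if k: "k < n" and Pk: "P k u" for k u
  proof -
    have "env_stored X \<rho> d env u"
      using EFold.prems(1) by (rule env_stored_cong) (use Pk in \<open>auto simp: P_def\<close>)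
    then have "env_stored X (\<rho>(r := d)) (d + 1) (env(r := acc k)) u"
      by (rule env_stored_upd) (use Pk accX k in \<open>auto simp: P_def\<close>)
    then have "env_stored X (\<rho>(r := d, i := d + 1)) (d + 1 + 1) (env(r := acc k, i := k)) u"
      by (rule env_stored_upd) (use Pk k nC X in \<open>auto simp: P_def\<close>)
    then have "env_stored X (\<rho>(r := d, i := d + 1)) (d + 3) (env(r := acc k, i := k)) u"
      by (rule env_stored_cong) auto
    moreover have "vbound xs X C body (env(r := acc k, i := k))"
      using EFold.prems k by (simp add: acc_def n_def)
    ultimately obtain t1 u1 where 1: "exec xs (compile_exp body (\<rho>(r := d, i := d + 1)) (d + 3)) u t1 u1"
        "t1 \<le> tcoef C body * lcost X"
        "\<forall>r < d + 3. reg u1 r = reg u r" "reg u1 (d + 3) = acc (Suc k)" "out u1 = out u"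
      unfolding acc_Suc using EFold.IH(3) by blast
    define u2 where "u2 = set_reg (d + 4) 0 u1"
    have 2: "exec xs (Const (d + 4) 0) u1 1 u2"
      using exec.Const[of xs "d + 4" 0 u1] by (simp add: u2_def)
    define u3 where "u3 = set_reg d (acc (Suc k)) u2"
    have 3: "exec xs (Add d (d + 3) (d + 4)) u2 (lcost (acc (Suc k)) + 1) u3"
      using exec.Add[of xs d "d + 3" "d + 4" u2] 1 by (simp add: u2_def u3_def)
    have "reg u3 (d + 1) = k" "reg u3 (d + 2) = n - k"
      using 1 Pk by (auto simp: u3_def u2_def P_def)
    then have 4: "exec xs (Seq (Const (d + 3) 1) (Seq (Add (d + 1) (d + 1) (d + 3)) (Sub (d + 2) (d + 2) (d + 3))))
        u3 (2 + ((lcost k + 2) + (lcost (n - k) + 2)))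
        (u3\<lparr>reg := (reg u3)(d + 3 := 1, d + 1 := k + 1, d + 2 := n - k - 1)\<rparr>)"
      by (intro loop_step_exec) auto
    have le: "lcost k \<le> lcost X" "lcost (n - k) \<le> lcost X" "lcost (acc (Suc k)) \<le> lcost X"
      using k nC X accX[of "Suc k"] by (auto intro!: lcost_mono)
    have P': "P (Suc k) (u3\<lparr>reg := (reg u3)(d + 3 := 1, d + 1 := k + 1, d + 2 := n - k - 1)\<rparr>)"
      using 1 Pk by (auto simp: P_def u3_def u2_def)
    show ?thesis
      using exec.Seq[OF 1(1) exec.Seq[OF exec.Seq[OF 2 3] 4]] P'
      apply (intro exI conjI)
        apply assumption
      using 1(2) le LX apply (simp add: algebra_simps)
      apply simp
      done
  qed
  then obtain t4 s4 where 4: "exec xs (WhileNZ (d + 2) ?body) s3 t4 s4"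
    "t4 \<le> (\<Sum>k < n. lcost n + (tcoef C body + 11) * lcost X) + 1" "P n s4"
    using while_count_exec[of n P xs ?body "\<lambda>_. (tcoef C body + 11) * lcost X" "d + 2" s3] P0
    by (auto simp: P_def)
  have "(\<Sum>k < n. lcost n + (tcoef C body + 11) * lcost X) = n * (lcost n + (tcoef C body + 11) * lcost X)"
    by simp
  also have "\<dots> \<le> C * ((tcoef C body + 12) * lcost X)"
    using nC X lcost_mono[of n X] by (intro mult_le_mono) (auto simp: algebra_simps)
  finally have t4: "t4 \<le> C * (tcoef C body + 12) * lcost X + 1" using 4(2) by (simp add: mult.assoc)
  have "t1 + (t2 + (1 + t4)) \<le> tcoef C (EFold r i cnt ini body) * lcost X"
    using 1(2) 2(2) t4 LX by (simp add: algebra_simps)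
  moreover have "exec xs (compile_exp (EFold r i cnt ini body) \<rho> d) s (t1 + (t2 + (1 + t4))) s4"
    unfolding compile_exp.simps by (rule exec.Seq[OF 1(1) exec.Seq[OF 2(1) exec.Seq[OF 3 4(1)]]])
  moreover have "eval xs (EFold r i cnt ini body) env = acc n" by (simp add: acc_def n_def)
  ultimately show ?case using 4(3) unfolding P_def by metis
qed

lemma compile_stm_exec:
  assumes X: "X \<ge> 2" "C \<le> X" "\<forall>v \<in> set xs. v \<le> X"
  shows "env_stored X \<rho> d env s \<Longrightarrow> svbound xs X C c env \<Longrightarrow>
    \<exists>t s'. exec xs (compile_stm c \<rho> d) s t s' \<and> t \<le> ssteps xs c env * scoef C c * lcost X \<and>
      (\<forall>r < d. reg s' r = reg s r) \<and> out s' = out s @ outp xs c env"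
proof (induction c arbitrary: \<rho> d env s)
  case (SEmit e)
  have env: "\<forall>x. env x \<le> X" using SEmit.prems by (auto simp: env_stored_def)
  obtain t1 s1 where 1: "exec xs (compile_exp e \<rho> d) s t1 s1" "t1 \<le> tcoef C e * lcost X"
      "\<forall>r < d. reg s1 r = reg s r" "reg s1 d = eval xs e env" "out s1 = out s"
    using compile_exp_exec[OF X, of \<rho> d env s e] SEmit.prems by auto
  have va: "lcost (eval xs e env) \<le> (weight e + 1) * lcost X"
    using lcost_mono[OF eval_le_weight[OF X(1,3) env, of C e]] SEmit.prems
      lcost_power[of X "weight e"] X(1) by simp
  show ?case
    using exec.Seq[OF 1(1) exec.Emit[of xs d s1]] 1 va by (auto simp: algebra_simps intro!: exI)
next
  case (SSeq b c)
  obtain t1 s1 where 1: "exec xs (compile_stm b \<rho> d) s t1 s1" "t1 \<le> ssteps xs b env * scoef C b * lcost X"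
      "\<forall>r < d. reg s1 r = reg s r" "out s1 = out s @ outp xs b env"
    using SSeq.IH(1)[of \<rho> d env s] SSeq.prems by auto
  have "env_stored X \<rho> d env s1"
    using SSeq.prems(1) by (rule env_stored_cong) (use 1 in auto)
  then obtain t2 s2 where 2: "exec xs (compile_stm c \<rho> d) s1 t2 s2" "t2 \<le> ssteps xs c env * scoef C c * lcost X"
      "\<forall>r < d. reg s2 r = reg s1 r" "out s2 = out s1 @ outp xs c env"
    using SSeq.IH(2)[of \<rho> d env s1] SSeq.prems by auto
  have "t1 + t2 \<le> (ssteps xs b env + ssteps xs c env) * (scoef C b + scoef C c) * lcost X"
    using 1(2) 2(2) by (simp add: algebra_simps)
  then show ?case using exec.Seq[OF 1(1) 2(1)] 1 2
    by (intro exI[of _ "t1 + t2"] exI[of _ s2]) simp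
next
  case (SLet r e c)
  obtain t1 s1 where 1: "exec xs (compile_exp e \<rho> d) s t1 s1" "t1 \<le> tcoef C e * lcost X"
      "\<forall>r < d. reg s1 r = reg s r" "reg s1 d = eval xs e env" "out s1 = out s"
    using compile_exp_exec[OF X, of \<rho> d env s e] SLet.prems by auto
  have "env_stored X \<rho> d env s1"
    using SLet.prems(1) by (rule env_stored_cong) (use 1 in auto)
  then have "env_stored X (\<rho>(r := d)) (d + 1) (env(r := eval xs e env)) s1"
    by (rule env_stored_upd) (use 1 SLet.prems in auto)
  then obtain t2 s2 where 2: "exec xs (compile_stm c (\<rho>(r := d)) (d + 1)) s1 t2 s2"
      "t2 \<le> ssteps xs c (env(r := eval xs e env)) * scoef C c * lcost X"
      "\<forall>r < d + 1. reg s2 r = reg s1 r" "out s2 = out s1 @ outp xs c (env(r := eval xs e env))"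
    using SLet.IH[of "\<rho>(r := d)" "d + 1" _ s1] SLet.prems by fastforce
  have "t1 + t2 \<le> (1 + ssteps xs c (env(r := eval xs e env))) * (tcoef C e + scoef C c) * lcost X"
    using 1(2) 2(2) by (simp add: algebra_simps)
  then show ?case using exec.Seq[OF 1(1) 2(1)] 1 2
    by (intro exI[of _ "t1 + t2"] exI[of _ s2]) simp
next
  case (SFor i e c)
  define n where "n = eval xs e env"
  have nX: "n \<le> X" using SFor.prems by (simp add: n_def)
  have LX: "1 \<le> lcost X" by (rule lcost_pos)
  have "env_stored X \<rho> (d + 1) env s"
    using SFor.prems(1) by (rule env_stored_cong) auto
  then obtain t1 s1 where 1: "exec xs (compile_exp e \<rho> (d + 1)) s t1 s1" "t1 \<le> tcoef C e * lcost X"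
      "\<forall>r < d + 1. reg s1 r = reg s r" "reg s1 (d + 1) = n" "out s1 = out s"
    using compile_exp_exec[OF X, of \<rho> "d + 1" env s e] SFor.prems unfolding n_def by fastforce
  define s2 where "s2 = set_reg d 0 s1"
  have 2: "exec xs (Const d 0) s1 1 s2"
    using exec.Const[of xs d 0 s1] by (simp add: s2_def)
  define P where "P k s' \<longleftrightarrow> (\<forall>r < d. reg s' r = reg s r) \<and>
     reg s' d = k \<and> reg s' (d + 1) = n - k \<and>
     out s' = out s @ concat (map (\<lambda>k. outp xs c (env(i := k))) [0..<k])" for k :: nat and s' :: ram
  have P0: "P 0 s2" using 1 by (simp add: P_def s2_def)
  let ?body = "Seq (compile_stm c (\<rho>(i := d)) (d + 2))
        (Seq (Const (d + 2) 1) (Seq (Add d d (d + 2)) (Sub (d + 1) (d + 1) (d + 2))))"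
  \<comment> \<open>Increment and decrement take 6 fixed units and two number lengths, hence 8. The
    loop test makes it 9, and initialisation and final test contribute 2 more, which gives the 11 of
    \<open>scoef\<close>.\<close>
  let ?B = "\<lambda>k. ssteps xs c (env(i := k)) * scoef C c * lcost X + 8 * lcost X"
  have "\<exists>t s'. exec xs ?body u t s' \<and> t \<le> ?B k \<and> P (Suc k) s'"
    if k: "k < n" and Pk: "P k u" for k u
  proof -
    have "env_stored X \<rho> d env u"
      using SFor.prems(1) by (rule env_stored_cong) (use Pk in \<open>auto simp: P_def\<close>)
    then have "env_stored X (\<rho>(i := d)) (d + 1) (env(i := k)) u"
      by (rule env_stored_upd) (use Pk k nX in \<open>auto simp: P_def\<close>)
    then have "env_stored X (\<rho>(i := d)) (d + 2) (env(i := k)) u"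
      by (rule env_stored_cong) auto
    moreover have "svbound xs X C c (env(i := k))"
      using SFor.prems k by (simp add: n_def)
    ultimately obtain t1 u1 where 1: "exec xs (compile_stm c (\<rho>(i := d)) (d + 2)) u t1 u1"
        "t1 \<le> ssteps xs c (env(i := k)) * scoef C c * lcost X"
        "\<forall>r < d + 2. reg u1 r = reg u r" "out u1 = out u @ outp xs c (env(i := k))"
      using SFor.IH by blast
    have "reg u1 d = k" "reg u1 (d + 1) = n - k"
      using 1 Pk by (auto simp: P_def)
    then have 4: "exec xs (Seq (Const (d + 2) 1) (Seq (Add d d (d + 2)) (Sub (d + 1) (d + 1) (d + 2))))
        u1 (2 + ((lcost k + 2) + (lcost (n - k) + 2)))
        (u1\<lparr>reg := (reg u1)(d + 2 := 1, d := k + 1, d + 1 := n - k - 1)\<rparr>)"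
      by (intro loop_step_exec) auto
    have le: "lcost k \<le> lcost X" "lcost (n - k) \<le> lcost X"
      using k nX X by (auto intro!: lcost_mono)
    have P': "P (Suc k) (u1\<lparr>reg := (reg u1)(d + 2 := 1, d := k + 1, d + 1 := n - k - 1)\<rparr>)"
      using 1 Pk by (auto simp: P_def)
    show ?thesis
      using exec.Seq[OF 1(1) 4] P'
      apply (intro exI conjI)
        apply assumption
      using 1(2) le LX apply (simp add: algebra_simps)
      apply simp
      done
  qed
  then obtain t4 s4 where 4: "exec xs (WhileNZ (d + 1) ?body) s2 t4 s4"
    "t4 \<le> (\<Sum>k < n. lcost n + ?B k) + 1" "P n s4"
    using while_count_exec[of n P xs ?body ?B "d + 1" s2] P0
    by (auto simp: P_def)
  have "(\<Sum>k < n. lcost n + ?B k) \<le> (\<Sum>k < n. (1 + ssteps xs c (env(i := k))) * ((scoef C c + 9) * lcost X))"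
    using lcost_mono[OF nX] by (intro sum_mono) (simp add: algebra_simps)
  also have "\<dots> = (\<Sum>k < n. 1 + ssteps xs c (env(i := k))) * ((scoef C c + 9) * lcost X)"
    by (rule sum_distrib_right[symmetric])
  finally have t4: "t4 \<le> (\<Sum>k < n. 1 + ssteps xs c (env(i := k))) * ((scoef C c + 9) * lcost X) + 1"
    using 4(2) by linarith
  have "t1 + (1 + t4) \<le> ssteps xs (SFor i e c) env * scoef C (SFor i e c) * lcost X"
    using 1(2) t4 LX by (simp add: algebra_simps flip: n_def)
  moreover have "exec xs (compile_stm (SFor i e c) \<rho> d) s (t1 + (1 + t4)) s4"
    unfolding compile_stm.simps by (rule exec.Seq[OF 1(1) exec.Seq[OF 2 4(1)]])
  moreover have "out s4 = out s @ outp xs (SFor i e c) env" using 4(3) by (simp add: P_def n_def)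
  ultimately show ?case using 4(3) unfolding P_def by metis
qed

text \<open>Initially all variables share register 0, which holds 0 as they all do. Only registers
  from \<open>d = 1\<close> on are written, so each binding gives its variable a register of its
  own.\<close>

lemma computes_compile_stm:
  assumes "X \<ge> 2" "C \<le> X" "\<forall>v \<in> set xs. v \<le> X" "svbound xs X C c (\<lambda>_. 0)"
  shows "\<exists>t. computes (compile_stm c (\<lambda>_. 0) 1) xs (outp xs c (\<lambda>_. 0)) t \<and>
    t \<le> ssteps xs c (\<lambda>_. 0) * scoef C c * lcost X"
proof -
  have "env_stored X (\<lambda>_. 0) 1 (\<lambda>_. 0) \<lparr>reg = (\<lambda>_. 0), mem = (\<lambda>_. 0), out = []\<rparr>"
    by (simp add: env_stored_def)
  from compile_stm_exec[OF assms(1-3) this assms(4)] show ?thesis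
    unfolding computes_def by fastforce
qed

section \<open>Polynomial dependence of the cost on the fold bound\<close>

definition poly_growth :: "(nat \<Rightarrow> nat) \<Rightarrow> bool" where
  "poly_growth f \<longleftrightarrow> (\<exists>A. \<forall>C. f C \<le> A * (C + 1) ^ A)"

lemma poly_growth_const: "poly_growth (\<lambda>_. k)"
  unfolding poly_growth_def by (intro exI[of _ k]) simp

lemma poly_growth_id: "poly_growth (\<lambda>C. C)"
  unfolding poly_growth_def by (intro exI[of _ 1]) simp

lemma poly_growth_add:
  assumes "poly_growth f" "poly_growth g"
  shows "poly_growth (\<lambda>C. f C + g C)"
proof -
  obtain A B where "\<And>C. f C \<le> A * (C + 1) ^ A" "\<And>C. g C \<le> B * (C + 1) ^ B"
    using assms unfolding poly_growth_def by blast
  moreover have "A * (C + 1) ^ A + B * (C + 1) ^ B \<le> (A + B) * (C + 1) ^ (A + B)" for C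
    unfolding add_mult_distrib by (intro add_mono mult_le_mono power_increasing) auto
  ultimately show ?thesis unfolding poly_growth_def by (meson add_mono le_trans)
qed

lemma poly_growth_mult:
  assumes "poly_growth f" "poly_growth g"
  shows "poly_growth (\<lambda>C. f C * g C)"
proof -
  obtain A B where "\<And>C. f C \<le> A * (C + 1) ^ A" "\<And>C. g C \<le> B * (C + 1) ^ B"
    using assms unfolding poly_growth_def by blast
  then have "f C * g C \<le> (A * (C + 1) ^ A) * (B * (C + 1) ^ B)" for C
    by (intro mult_le_mono)
  moreover have "(A * (C + 1) ^ A) * (B * (C + 1) ^ B) \<le> (A * B + A + B) * (C + 1) ^ (A * B + A + B)" for C
  proof -
    have "(A * (C + 1) ^ A) * (B * (C + 1) ^ B) = A * B * (C + 1) ^ (A + B)"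
      by (simp add: power_add)
    also have "\<dots> \<le> (A * B + A + B) * (C + 1) ^ (A * B + A + B)"
      by (intro mult_le_mono power_increasing) auto
    finally show ?thesis .
  qed
  ultimately show ?thesis unfolding poly_growth_def by (meson le_trans)
qed

lemmas poly_growth_intros = poly_growth_const poly_growth_id poly_growth_add poly_growth_mult

text \<open>Each level of fold nesting multiplies by \<open>C\<close> once, so the degree of the
  polynomial depends on the program alone.\<close>

lemma poly_growth_tcoef: "poly_growth (\<lambda>C. tcoef C e)"
  by (induction e) (simp_all only: tcoef.simps, (intro poly_growth_intros; assumption)+)

lemma poly_growth_scoef: "poly_growth (\<lambda>C. scoef C c)"
  by (induction c) (simp_all only: scoef.simps, (intro poly_growth_intros poly_growth_tcoef; assumption?)+)

section \<open>Growth classes\<close>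

text \<open>Quantifying over fixed \<delta> > 0 removes the null sequence \<epsilon> from later
  estimates. Conversely, \<epsilon> N is the exact exponent for \<open>f N\<close>, the logarithm of
  log f(N) to base log N; the maximum with 1 keeps it nonnegative when \<open>f N\<close> is small
  or 0.\<close>

lemma quasi_const_exp_iff:
  "quasi_const_exp f \<longleftrightarrow> (\<forall>\<delta>>0. \<forall>\<^sub>F N in sequentially. real (f N) \<le> 2 powr (log 2 (real N) powr \<delta>))"
proof
  assume "quasi_const_exp f"
  then obtain \<epsilon> where \<epsilon>: "\<epsilon> \<longlonglongrightarrow> 0"
      "\<forall>\<^sub>F N in sequentially. real (f N) \<le> 2 powr (log 2 (real N) powr \<epsilon> N)"
    unfolding quasi_const_exp_def by blast
  show "\<forall>\<delta>>0. \<forall>\<^sub>F N in sequentially. real (f N) \<le> 2 powr (log 2 (real N) powr \<delta>)"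
  proof (intro allI impI)
    fix \<delta> :: real assume "\<delta> > 0"
    then have "\<forall>\<^sub>F N in sequentially. \<epsilon> N < \<delta>" by (rule order_tendstoD(2)[OF \<epsilon>(1)])
    moreover have "\<forall>\<^sub>F N in sequentially. log 2 (real N) \<ge> 1" by real_asymp
    ultimately show "\<forall>\<^sub>F N in sequentially. real (f N) \<le> 2 powr (log 2 (real N) powr \<delta>)"
      using \<epsilon>(2)
    proof eventually_elim
      case (elim N)
      have "log 2 (real N) powr \<epsilon> N \<le> log 2 (real N) powr \<delta>"
        using elim by (intro powr_mono) auto
      then have "2 powr (log 2 (real N) powr \<epsilon> N) \<le> (2::real) powr (log 2 (real N) powr \<delta>)"
        by (rule powr_mono) auto
      then show ?case using elim by linarith
    qed
  qed
next
  assume *: "\<forall>\<delta>>0. \<forall>\<^sub>F N in sequentially. real (f N) \<le> 2 powr (log 2 (real N) powr \<delta>)"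
  define g where "g N = max 1 (log 2 (real (f N)))" for N
  define \<epsilon> where "\<epsilon> N = log (log 2 (real N)) (g N)" for N
  have big: "\<forall>\<^sub>F N in sequentially. log 2 (real N) > 1" by real_asymp
  have "\<forall>\<^sub>F N in sequentially. \<epsilon> N \<ge> 0"
    using big by eventually_elim (auto simp: \<epsilon>_def g_def)
  moreover have "\<forall>\<^sub>F N in sequentially. \<epsilon> N \<le> \<delta>" if "\<delta> > 0" for \<delta>
    using big *[rule_format, OF that]
  proof eventually_elim
    case (elim N)
    have "log 2 (real (f N)) \<le> log 2 (real N) powr \<delta>"
    proof (cases "f N = 0")
      case False
      then show ?thesis using elim by (subst log_le_iff) auto
    qed (simp add: log_def)
    moreover have "1 \<le> log 2 (real N) powr \<delta>" using elim that by (intro ge_one_powr_ge_zero) auto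
    ultimately have "g N \<le> log 2 (real N) powr \<delta>" by (simp add: g_def)
    then show ?case using elim unfolding \<epsilon>_def by (subst log_le_iff) (auto simp: g_def)
  qed
  ultimately have "\<epsilon> \<longlonglongrightarrow> 0"
    by (intro order_tendstoI) (metis (mono_tags, lifting) eventually_mono less_le_trans,
      metis (mono_tags, lifting) dense eventually_mono le_less_trans)
  moreover have "\<forall>\<^sub>F N in sequentially. real (f N) \<le> 2 powr (log 2 (real N) powr \<epsilon> N)"
    using big
  proof eventually_elim
    case (elim N)
    have "log 2 (real N) powr \<epsilon> N = g N"
      unfolding \<epsilon>_def using elim by (intro powr_log_cancel) (auto simp: g_def)
    moreover have "real (f N) \<le> 2 powr g N"
    proof (cases "f N = 0")
      case False
      then have "real (f N) = 2 powr log 2 (real (f N))" by simp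
      also have "\<dots> \<le> 2 powr g N" by (intro powr_mono) (auto simp: g_def)
      finally show ?thesis .
    qed simp
    ultimately show ?case by simp
  qed
  ultimately show "quasi_const_exp f" unfolding quasi_const_exp_def by blast
qed

lemma eventually_const_le_log_powr:
  assumes "\<delta> > 0"
  shows "\<forall>\<^sub>F N in sequentially. c \<le> log 2 (real N) powr \<delta>"
  using assms by real_asymp

text \<open>Halving \<delta> leaves y >= 2 with y * y = (log N) powr \<delta>, and then y + y <= y *
  y.\<close>

lemma quasi_const_exp_mult:
  assumes "quasi_const_exp f" "quasi_const_exp g"
  shows "quasi_const_exp (\<lambda>N. f N * g N)"
  unfolding quasi_const_exp_iff
proof (intro allI impI)
  fix \<delta> :: real assume \<delta>: "\<delta> > 0"
  have "\<forall>\<^sub>F N in sequentially. real (f N) \<le> 2 powr (log 2 (real N) powr (\<delta> / 2))"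
    "\<forall>\<^sub>F N in sequentially. real (g N) \<le> 2 powr (log 2 (real N) powr (\<delta> / 2))"
    using assms \<delta> unfolding quasi_const_exp_iff by auto
  moreover have "\<forall>\<^sub>F N in sequentially. 2 \<le> log 2 (real N) powr (\<delta> / 2)"
    using \<delta> by (intro eventually_const_le_log_powr) simp
  ultimately show "\<forall>\<^sub>F N in sequentially. real (f N * g N) \<le> 2 powr (log 2 (real N) powr \<delta>)"
  proof eventually_elim
    case (elim N)
    let ?y = "log 2 (real N) powr (\<delta> / 2)"
    have "real (f N * g N) \<le> 2 powr ?y * 2 powr ?y"
      unfolding of_nat_mult using elim by (intro mult_mono) auto
    also have "\<dots> = 2 powr (2 * ?y)" by (simp flip: powr_add)
    also have "\<dots> \<le> 2 powr (?y * ?y)" using elim by (intro powr_mono mult_right_mono) auto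
    also have "?y * ?y = log 2 (real N) powr \<delta>" by (simp flip: powr_add)
    finally show ?case .
  qed
qed

lemma floorlog_le_log: "n > 0 \<Longrightarrow> real (floorlog 2 n) \<le> log 2 (real n) + 1"
  by (simp add: floorlog_def)

text \<open>In terms of y = (log N) powr \<delta>, log N is the fixed power y powr (1 / \<delta>),
  which 2 powr y dominates.\<close>

lemma quasi_const_exp_floorlog: "quasi_const_exp (\<lambda>N. floorlog 2 N + k)"
  unfolding quasi_const_exp_iff
proof (intro allI impI)
  fix \<delta> :: real assume \<delta>: "\<delta> > 0"
  have "\<forall>\<^sub>F y in at_top. y powr p + 1 + real k \<le> 2 powr y" if "p > 0" for p :: real
    using that by real_asymp
  then have "\<forall>\<^sub>F y in at_top. y powr (1 / \<delta>) + 1 + real k \<le> 2 powr y"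
    using \<delta> by simp
  moreover have "filterlim (\<lambda>N. log 2 (real N) powr \<delta>) at_top sequentially"
    using \<delta> by real_asymp
  ultimately have "\<forall>\<^sub>F N in sequentially.
      (log 2 (real N) powr \<delta>) powr (1 / \<delta>) + 1 + real k \<le> 2 powr (log 2 (real N) powr \<delta>)"
    by (rule eventually_compose_filterlim)
  moreover have "\<forall>\<^sub>F N in sequentially. log 2 (real N) \<ge> 1" by real_asymp
  ultimately have "\<forall>\<^sub>F N in sequentially. log 2 (real N) + 1 + real k \<le> 2 powr (log 2 (real N) powr \<delta>)"
  proof eventually_elim
    case (elim N)
    have "(log 2 (real N) powr \<delta>) powr (1 / \<delta>) = log 2 (real N)"
      unfolding powr_powr using \<delta> elim by (simp del: powr_powr)
    then show ?case using elim by simp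
  qed
  moreover have "\<forall>\<^sub>F N in sequentially. N > (0::nat)" by (rule eventually_gt_at_top)
  ultimately show "\<forall>\<^sub>F N in sequentially. real (floorlog 2 N + k) \<le> 2 powr (log 2 (real N) powr \<delta>)"
  proof eventually_elim
    case (elim N)
    then show ?case using floorlog_le_log[of N] by simp
  qed
qed

text \<open>Bounds 2 ^ polylog(n), with a single parameter as coefficient and exponent so that a
  class of functions is described by one existential quantifier. Substituting n = \<open>l N\<close>
  does not leave \<open>quasi_const_exp\<close>.\<close>

definition quasi_poly :: "nat \<Rightarrow> nat \<Rightarrow> nat" where
  "quasi_poly A n = 2 ^ (A * (floorlog 2 n + 1) ^ A)"

lemma quasi_poly_mono: "m \<le> n \<Longrightarrow> quasi_poly A m \<le> quasi_poly A n"
  unfolding quasi_poly_def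
  by (intro power_increasing mult_le_mono power_mono add_mono floorlog_mono) auto

lemma quasi_const_exp_quasi_poly:
  assumes "quasi_const_exp l"
  shows "quasi_const_exp (\<lambda>N. quasi_poly A (l N))"
  unfolding quasi_const_exp_iff
proof (intro allI impI)
  fix \<delta> :: real assume \<delta>: "\<delta> > 0"
  \<comment> \<open>The exponent \<open>A\<close> of the polylogarithm multiplies \<delta>', which
    may use up half of \<delta>. The other half absorbs the constant A * 3 ^ A, where 3 comes from y
    + 2 <= 3 * y for y >= 1.\<close>
  define \<delta>' where "\<delta>' = \<delta> / (2 * (real A + 1))"
  have \<delta>': "\<delta>' > 0" "\<delta>' * A \<le> \<delta> / 2" using \<delta> by (auto simp: \<delta>'_def field_simps)
  have "\<forall>\<^sub>F N in sequentially. real (l N) \<le> 2 powr (log 2 (real N) powr \<delta>')"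
    using assms \<delta>' unfolding quasi_const_exp_iff by auto
  moreover have "\<forall>\<^sub>F N in sequentially. real A * 3 ^ A \<le> log 2 (real N) powr (\<delta> / 2)"
    using \<delta> by (intro eventually_const_le_log_powr) simp
  moreover have "\<forall>\<^sub>F N in sequentially. 1 \<le> log 2 (real N) powr \<delta>'"
    using \<delta>' by (intro eventually_const_le_log_powr) simp
  moreover have "\<forall>\<^sub>F N in sequentially. log 2 (real N) \<ge> 1" by real_asymp
  ultimately show "\<forall>\<^sub>F N in sequentially. real (quasi_poly A (l N)) \<le> 2 powr (log 2 (real N) powr \<delta>)"
  proof eventually_elim
    case (elim N)
    let ?y = "log 2 (real N) powr \<delta>'"
    have "real (floorlog 2 (l N)) \<le> ?y + 1"
    proof (cases "l N = 0")
      case False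
      then have "log 2 (real (l N)) \<le> ?y" using elim by (subst log_le_iff) auto
      then show ?thesis using floorlog_le_log[of "l N"] False by simp
    qed (simp add: floorlog_def)
    then have "real (floorlog 2 (l N) + 1) \<le> 3 * ?y" using elim by simp
    then have "real (floorlog 2 (l N) + 1) ^ A \<le> (3 * ?y) ^ A" by (intro power_mono) auto
    then have "real A * real (floorlog 2 (l N) + 1) ^ A \<le> real A * (3 * ?y) ^ A"
      by (intro mult_left_mono) auto
    also have "\<dots> = (real A * 3 ^ A) * ?y ^ A" by (simp add: power_mult_distrib)
    also have "?y ^ A = log 2 (real N) powr (\<delta>' * A)"
      using elim by (simp add: powr_powr flip: powr_realpow)
    also have "(real A * 3 ^ A) * log 2 (real N) powr (\<delta>' * A)
       \<le> log 2 (real N) powr (\<delta> / 2) * log 2 (real N) powr (\<delta> / 2)"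
      using elim \<delta>' by (intro mult_mono powr_mono) auto
    also have "\<dots> = log 2 (real N) powr \<delta>" by (simp flip: powr_add)
    finally have "real (A * (floorlog 2 (l N) + 1) ^ A) \<le> log 2 (real N) powr \<delta>" by simp
    then have "2 powr real (A * (floorlog 2 (l N) + 1) ^ A) \<le> 2 powr (log 2 (real N) powr \<delta>)"
      by (intro powr_mono) auto
    then show ?case unfolding quasi_poly_def
      by (simp only: powr_realpow of_nat_power of_nat_numeral zero_less_numeral)
  qed
qed

lemma near_linear_mult_quasi_const_exp:
  assumes "quasi_const_exp f"
  shows "near_linear (\<lambda>N. N * f N)"
proof -
  obtain \<epsilon> where \<epsilon>: "\<epsilon> \<longlonglongrightarrow> 0"
      "\<forall>\<^sub>F N in sequentially. real (f N) \<le> 2 powr (log 2 (real N) powr \<epsilon> N)"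
    using assms unfolding quasi_const_exp_def by blast
  \<comment> \<open>Chosen so that log N * \<epsilon>' N = (log N) powr \<epsilon> N. It tends to 0
    because the exponent \<epsilon> N - 1 is eventually below -1/2.\<close>
  define \<epsilon>' where "\<epsilon>' N = log 2 (real N) powr (\<epsilon> N - 1)" for N
  have "\<epsilon>' \<longlonglongrightarrow> 0"
  proof (rule tendsto_sandwich)
    show "\<forall>\<^sub>F N in sequentially. 0 \<le> \<epsilon>' N" by (simp add: \<epsilon>'_def)
    have "\<forall>\<^sub>F N in sequentially. \<epsilon> N < 1 / 2" by (rule order_tendstoD(2)[OF \<epsilon>(1)]) simp
    moreover have "\<forall>\<^sub>F N in sequentially. log 2 (real N) \<ge> 1" by real_asymp
    ultimately show "\<forall>\<^sub>F N in sequentially. \<epsilon>' N \<le> log 2 (real N) powr (- (1 / 2))"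
      by eventually_elim (auto simp: \<epsilon>'_def intro!: powr_mono)
    show "(\<lambda>N. log 2 (real N) powr (- (1 / 2))) \<longlonglongrightarrow> 0" by real_asymp
  qed auto
  moreover have "\<forall>\<^sub>F N in sequentially. log 2 (real N) \<ge> 1" by real_asymp
  then have "\<forall>\<^sub>F N in sequentially. real (N * f N) \<le> real N powr (1 + \<epsilon>' N)"
    using \<epsilon>(2)
  proof eventually_elim
    case (elim N)
    have N: "real N > 0" using elim by (cases "N = 0") (auto simp: log_def)
    have "log 2 (real N) * \<epsilon>' N = log 2 (real N) powr 1 * log 2 (real N) powr (\<epsilon> N - 1)"
      using elim by (subst powr_one) (auto simp: \<epsilon>'_def)
    also have "\<dots> = log 2 (real N) powr \<epsilon> N" by (subst powr_add[symmetric]) simp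
    finally have "2 powr (log 2 (real N) powr \<epsilon> N) = (2 powr log 2 (real N)) powr \<epsilon>' N"
      by (simp add: powr_powr)
    also have "\<dots> = real N powr \<epsilon>' N" using N by simp
    finally have "real (f N) \<le> real N powr \<epsilon>' N" using elim by simp
    then have "real N * real (f N) \<le> real N * real N powr \<epsilon>' N" by (intro mult_left_mono) auto
    then show ?case using N by (simp add: powr_add)
  qed
  ultimately show ?thesis unfolding near_linear_def by blast
qed

definition quasi_poly_bounded :: "(nat \<Rightarrow> nat) \<Rightarrow> bool" where
  "quasi_poly_bounded f \<longleftrightarrow> (\<exists>A. \<forall>n. f n \<le> quasi_poly A n)"

lemma quasi_poly_bounded_exp2:
  assumes "poly_growth f"
  shows "quasi_poly_bounded (\<lambda>n. 2 ^ f (floorlog 2 n))"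
  proof -
  obtain A where "\<And>C. f C \<le> A * (C + 1) ^ A" using assms unfolding poly_growth_def by blast
  then have "2 ^ f (floorlog 2 n) \<le> quasi_poly A n" for n
    unfolding quasi_poly_def by (intro power_increasing) auto
  then show ?thesis unfolding quasi_poly_bounded_def by blast
qed

lemma quasi_poly_bounded_mono:
  assumes "quasi_poly_bounded g" "\<And>n. f n \<le> g n"
  shows "quasi_poly_bounded f"
  using assms unfolding quasi_poly_bounded_def by (meson le_trans)

lemma quasi_poly_bounded_const: "quasi_poly_bounded (\<lambda>_. k)"
  by (rule quasi_poly_bounded_mono[OF quasi_poly_bounded_exp2[OF poly_growth_const[of k]]])
    (simp add: less_imp_le)

lemma quasi_poly_bounded_id: "quasi_poly_bounded (\<lambda>n. n)"
proof (rule quasi_poly_bounded_mono[OF quasi_poly_bounded_exp2[OF poly_growth_id]])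
  show "n \<le> 2 ^ floorlog 2 n" for n
    by (cases "n = 0") (auto simp: floorlog_bounds less_imp_le)
qed

lemma quasi_poly_bounded_mult:
  assumes "quasi_poly_bounded f" "quasi_poly_bounded g"
  shows "quasi_poly_bounded (\<lambda>n. f n * g n)"
proof -
  obtain A B where AB: "\<And>n. f n \<le> quasi_poly A n" "\<And>n. g n \<le> quasi_poly B n"
    using assms unfolding quasi_poly_bounded_def by blast
  have "poly_growth (\<lambda>b. A * (b + 1) ^ A)" "poly_growth (\<lambda>b. B * (b + 1) ^ B)"
    unfolding poly_growth_def by blast+
  then have "quasi_poly_bounded (\<lambda>n. 2 ^ (A * (floorlog 2 n + 1) ^ A + B * (floorlog 2 n + 1) ^ B))"
    by (intro quasi_poly_bounded_exp2[of "\<lambda>b. A * (b + 1) ^ A + B * (b + 1) ^ B"] poly_growth_add)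
  moreover have "f n * g n \<le> 2 ^ (A * (floorlog 2 n + 1) ^ A + B * (floorlog 2 n + 1) ^ B)" for n
    using mult_le_mono[OF AB] unfolding power_add quasi_poly_def .
  ultimately show ?thesis by (rule quasi_poly_bounded_mono)
qed

lemma quasi_poly_bounded_add:
  assumes "quasi_poly_bounded f" "quasi_poly_bounded g"
  shows "quasi_poly_bounded (\<lambda>n. f n + g n)"
proof -
  obtain A B where AB: "\<And>n. f n \<le> quasi_poly A n" "\<And>n. g n \<le> quasi_poly B n"
    using assms unfolding quasi_poly_bounded_def by blast
  have "quasi_poly_bounded (\<lambda>n. 2 * (quasi_poly A n * quasi_poly B n))"
    by (intro quasi_poly_bounded_mult quasi_poly_bounded_const)
      (auto simp: quasi_poly_bounded_def)
  moreover have "f n + g n \<le> 2 * (quasi_poly A n * quasi_poly B n)" for n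
  proof -
    have "1 \<le> quasi_poly A n" "1 \<le> quasi_poly B n" by (auto simp: quasi_poly_def)
    then have "quasi_poly A n \<le> quasi_poly A n * quasi_poly B n"
      "quasi_poly B n \<le> quasi_poly A n * quasi_poly B n" by auto
    then show ?thesis using AB[of n] by linarith
  qed
  ultimately show ?thesis by (rule quasi_poly_bounded_mono)
qed

lemma quasi_poly_bounded_power:
  "quasi_poly_bounded f \<Longrightarrow> quasi_poly_bounded (\<lambda>n. f n ^ k)"
  by (induction k) (auto intro: quasi_poly_bounded_const quasi_poly_bounded_mult)

lemmas quasi_poly_bounded_intros = quasi_poly_bounded_const quasi_poly_bounded_id
  quasi_poly_bounded_add quasi_poly_bounded_mult quasi_poly_bounded_power

section \<open>Branching programs for reachability and non-reachability\<close>

text \<open>Every tuple (t, u, v, m) yields exactly one edge, which leads to v or to the dead node v + W.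
  So the number of edges, which precedes them in the encoding, is known beforehand.\<close>

definition bp_edge :: "nat \<Rightarrow> (nat \<Rightarrow> nat \<Rightarrow> nat \<Rightarrow> bool \<Rightarrow> bool) \<Rightarrow> nat \<Rightarrow> nat \<times> nat \<times> nat \<times> bool" where
  "bp_edge W ed e =
     (let m = odd e; v = e div 2 mod W; u = e div 2 div W mod W; t = e div 2 div W div W
      in (t, u, v + (if ed t u v m then 0 else W), m))"

definition mk_bp :: "nat \<Rightarrow> nat \<Rightarrow> nat \<Rightarrow> (nat \<Rightarrow> nat \<Rightarrow> nat \<Rightarrow> bool \<Rightarrow> bool) \<Rightarrow> bp" where
  "mk_bp V W T ed = \<lparr>bp_vars = V, bp_length = T + 1, bp_width = 2 * W,
     bp_labels = map (\<lambda>t. t mod V) [0..<T],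
     bp_edges = map (bp_edge W ed) [0..<2 * (W * (W * T))]\<rparr>"

lemma bp_edge_code:
  assumes "u < W" "v < W"
  shows "bp_edge W ed (2 * (W * (W * t + u) + v) + of_bool m)
    = (t, u, v + (if ed t u v m then 0 else W), m)"
  using assms by (simp add: bp_edge_def Let_def)

lemma bp_edge_code_less:
  fixes t T u v W m :: nat
  assumes "t < T" "u < W" "v < W" "m < 2"
  shows "2 * (W * (W * t + u) + v) + m < 2 * (W * (W * T))"
proof -
  have *: "a * x + y < a * z" if "x < z" "y < a" for a x y z :: nat
  proof -
    have "a * x + y < a * (x + 1)" using that by simp
    also have "\<dots> \<le> a * z" using that by (intro mult_le_mono) auto
    finally show ?thesis .
  qed
  show ?thesis using assms by (intro *)
qed

lemma bp_edge_code_surj: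
  fixes e W T :: nat
  assumes "e < 2 * (W * (W * T))"
  obtains t u v m where "e = 2 * (W * (W * t + u) + v) + of_bool m" "t < T" "u < W" "v < W"
proof
  have W: "W > 0" using assms by (cases W) auto
  show "e = 2 * (W * (W * (e div 2 div W div W) + e div 2 div W mod W) + e div 2 mod W) + of_bool (odd e)"
    by (simp add: algebra_simps)
  show "e div 2 div W mod W < W" "e div 2 mod W < W" using W by auto
  have "e div 2 < W * (W * T)" using assms by auto
  then have "e div 2 div W < W * T" by (simp add: less_mult_imp_div_less mult.commute)
  then show "e div 2 div W div W < T" by (simp add: less_mult_imp_div_less mult.commute)
qed

lemma in_bp_edges_mk_bp:
  "(t, u, v', m) \<in> set (bp_edges (mk_bp V W T ed)) \<longleftrightarrow>
     t < T \<and> u < W \<and> (\<exists>v < W. v' = v + (if ed t u v m then 0 else W))"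
proof
  assume "(t, u, v', m) \<in> set (bp_edges (mk_bp V W T ed))"
  then obtain e where e: "e < 2 * (W * (W * T))" "(t, u, v', m) = bp_edge W ed e"
    by (auto simp: mk_bp_def)
  from e(1) obtain t' u' w m' where "e = 2 * (W * (W * t' + u') + w) + of_bool m'" "t' < T" "u' < W" "w < W"
    by (rule bp_edge_code_surj)
  then show "t < T \<and> u < W \<and> (\<exists>v < W. v' = v + (if ed t u v m then 0 else W))"
    using e(2) bp_edge_code[of u' W w ed t' m'] by auto
next
  assume *: "t < T \<and> u < W \<and> (\<exists>v < W. v' = v + (if ed t u v m then 0 else W))"
  then obtain v where v: "v < W" "v' = v + (if ed t u v m then 0 else W)" by blast
  show "(t, u, v', m) \<in> set (bp_edges (mk_bp V W T ed))"
    using * v bp_edge_code[of u W v ed t m] bp_edge_code_less[of t T u W v "of_bool m"]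
    unfolding mk_bp_def
    by (auto intro!: image_eqI[of _ _ "2 * (W * (W * t + u) + v) + of_bool m"])
qed

lemma inj_on_bp_edge: "inj_on (bp_edge W ed) {..<2 * (W * (W * T))}"
proof (rule inj_onI)
  fix e e' assume *: "e \<in> {..<2 * (W * (W * T))}" "e' \<in> {..<2 * (W * (W * T))}"
    "bp_edge W ed e = bp_edge W ed e'"
  obtain t u v m where 1: "e = 2 * (W * (W * t + u) + v) + of_bool m" "t < T" "u < W" "v < W"
    using *(1) by (auto elim: bp_edge_code_surj)
  obtain t' u' v' m' where 2: "e' = 2 * (W * (W * t' + u') + v') + of_bool m'" "t' < T" "u' < W" "v' < W"
    using *(2) by (auto elim: bp_edge_code_surj)
  show "e = e'"
    using *(3) 1 2 bp_edge_code[of u W v ed t m] bp_edge_code[of u' W v' ed t' m']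
    by (auto split: if_splits)
qed

lemma bp_wf_mk_bp:
  assumes "V > 0" "W > 0"
  shows "bp_wf (mk_bp V W T ed)"
proof -
  have "distinct (bp_edges (mk_bp V W T ed))"
    using inj_on_bp_edge[of W ed T] by (simp add: mk_bp_def distinct_map atLeast0LessThan)
  moreover have "i < T \<and> u < 2 * W \<and> v < 2 * W" if "(i, u, v, m) \<in> set (bp_edges (mk_bp V W T ed))"
    for i u v m using that unfolding in_bp_edges_mk_bp by auto
  moreover have "bp_length (mk_bp V W T ed) = T + 1" "bp_width (mk_bp V W T ed) = 2 * W"
    "bp_vars (mk_bp V W T ed) = V" "bp_labels (mk_bp V W T ed) = map (\<lambda>t. t mod V) [0..<T]"
    by (simp_all add: mk_bp_def)
  ultimately show ?thesis
    using assms unfolding bp_wf_def by auto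
qed

lemma bp_size_mk_bp: "bp_size (mk_bp V W T ed) = 2 * (W * (W * T))"
  by (simp add: bp_size_def mk_bp_def)

text \<open>No edge leaves a dead node and paths have to end in node 0 < \<open>W\<close>, so an
  accepting path avoids all nodes from \<open>W\<close> on.\<close>

lemma bp_accepts_mk_bp:
  assumes "W > 0"
  shows "bp_accepts (mk_bp V W T ed) x \<longleftrightarrow>
    (\<exists>p. p 0 = 0 \<and> p T = 0 \<and> (\<forall>t \<le> T. p t < W) \<and> (\<forall>t < T. ed t (p t) (p (t + 1)) (x ! (t mod V))))"
    (is "_ \<longleftrightarrow> ?R")
proof
  have len: "bp_length (mk_bp V W T ed) - 1 = T" by (simp add: mk_bp_def)
  have lab: "bp_labels (mk_bp V W T ed) ! t = t mod V" if "t < T" for t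
    using that by (simp add: mk_bp_def)
  {
    assume "bp_accepts (mk_bp V W T ed) x"
    then obtain p where p: "p 0 = 0" "p T = 0"
      "\<And>t. t < T \<Longrightarrow> (t, p t, p (t + 1), x ! (t mod V)) \<in> set (bp_edges (mk_bp V W T ed))"
      unfolding bp_accepts_def len using lab by auto
    have lt: "p t < W" if "t \<le> T" for t
      using p that assms unfolding in_bp_edges_mk_bp by (cases "t = T") auto
    have "ed t (p t) (p (t + 1)) (x ! (t mod V))" if t: "t < T" for t
    proof -
      obtain v where v: "v < W" "p (t + 1) = v + (if ed t (p t) v (x ! (t mod V)) then 0 else W)"
        using p(3)[OF t] unfolding in_bp_edges_mk_bp by auto
      moreover have "p (t + 1) < W" using lt t by simp
      ultimately show ?thesis by (auto split: if_splits)
    qed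
    then show ?R using p lt by blast
  next
    assume ?R
    then show "bp_accepts (mk_bp V W T ed) x"
      unfolding bp_accepts_def len using lab
      by (auto simp: in_bp_edges_mk_bp) (metis Suc_leI less_imp_le_nat add_0_right)
  }
qed

text \<open>A walk in a relation whose edges can each be tested by reading a single input bit: the
  program sweeps over all variables and moves along an edge when its bit comes up.\<close>

definition walk_edge :: "(nat \<Rightarrow> nat \<Rightarrow> nat \<Rightarrow> bool \<Rightarrow> bool) \<Rightarrow> nat \<Rightarrow> nat \<Rightarrow> nat \<Rightarrow> nat \<Rightarrow> nat \<Rightarrow> bool \<Rightarrow> bool" where
  "walk_edge ok V S t u v m \<longleftrightarrow> (if t < V * S then u = v \<or> ok u v (t mod V) m else u = 1)"

text \<open>Bit 0 is left out because it is a padding bit; the program for non-reachability uses the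
  layers that read it to revise its claims.\<close>

definition bit_rel :: "(nat \<Rightarrow> nat \<Rightarrow> nat \<Rightarrow> bool \<Rightarrow> bool) \<Rightarrow> nat \<Rightarrow> nat \<Rightarrow> bool list \<Rightarrow> nat \<Rightarrow> nat \<Rightarrow> bool" where
  "bit_rel ok V S x u v \<longleftrightarrow> u < S \<and> v < S \<and> (\<exists>j. 0 < j \<and> j < V \<and> ok u v j (x ! j))"

text \<open>On a path without repetitions the vertices after the start are distinct numbers below
  \<open>S\<close>.\<close>

lemma rtrancl_path_length_bound:
  assumes "r\<^sup>*\<^sup>* (u::nat) v" "\<And>a b. r a b \<Longrightarrow> b < S"
  shows "\<exists>k \<le> S. (r ^^ k) u v"
proof -
  obtain xs where "rtrancl_path r u xs v" using assms(1) by (auto simp: rtranclp_eq_rtrancl_path)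
  then obtain ys where ys: "rtrancl_path r u ys v" "distinct (u # ys)"
    by (rule rtrancl_path_distinct)
  have "set ys \<subseteq> {..<S}" and "(r ^^ length ys) u v"
    using ys(1)
  proof (induction rule: rtrancl_path.induct)
    case (step a b ys c)
    { case 1 then show ?case using step assms(2) by auto }
    { case 2 then show ?case using step relpowp_Suc_I2[of r a b "length ys" c] by simp }
  qed auto
  moreover have "length ys \<le> S"
    using calculation(1) ys(2) card_mono[of "{..<S}" "set ys"] by (simp add: distinct_card)
  ultimately show ?thesis by blast
qed

text \<open>One sweep per step suffices, hence \<open>S\<close> sweeps; one more layer joins the
  target 1 to node 0, where paths have to end. The hypothesis on bit 0 makes its layers harmless: a
  move permitted there is permitted by bit 1 too and so belongs to \<open>bit_rel\<close>.\<close>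

lemma walk_accepts:
  assumes S: "S > 1" and V: "V > 1"
    and ok0: "\<And>u v. ok u v 0 (x ! 0) \<Longrightarrow> ok u v 1 (x ! 1)"
  shows "bp_accepts (mk_bp V S (V * S + 1) (walk_edge ok V S)) x \<longleftrightarrow> (bit_rel ok V S x)\<^sup>*\<^sup>* 0 1"
proof -
  let ?r = "bit_rel ok V S x"
  let ?T = "V * S"
  have acc: "bp_accepts (mk_bp V S (V * S + 1) (walk_edge ok V S)) x \<longleftrightarrow>
    (\<exists>p. p 0 = 0 \<and> p (?T + 1) = 0 \<and> (\<forall>t \<le> ?T + 1. p t < S) \<and>
      (\<forall>t < ?T + 1. walk_edge ok V S t (p t) (p (t + 1)) (x ! (t mod V))))"
    using S by (intro bp_accepts_mk_bp) simp
  show ?thesis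
  proof
    assume "bp_accepts (mk_bp V S (V * S + 1) (walk_edge ok V S)) x"
    then obtain p where p: "p 0 = 0" "\<And>t. t \<le> ?T + 1 \<Longrightarrow> p t < S"
      "\<And>t. t < ?T + 1 \<Longrightarrow> walk_edge ok V S t (p t) (p (t + 1)) (x ! (t mod V))"
      unfolding acc by blast
    have "?r\<^sup>*\<^sup>* 0 (p t)" if "t \<le> ?T" for t
      using that
    proof (induction t)
      case (Suc t)
      have "p t = p (Suc t) \<or> ok (p t) (p (Suc t)) (t mod V) (x ! (t mod V))"
        using p(3)[of t] Suc.prems by (simp add: walk_edge_def)
      moreover have "\<exists>j. 0 < j \<and> j < V \<and> ok (p t) (p (Suc t)) j (x ! j)"
        if "ok (p t) (p (Suc t)) (t mod V) (x ! (t mod V))"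
        using that ok0 V by (cases "t mod V = 0") (auto intro: exI[of _ "t mod V"])
      ultimately have "p t = p (Suc t) \<or> ?r (p t) (p (Suc t))"
        using p(2) Suc.prems unfolding bit_rel_def by auto
      then show ?case using Suc by (auto intro: rtranclp.rtrancl_into_rtrancl)
    qed (simp add: p)
    moreover have "p ?T = 1" using p(3)[of ?T] by (simp add: walk_edge_def)
    ultimately show "?r\<^sup>*\<^sup>* 0 1" by (metis order_refl)
  next
    assume "?r\<^sup>*\<^sup>* 0 1"
    then obtain k where k: "k \<le> S" "(?r ^^ k) 0 1"
      using rtrancl_path_length_bound[of ?r 0 1 S] by (auto simp: bit_rel_def)
    then obtain f where f: "f 0 = 0" "f k = 1" "\<And>i. i < k \<Longrightarrow> ?r (f i) (f (Suc i))"
      unfolding relpowp_fun_conv by blast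
    \<comment> \<open>The walk waits at the target 1 from step \<open>k\<close> on, so that each of
      the \<open>S\<close> sweeps has a prescribed start and end.\<close>
    define g where "g i = (if i < k then f i else 1)" for i
    have g: "g (Suc i) = g i \<or> ?r (g i) (g (Suc i))" for i
      using f by (auto simp: g_def) (metis Suc_lessI)
    define J where "J i = (SOME j. 0 < j \<and> j < V \<and> ok (g i) (g (Suc i)) j (x ! j))" for i
    have J: "0 < J i \<and> J i < V \<and> ok (g i) (g (Suc i)) (J i) (x ! J i)" if "g (Suc i) \<noteq> g i" for i
    proof -
      have "\<exists>j. 0 < j \<and> j < V \<and> ok (g i) (g (Suc i)) j (x ! j)"
        using g[of i] that unfolding bit_rel_def by auto
      then show ?thesis unfolding J_def by (rule someI_ex)
    qed
    have gS: "g i < S" for i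
    proof (cases "i < k")
      case True then show ?thesis using f(3)[of i] by (simp add: g_def bit_rel_def)
    qed (use S in \<open>simp add: g_def\<close>)
    have gend: "g S = 1" using k by (simp add: g_def)
    \<comment> \<open>In sweep i the program stands at \<open>g i\<close> up to and including the
      layer that reads bit \<open>J i\<close>, and at \<open>g (Suc i)\<close> afterwards. If the
      two coincide, the value of \<open>J i\<close> is irrelevant.\<close>
    define p where "p t = (if t = ?T + 1 then 0 else
      if t mod V \<le> J (t div V) then g (t div V) else g (Suc (t div V)))" for t
    have "k > 0" using f by (cases k) auto
    then have "p 0 = 0" "p (?T + 1) = 0" using f by (auto simp: p_def g_def)
    moreover have "p t < S" for t using gS S by (simp add: p_def)
    moreover have "walk_edge ok V S t (p t) (p (t + 1)) (x ! (t mod V))" if "t < ?T + 1" for t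
    proof (cases "t < ?T")
      case True
      define i j where "i = t div V" and "j = t mod V"
      have t: "t = i * V + j" "j < V" using V by (auto simp: i_def j_def)
      have pt: "p t = (if j \<le> J i then g i else g (Suc i))"
        using True by (simp add: p_def i_def j_def)
      have "p (t + 1) = p t \<or> ok (p t) (p (t + 1)) j (x ! j)"
      proof (cases "Suc j < V")
        case True
        then have "(t + 1) div V = i" "(t + 1) mod V = Suc j"
          using t by (auto simp: div_nat_eqI)
        then have "p (t + 1) = (if Suc j \<le> J i then g i else g (Suc i))"
          using \<open>t < ?T\<close> by (simp add: p_def)
        then show ?thesis using pt J[of i] by (cases "g (Suc i) = g i"; cases "j = J i") auto
      next
        case False
        then have j: "Suc j = V" using t by simp
        then have "t + 1 = Suc i * V" using t by simp
        then have "(t + 1) div V = Suc i" "(t + 1) mod V = 0" using V by (simp_all only: nonzero_mult_div_cancel_right mod_mult_self2_is_0)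
        then have "p (t + 1) = g (Suc i)"
          using \<open>t < ?T\<close> by (simp add: p_def)
        then show ?thesis using pt J[of i] j by (cases "g (Suc i) = g i"; cases "j = J i") auto
      qed
      then show ?thesis using True by (auto simp: walk_edge_def j_def)
    next
      case False
      then have "t = ?T" using that by simp
      then have "p t = g S" using V by (simp add: p_def)
      then show ?thesis using False gend by (simp add: walk_edge_def)
    qed
    ultimately show "bp_accepts (mk_bp V S (V * S + 1) (walk_edge ok V S)) x"
      unfolding acc by blast
  qed
qed

text \<open>Savitch's recursion for non-reachability: for every midpoint \<open>w\<close> one of the two halves fails.
  The digits of \<open>i\<close> to base \<open>S\<close> list the midpoints, the bits of \<open>c\<close> say which half is claimed to
  fail. Time enumerates all \<open>i\<close>, and the claim on level \<open>k\<close> may depend on the midpoints on the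
  levels from \<open>k\<close> on only, that is, it may be revised only when \<open>S ^ k\<close> divides \<open>i\<close>.\<close>

fun savitch_leaf :: "nat \<Rightarrow> nat \<Rightarrow> nat \<Rightarrow> nat \<Rightarrow> nat \<times> nat \<Rightarrow> nat \<times> nat" where
  "savitch_leaf S 0 i c uv = uv"
| "savitch_leaf S (Suc k) i c uv =
     savitch_leaf S k i c (if even (c div 2 ^ k) then (fst uv, i div S ^ k mod S) else (i div S ^ k mod S, snd uv))"

definition savitch_agree :: "nat \<Rightarrow> nat \<Rightarrow> nat \<Rightarrow> nat \<Rightarrow> nat \<Rightarrow> bool" where
  "savitch_agree S k i c c' \<longleftrightarrow> (\<forall>l < k. \<not> S ^ l dvd i \<longrightarrow> c div 2 ^ l = c' div 2 ^ l)"

fun unreachable :: "(nat \<Rightarrow> nat \<Rightarrow> bool) \<Rightarrow> nat \<Rightarrow> nat \<Rightarrow> nat \<Rightarrow> nat \<Rightarrow> bool" where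
  "unreachable r S 0 u v \<longleftrightarrow> \<not> (u = v \<or> r u v)"
| "unreachable r S (Suc k) u v \<longleftrightarrow> (\<forall>w < S. unreachable r S k u w \<or> unreachable r S k w v)"

abbreviation leaf_fails :: "(nat \<Rightarrow> nat \<Rightarrow> bool) \<Rightarrow> nat \<Rightarrow> nat \<Rightarrow> nat \<Rightarrow> nat \<Rightarrow> nat \<times> nat \<Rightarrow> bool" where
  "leaf_fails r S k i c uv \<equiv>
     unreachable r S 0 (fst (savitch_leaf S k i c uv)) (snd (savitch_leaf S k i c uv))"

text \<open>Level l reads only digit l of the index and bit l of the claim. Hence the index within a
  block can replace the full index when the recursion descends.\<close>

lemma savitch_leaf_cong:
  assumes "S > 0" "i mod S ^ k = i' mod S ^ k" "c mod 2 ^ k = c' mod 2 ^ k"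
  shows "savitch_leaf S k i c uv = savitch_leaf S k i' c' uv"
  using assms
proof (induction k arbitrary: uv)
  case (Suc k)
  have dm: "(a div b ^ k) mod b = (a' div b ^ k) mod b" "a mod b ^ k = a' mod b ^ k"
    if "a mod b ^ Suc k = a' mod b ^ Suc k" for a a' b :: nat
  proof -
    have "(x div b ^ k) mod b = (x mod b ^ Suc k) div b ^ k" for x
      by (cases "b ^ k = 0") (auto simp: mod_mult2_eq mult.commute[of b])
    then show "(a div b ^ k) mod b = (a' div b ^ k) mod b" using that by metis
    have "b ^ k dvd b ^ Suc k" by simp
    then show "a mod b ^ k = a' mod b ^ k" using that by (metis mod_mod_cancel)
  qed
  have "i div S ^ k mod S = i' div S ^ k mod S" "i mod S ^ k = i' mod S ^ k"
    using dm[OF Suc.prems(2)] by auto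
  moreover have "even (c div 2 ^ k) = even (c' div 2 ^ k)" "c mod 2 ^ k = c' mod 2 ^ k"
    using dm[OF Suc.prems(3)] by (auto simp: even_iff_mod_2_eq_zero)
  ultimately show ?case using Suc.IH Suc.prems(1) by simp
qed simp

text \<open>The indices with leading digit \<open>w\<close> form a block of length
  \<open>S ^ k\<close>. In it \<open>S ^ k\<close> divides no index but the first, so bit
  \<open>k\<close> of the claims is constant there and names one half; the lower bits are a claim
  sequence showing that this half fails.\<close>

lemma savitch_sound:
  assumes "S > 0"
    and "\<And>i. i < S ^ k \<Longrightarrow> leaf_fails r S k i (c i) (u, v)"
    and "\<And>i. Suc i < S ^ k \<Longrightarrow> savitch_agree S k (Suc i) (c i) (c (Suc i))"
  shows "unreachable r S k u v"
  using assms(2,3)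
proof (induction k arbitrary: u v c)
  case 0
  then show ?case by simp
next
  case (Suc k)
  show ?case unfolding unreachable.simps(2)
  proof (intro allI impI)
    fix w assume w: "w < S"
    define c' where "c' i = c (w * S ^ k + i)" for i
    have lt: "w * S ^ k + i < S ^ Suc k" if "i < S ^ k" for i
    proof -
      have "w * S ^ k + i < (w + 1) * S ^ k" using that by simp
      also have "\<dots> \<le> S * S ^ k" using w by (intro mult_le_mono1) simp
      finally show ?thesis by simp
    qed
    have const: "c' i div 2 ^ k = c' 0 div 2 ^ k" if "i < S ^ k" for i
      using that
    proof (induction i)
      case (Suc i)
      have "savitch_agree S (Suc k) (Suc (w * S ^ k + i)) (c' i) (c' (Suc i))"
        using Suc.prems(1) lt[of "Suc i"] \<open>\<And>i. Suc i < S ^ Suc k \<Longrightarrow> savitch_agree S (Suc k) (Suc i) (c i) (c (Suc i))\<close>[of "w * S ^ k + i"]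
        by (simp add: c'_def)
      moreover have "\<not> S ^ k dvd Suc (w * S ^ k + i)"
      proof
        assume "S ^ k dvd Suc (w * S ^ k + i)"
        then have "S ^ k dvd w * S ^ k + Suc i" by simp
        then have "S ^ k dvd Suc i" using dvd_add_right_iff[of "S ^ k" "w * S ^ k" "Suc i"] by simp
        then show False using Suc.prems(1) by (auto dest: dvd_imp_le)
      qed
      ultimately have "c' i div 2 ^ k = c' (Suc i) div 2 ^ k" by (auto simp: savitch_agree_def)
      then show ?case using Suc by simp
    qed simp
    have agree: "savitch_agree S k (Suc i) (c' i) (c' (Suc i))" if "Suc i < S ^ k" for i
    proof -
      have *: "savitch_agree S (Suc k) (Suc (w * S ^ k + i)) (c' i) (c' (Suc i))"
        using lt[OF that] Suc.prems(2)[of "w * S ^ k + i"] by (simp add: c'_def)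
      show ?thesis unfolding savitch_agree_def
      proof (intro allI impI)
        fix l assume l: "l < k" "\<not> S ^ l dvd Suc i"
        have "S ^ l dvd w * S ^ k" using l(1) by (simp add: le_imp_power_dvd)
        then have "\<not> S ^ l dvd w * S ^ k + Suc i" using l(2) by (simp only: dvd_add_right_iff not_False_eq_True)
        then show "c' i div 2 ^ l = c' (Suc i) div 2 ^ l"
          using * l(1) unfolding savitch_agree_def by simp
      qed
    qed
    have leaf: "savitch_leaf S (Suc k) (w * S ^ k + i) (c' i) (u, v) =
       savitch_leaf S k i (c' i) (if even (c' 0 div 2 ^ k) then (u, w) else (w, v))"
      if "i < S ^ k" for i
    proof -
      have "(w * S ^ k + i) div S ^ k mod S = w" using that w assms(1) by simp
      moreover have "savitch_leaf S k (w * S ^ k + i) (c' i) uv = savitch_leaf S k i (c' i) uv" for uv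
        using assms(1) by (intro savitch_leaf_cong) auto
      ultimately show ?thesis using const[OF that] by simp
    qed
    have base: "leaf_fails r S (Suc k) (w * S ^ k + i) (c' i) (u, v)" if "i < S ^ k" for i
      unfolding c'_def by (rule Suc.prems(1)[OF lt[OF that]])
    show "unreachable r S k u w \<or> unreachable r S k w v"
    proof (cases "even (c' 0 div 2 ^ k)")
      case True
      have "unreachable r S k u w"
      proof (rule Suc.IH[of c'])
        show "leaf_fails r S k i (c' i) (u, w)"
          if "i < S ^ k" for i using base[OF that] True unfolding leaf[OF that] by simp
      qed (rule agree)
      then show ?thesis ..
    next
      case False
      have "unreachable r S k w v"
      proof (rule Suc.IH[of c'])
        show "leaf_fails r S k i (c' i) (w, v)"
          if "i < S ^ k" for i using base[OF that] False unfolding leaf[OF that] by simp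
      qed (rule agree)
      then show ?thesis ..
    qed
  qed
qed

text \<open>For each midpoint \<open>w\<close> a failing half is chosen and recorded in
  \<open>b w\<close>, together with a claim sequence for it. These sequences are concatenated over
  the blocks, with \<open>b w\<close> as bit \<open>k\<close>; it changes only at block boundaries,
  where \<open>S ^ k\<close> divides the index.\<close>

lemma savitch_complete:
  assumes "S > 0" "unreachable r S k u v"
  shows "\<exists>c. (\<forall>i < S ^ k. c i < 2 ^ k \<and>
      leaf_fails r S k i (c i) (u, v)) \<and>
    (\<forall>i. Suc i < S ^ k \<longrightarrow> savitch_agree S k (Suc i) (c i) (c (Suc i)))"
  using assms(2)
proof (induction k arbitrary: u v)
  case 0
  then show ?case by (intro exI[of _ "\<lambda>_. 0"]) (auto simp: savitch_agree_def)
next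
  case (Suc k)
  define good where "good c p \<longleftrightarrow> (\<forall>i < S ^ k. c i < 2 ^ k \<and>
      leaf_fails r S k i (c i) p) \<and>
    (\<forall>i. Suc i < S ^ k \<longrightarrow> savitch_agree S k (Suc i) (c i) (c (Suc i)))" for c and p :: "nat \<times> nat"
  have "\<forall>w. \<exists>b c. w < S \<longrightarrow> good c (if b then (w, v) else (u, w))"
  proof
    fix w
    show "\<exists>b c. w < S \<longrightarrow> good c (if b then (w, v) else (u, w))"
    proof (cases "w < S")
      case True
      then consider "unreachable r S k u w" | "unreachable r S k w v"
        using Suc.prems by auto
      then show ?thesis
      proof cases
        case 1
        then show ?thesis using Suc.IH[of u w] unfolding good_def
          by (intro exI[of _ False]) auto
      next
        case 2
        then show ?thesis using Suc.IH[of w v] unfolding good_def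
          by (intro exI[of _ True]) auto
      qed
    qed simp
  qed
  then obtain b c where good: "\<And>w. w < S \<Longrightarrow> good (c w) (if b w then (w, v) else (u, w))"
    by metis
  define c' where "c' i = of_bool (b (i div S ^ k)) * 2 ^ k + c (i div S ^ k) (i mod S ^ k)" for i
  have Sk: "S ^ k > 0" using assms(1) by simp
  have wS: "i div S ^ k < S" if "i < S ^ Suc k" for i
    using that by (simp add: less_mult_imp_div_less)
  have clt: "c (i div S ^ k) (i mod S ^ k) < 2 ^ k" if "i < S ^ Suc k" for i
    using good[OF wS[OF that]] Sk unfolding good_def by simp
  have cdiv: "c' i div 2 ^ k = of_bool (b (i div S ^ k))" "c' i mod 2 ^ k = c (i div S ^ k) (i mod S ^ k)"
    if "i < S ^ Suc k" for i
    using clt[OF that] by (auto simp: c'_def)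
  show ?case
  proof (intro exI[of _ c'] conjI allI impI)
    fix i assume i: "i < S ^ Suc k"
    show "c' i < 2 ^ Suc k" using clt[OF i] by (simp add: c'_def)
    have *: "savitch_leaf S k i (c' i) uv = savitch_leaf S k (i mod S ^ k) (c (i div S ^ k) (i mod S ^ k)) uv" for uv
      using assms(1) cdiv(2)[OF i] clt[OF i] by (intro savitch_leaf_cong) auto
    have "i div S ^ k mod S = i div S ^ k" using wS[OF i] by simp
    then have "savitch_leaf S (Suc k) i (c' i) (u, v) =
       savitch_leaf S k (i mod S ^ k) (c (i div S ^ k) (i mod S ^ k))
         (if b (i div S ^ k) then (i div S ^ k, v) else (u, i div S ^ k))"
      using cdiv(1)[OF i] * by simp
    then show "leaf_fails r S (Suc k) i (c' i) (u, v)"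
      using good[OF wS[OF i]] Sk unfolding good_def by simp
  next
    fix i assume i: "Suc i < S ^ Suc k"
    show "savitch_agree S (Suc k) (Suc i) (c' i) (c' (Suc i))"
      unfolding savitch_agree_def
    proof (intro allI impI)
      fix l assume l: "l < Suc k" "\<not> S ^ l dvd Suc i"
      have nd: "\<not> S ^ k dvd Suc i"
        using l by (meson dvd_trans le_imp_power_dvd less_Suc_eq_le)
      have eq: "Suc i div S ^ k = i div S ^ k" "Suc i mod S ^ k = Suc (i mod S ^ k)"
        using nd by (auto simp: div_Suc mod_Suc dvd_eq_mod_eq_0 split: if_splits)
      have lt: "Suc (i mod S ^ k) < S ^ k" using eq(2) Sk by (metis mod_less_divisor)
      define w where "w = i div S ^ k"
      have w: "w < S" using wS[of i] i by (simp add: w_def)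
      show "c' i div 2 ^ l = c' (Suc i) div 2 ^ l"
      proof (cases "l = k")
        case True
        then show ?thesis using cdiv(1)[of i] cdiv(1)[OF i] i eq(1) by simp
      next
        case False
        then have lk: "l < k" using l by simp
        have "S ^ l dvd i div S ^ k * S ^ k" using lk by (simp add: le_imp_power_dvd)
        moreover have "Suc i = i div S ^ k * S ^ k + Suc (i mod S ^ k)"
          by (metis add_Suc_right div_mult_mod_eq)
        ultimately have "\<not> S ^ l dvd Suc (i mod S ^ k)" using l(2) by (metis dvd_add)
        then have *: "c w (i mod S ^ k) div 2 ^ l = c w (Suc (i mod S ^ k)) div 2 ^ l"
          using good[OF w] lt lk unfolding good_def savitch_agree_def by blast
        have "(x * 2 ^ k + y) div 2 ^ l = x * 2 ^ (k - l) + y div 2 ^ l" for x y :: nat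
        proof -
          have e: "x * 2 ^ k + y = y + x * 2 ^ (k - l) * 2 ^ l"
            using lk by (simp add: mult.assoc flip: power_add)
          show ?thesis unfolding e by simp
        qed
        then show ?thesis using * eq by (simp add: c'_def w_def)
      qed
    qed
  qed
qed

text \<open>A path of length at most 2 ^ (k + 1) is cut at step min j (2 ^ k). The cut point is
  below \<open>S\<close> since it is \<open>u\<close> itself or the end of a step of
  \<open>r\<close>.\<close>

lemma unreachable_iff:
  assumes r: "\<And>a b. r a b \<Longrightarrow> a < S \<and> b < S" and "u < S" "v < S"
  shows "unreachable r S k u v \<longleftrightarrow> \<not> (\<exists>j \<le> 2 ^ k. (r ^^ j) u v)"
  using assms(2,3)
proof (induction k arbitrary: u v)
  case 0
  have "(\<exists>j \<le> 2 ^ 0. (r ^^ j) u v) \<longleftrightarrow> (u = v \<or> r u v)"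
    by (metis le_0_eq le_Suc_eq One_nat_def order_refl zero_le power_0 relpowp_0_E relpowp_0_I relpowp_1)
  then show ?case by simp
next
  case (Suc k)
  have "(\<exists>j \<le> 2 ^ Suc k. (r ^^ j) u v) \<longleftrightarrow>
    (\<exists>w < S. (\<exists>j \<le> 2 ^ k. (r ^^ j) u w) \<and> (\<exists>j \<le> 2 ^ k. (r ^^ j) w v))"
  proof
    assume "\<exists>j \<le> 2 ^ Suc k. (r ^^ j) u v"
    then obtain j where j: "j \<le> 2 * 2 ^ k" "(r ^^ j) u v" by auto
    define a where "a = min j (2 ^ k)"
    have "(r ^^ (a + (j - a))) u v" using j by (simp add: a_def)
    then obtain w where w: "(r ^^ a) u w" "(r ^^ (j - a)) w v"
      by (auto simp: relpowp_add)
    have "w < S"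
    proof (cases a)
      case 0 then show ?thesis using w Suc.prems by simp
    next
      case (Suc a') then show ?thesis using w r by auto
    qed
    moreover have "a \<le> 2 ^ k" "j - a \<le> 2 ^ k" using j by (auto simp: a_def)
    ultimately show "\<exists>w < S. (\<exists>j \<le> 2 ^ k. (r ^^ j) u w) \<and> (\<exists>j \<le> 2 ^ k. (r ^^ j) w v)"
      using w by blast
  next
    assume "\<exists>w < S. (\<exists>j \<le> 2 ^ k. (r ^^ j) u w) \<and> (\<exists>j \<le> 2 ^ k. (r ^^ j) w v)"
    then obtain w a b where "a \<le> 2 ^ k" "b \<le> 2 ^ k" "(r ^^ a) u w" "(r ^^ b) w v" by blast
    then have "(r ^^ (a + b)) u v" "a + b \<le> 2 ^ Suc k" by (auto simp: relpowp_add)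
    then show "\<exists>j \<le> 2 ^ Suc k. (r ^^ j) u v" by blast
  qed
  then show ?case using Suc by auto
qed

text \<open>The number t div V of the sweep is the index of the leaf. Layer 0 of a sweep only
  revises the claims; each later layer blocks the path if the endpoints of the leaf coincide or its
  bit witnesses a step between them. Surviving the sweep thus means that no bit is a
  witness.\<close>

definition savitch_edge ::
  "(nat \<Rightarrow> nat \<Rightarrow> nat \<Rightarrow> bool \<Rightarrow> bool) \<Rightarrow> nat \<Rightarrow> nat \<Rightarrow> nat \<Rightarrow> nat \<Rightarrow> nat \<Rightarrow> nat \<Rightarrow> bool \<Rightarrow> bool" where
  "savitch_edge ok V S L t c c' m \<longleftrightarrow>
     (if t mod V = 0 then savitch_agree S L (t div V) c c'
      else c = c' \<and> (case savitch_leaf S L (t div V) c (0, 1) of (u, v) \<Rightarrow> \<not> (u = v \<or> ok u v (t mod V) m)))"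

lemma savitch_leaf_less:
  assumes "S > 0" "fst uv < S" "snd uv < S"
  shows "fst (savitch_leaf S k i c uv) < S \<and> snd (savitch_leaf S k i c uv) < S"
  using assms by (induction k arbitrary: uv) auto

text \<open>Claim strings have \<open>L\<close> bits, so they are numbers below \<open>S\<close>,
  and 2 ^ L = \<open>S\<close> also bounds the relevant path lengths. The last layer belongs to
  index \<open>S ^ L\<close>, which every \<open>S ^ l\<close> with l < L divides, so the claims may
  be reset there to the final node 0. Index 0 likewise permits arbitrary initial claims.\<close>

lemma savitch_accepts:
  assumes S: "S = 2 ^ L" "S > 1" and V: "V > 1"
  shows "bp_accepts (mk_bp V S (V * S ^ L + 1) (savitch_edge ok V S L)) x \<longleftrightarrow> \<not> (bit_rel ok V S x)\<^sup>*\<^sup>* 0 1"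
proof -
  let ?r = "bit_rel ok V S x"
  let ?T = "V * S ^ L"
  have SL: "S ^ L > 0" using S by simp
  have "?r\<^sup>*\<^sup>* 0 1 \<longleftrightarrow> (\<exists>j \<le> 2 ^ L. (?r ^^ j) 0 1)"
    using rtrancl_path_length_bound[of ?r 0 1 S] S(1)
    by (auto simp: bit_rel_def intro: relpowp_imp_rtranclp)
  then have un: "\<not> ?r\<^sup>*\<^sup>* 0 1 \<longleftrightarrow> unreachable ?r S L 0 1"
    using unreachable_iff[of ?r S 0 1 L] S by (auto simp: bit_rel_def)
  have acc: "bp_accepts (mk_bp V S (?T + 1) (savitch_edge ok V S L)) x \<longleftrightarrow>
    (\<exists>p. p 0 = 0 \<and> p (?T + 1) = 0 \<and> (\<forall>t \<le> ?T + 1. p t < S) \<and>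
      (\<forall>t < ?T + 1. savitch_edge ok V S L t (p t) (p (t + 1)) (x ! (t mod V))))"
    using S by (intro bp_accepts_mk_bp) simp
  have lt: "i * V + j < ?T" if "i < S ^ L" "j < V" for i j
  proof -
    have "i * V + j < (i + 1) * V" using that by simp
    also have "\<dots> \<le> S ^ L * V" using that by (intro mult_le_mono1) simp
    finally show ?thesis by (simp add: mult.commute)
  qed
  show ?thesis unfolding un
  proof
    assume "bp_accepts (mk_bp V S (?T + 1) (savitch_edge ok V S L)) x"
    then obtain p where p: "p 0 = 0" "\<And>t. t \<le> ?T + 1 \<Longrightarrow> p t < S"
      "\<And>t. t < ?T + 1 \<Longrightarrow> savitch_edge ok V S L t (p t) (p (t + 1)) (x ! (t mod V))"
      unfolding acc by blast
    \<comment> \<open>Layer 0 of sweep i revises the claims, so those in force during the sweep are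
      found one layer after its start.\<close>
    define c where "c i = p (i * V + 1)" for i
    have const: "p (i * V + Suc j) = c i \<and> (0 < j \<longrightarrow>
        \<not> (fst (savitch_leaf S L i (c i) (0, 1)) = snd (savitch_leaf S L i (c i) (0, 1)) \<or>
           ok (fst (savitch_leaf S L i (c i) (0, 1))) (snd (savitch_leaf S L i (c i) (0, 1))) j (x ! j)))"
      if "i < S ^ L" "j < V" for i j
      using that(2)
    proof (induction j)
      case (Suc j)
      have "(i * V + Suc j) div V = i" using Suc.prems by (intro div_nat_eqI) auto
      moreover have "(i * V + Suc j) mod V = Suc j"
        using Suc.prems by (metis mod_less mod_mult_self3)
      ultimately show ?case using Suc p(3)[of "i * V + Suc j"] lt[OF that(1) Suc.prems]
        by (auto simp: savitch_edge_def case_prod_beta)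
    qed (simp add: c_def)
    show "unreachable ?r S L 0 1"
    proof (rule savitch_sound)
      show "S > 0" using S by simp
      fix i assume i: "i < S ^ L"
      show "leaf_fails ?r S L i (c i) (0, 1)"
        using const[OF i] V by (auto simp: bit_rel_def)
    next
      fix i assume i: "Suc i < S ^ L"
      have "p (Suc i * V) = c i"
        using const[of i "V - 1"] i V by (simp add: add.commute)
      moreover have "savitch_edge ok V S L (Suc i * V) (p (Suc i * V)) (p (Suc i * V + 1)) (x ! (Suc i * V mod V))"
        using p(3)[of "Suc i * V"] lt[OF i, of 0] V by simp
      ultimately show "savitch_agree S L (Suc i) (c i) (c (Suc i))"
        using V unfolding savitch_edge_def c_def
        by (simp only: mod_mult_self2_is_0 if_True nonzero_mult_div_cancel_right)
    qed
  next
    assume "unreachable ?r S L 0 1"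
    then obtain c where c: "\<And>i. i < S ^ L \<Longrightarrow> c i < 2 ^ L"
      "\<And>i. i < S ^ L \<Longrightarrow> leaf_fails ?r S L i (c i) (0, 1)"
      "\<And>i. Suc i < S ^ L \<Longrightarrow> savitch_agree S L (Suc i) (c i) (c (Suc i))"
      using savitch_complete[of S ?r L 0 1] S by auto
    define p where "p t = (if t = 0 \<or> t = ?T + 1 then 0 else c ((t - 1) div V))" for t
    have "p 0 = 0" "p (?T + 1) = 0" by (auto simp: p_def)
    moreover have "p t < S" if "t \<le> ?T + 1" for t
    proof (cases "t = 0 \<or> t = ?T + 1")
      case False
      then have "t - 1 < S ^ L * V" using that by (simp add: mult.commute) linarith
      then have "(t - 1) div V < S ^ L" by (rule less_mult_imp_div_less)
      then show ?thesis using c(1) S False by (simp add: p_def)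
    qed (use S in \<open>simp add: p_def\<close>)
    moreover have "savitch_edge ok V S L t (p t) (p (t + 1)) (x ! (t mod V))" if t: "t < ?T + 1" for t
    proof (cases "t mod V = 0")
      case True
      then obtain i where i: "t = i * V" by (metis mod_0_imp_dvd dvd_def mult.commute)
      have ti: "t div V = i" using i V by simp
      have "savitch_agree S L i (p t) (p (t + 1))"
      proof (cases "i = 0 \<or> i = S ^ L")
        case True
        have "S ^ l dvd S ^ L" if "l < L" for l using that by (simp add: le_imp_power_dvd)
        then show ?thesis using True unfolding savitch_agree_def by auto
      next
        case False
        then obtain i' where i': "i = Suc i'" by (cases i) auto
        have "i < S ^ L"
        proof -
          have "V * i \<le> V * S ^ L" using t unfolding i by (metis Suc_eq_plus1 less_Suc_eq_le mult.commute)
          then have "i \<le> S ^ L" using V by simp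
          then show ?thesis using False by simp
        qed
        then have tT: "t < ?T" using lt[of i 0] V i by simp
        have "p (t + 1) = c i" using i V tT by (simp add: p_def)
        moreover have "(t - 1) div V = i'"
          using i i' V by (intro div_nat_eqI) (auto simp: mult.commute[of V])
        then have "p t = c i'" using tT i i' V by (simp add: p_def)
        ultimately show ?thesis using c(3)[of i'] i' \<open>i < S ^ L\<close> by simp
      qed
      then show ?thesis using True ti by (simp add: savitch_edge_def)
    next
      case False
      define i j where "i = t div V" and "j = t mod V"
      have tT: "t < ?T" using t False by (cases "t = ?T") auto
      have i: "i < S ^ L" using tT by (simp add: i_def less_mult_imp_div_less mult.commute)
      have j: "0 < j" "j < V" "t = i * V + j" using False V by (auto simp: i_def j_def)
      have "(t - 1) div V = i" using j by (intro div_nat_eqI) (auto simp: mult.commute[of V])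
      then have "p t = c i" "p (t + 1) = c i" using tT j(1) False by (auto simp: p_def i_def)
      moreover have "fst (savitch_leaf S L i (c i) (0, 1)) < S" "snd (savitch_leaf S L i (c i) (0, 1)) < S"
        using savitch_leaf_less[of S "(0, 1)" L i "c i"] S by auto
      moreover have "t div V = i" "t mod V = j" by (simp_all add: i_def j_def)
      ultimately show ?thesis using c(2)[OF i] j(1,2)
        by (auto simp: savitch_edge_def case_prod_beta bit_rel_def)
    qed
    ultimately show "bp_accepts (mk_bp V S (?T + 1) (savitch_edge ok V S L)) x"
      unfolding acc by blast
  qed
qed

section \<open>Turing machine configurations as numbers\<close>

text \<open>Codes start at 1 because \<open>cell_at\<close> returns 0 for a cell that the current
  layer does not reveal.\<close>

fun cell_code :: "cell \<Rightarrow> nat" where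
  "cell_code LeftEnd = 1"
| "cell_code RightEnd = 2"
| "cell_code (Sym (Bit b)) = 3 + of_bool b"
| "cell_code (Sym Hash) = 5"

lemma cell_code_inject: "cell_code c = cell_code c' \<longleftrightarrow> c = c'"
  by (cases c rule: cell_code.cases; cases c' rule: cell_code.cases) auto

lemma cell_code_pos: "cell_code c \<noteq> 0"
  by (cases c rule: cell_code.cases) auto

text \<open>The work head position \<open>w\<close> is represented by \<open>h = G ^ w - 1\<close>, so that scanning and moving are
  arithmetic operations and the initial configuration has code 0. The truncated subtraction keeps
  the head at position 0 when it moves left from there.\<close>

fun move_code :: "nat \<Rightarrow> move \<Rightarrow> nat \<Rightarrow> nat" where
  "move_code G MLeft h = (h + 1) div G - 1"
| "move_code G MStay h = h"
| "move_code G MRight h = (h + 1) * G - 1"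

text \<open>A mixed radix representation with the state as lowest digit, so that acceptance shows in
  the remainder modulo \<open>Q\<close> and code 1 is itself accepting.\<close>

definition cfg_code :: "nat \<Rightarrow> nat \<Rightarrow> nat \<Rightarrow> nat \<Rightarrow> nat \<Rightarrow> nat \<Rightarrow> nat \<Rightarrow> nat" where
  "cfg_code Q I Z q i h tp = q + Q * (i + I * (h + Z * tp))"

lemma cfg_code_decode:
  assumes "q < Q" "i < I" "h < Z"
  shows "cfg_code Q I Z q i h tp mod Q = q"
    "cfg_code Q I Z q i h tp div Q mod I = i"
    "cfg_code Q I Z q i h tp div Q div I mod Z = h"
    "cfg_code Q I Z q i h tp div Q div I div Z = tp"
  using assms by (auto simp: cfg_code_def)

lemma cfg_code_less:
  assumes "q < Q" "i < I" "h < Z" "tp < Y"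
  shows "cfg_code Q I Z q i h tp < Q * (I * (Z * Y))"
proof -
  have *: "y + a * x < a * z" if "x < z" "y < a" for a x y z :: nat
  proof -
    have "y + a * x < a * (x + 1)" using that by simp
    also have "\<dots> \<le> a * z" using that by (intro mult_le_mono) auto
    finally show ?thesis .
  qed
  show ?thesis unfolding cfg_code_def using assms by (intro *)
qed

type_synonym trans = "nat \<times> cell \<times> nat \<times> nat \<times> nat \<times> move \<times> move"

text \<open>\<open>h + 1\<close> is the power of \<open>G\<close> at the head position, that is, the
  place value of the scanned digit. In the new tape number the addition comes first so that the
  subtraction is not truncated.\<close>

fun code_trans :: "nat \<Rightarrow> nat \<Rightarrow> nat \<Rightarrow> nat \<Rightarrow> nat \<Rightarrow> nat \<Rightarrow> nat \<Rightarrow> nat \<Rightarrow> nat \<Rightarrow> nat \<Rightarrow> nat \<Rightarrow> trans \<Rightarrow> bool" where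
  "code_trans Q I Z G RE q i h tp cl v (q0, c0, s0, q1, s1, di, dw) \<longleftrightarrow>
     q = q0 \<and> cl = cell_code c0 \<and> tp div (h + 1) mod G = s0 \<and>
     v = cfg_code Q I Z q1 (min RE (move_head di i)) (move_code G dw h) (tp + s1 * (h + 1) - s0 * (h + 1))"

text \<open>The last disjunct sends every accepting configuration to code 1, whatever its tape and
  heads, so that acceptance becomes reachability of a single node.\<close>

definition code_step :: "trans list \<Rightarrow> nat \<Rightarrow> nat \<Rightarrow> nat \<Rightarrow> nat \<Rightarrow> nat \<Rightarrow> nat \<Rightarrow> nat \<Rightarrow> nat \<Rightarrow> bool" where
  "code_step ts Q I Z G RE u cl v \<longleftrightarrow>
     (\<exists>tr \<in> set ts. code_trans Q I Z G RE (u mod Q) (u div Q mod I) (u div Q div I mod Z) (u div Q div I div Z) cl v tr) \<or>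
     (u mod Q = 1 \<and> v = 1)"

text \<open>Cells of the two strings are visible only in the layer that reads them. End markers,
  separators, sign and digits of k are constants of the instance; \<open>RE\<close> is the position
  of the right end marker.\<close>

definition cell_at :: "nat \<Rightarrow> bool \<Rightarrow> nat \<Rightarrow> nat \<Rightarrow> nat \<Rightarrow> bool \<Rightarrow> nat \<Rightarrow> nat" where
  "cell_at n neg ak RE j m i =
     (if i = 0 then 1 else if i = n + 1 \<or> i = 2 * n + 2 then 5
      else if i < 2 * n + 2 then (if i = j then 3 + of_bool m else 0)
      else if i = 2 * n + 3 then 3 + of_bool neg
      else if i < RE then 3 + ak div 2 ^ (RE - 1 - i) mod 2 else 2)"

definition query_step ::
  "trans list \<Rightarrow> nat \<Rightarrow> nat \<Rightarrow> nat \<Rightarrow> nat \<Rightarrow> nat \<Rightarrow> nat \<Rightarrow> bool \<Rightarrow> nat \<Rightarrow> nat \<Rightarrow> nat \<Rightarrow> nat \<Rightarrow> bool \<Rightarrow> bool" where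
  "query_step ts Q I Z G RE n neg ak u v j m \<longleftrightarrow>
     code_step ts Q I Z G RE u (cell_at n neg ak RE j m (u div Q mod I)) v"

section \<open>Queries as tape contents\<close>

lemma length_bin_rep: "length (bin_rep k) = floorlog 2 k"
proof (induction k rule: bin_rep.induct)
  case (1 k)
  then show ?case
    by (subst bin_rep.simps, subst compute_floorlog) auto
qed

lemma bin_rep_nth:
  "r < length (bin_rep k) \<Longrightarrow> bin_rep k ! r = odd (k div 2 ^ (length (bin_rep k) - 1 - r))"
proof (induction k arbitrary: r rule: bin_rep.induct)
  case (1 k)
  show ?case
  proof (cases "k = 0")
    case True
    then show ?thesis using "1.prems" by (simp add: bin_rep.simps)
  next
    case False
    then have b: "bin_rep k = bin_rep (k div 2) @ [odd k]" by (simp add: bin_rep.simps)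
    show ?thesis
    proof (cases "r < length (bin_rep (k div 2))")
      case True
      then have "bin_rep k ! r = odd (k div 2 div 2 ^ (length (bin_rep (k div 2)) - 1 - r))"
        using "1.IH"[OF False True] b by (simp add: nth_append)
      also have "k div 2 div 2 ^ (length (bin_rep (k div 2)) - 1 - r) = k div 2 ^ (length (bin_rep k) - 1 - r)"
      proof -
        have "length (bin_rep k) - 1 - r = Suc (length (bin_rep (k div 2)) - 1 - r)" using b True by simp
        then show ?thesis by (simp add: div_mult2_eq)
      qed
      finally show ?thesis .
    next
      case False
      then have "r = length (bin_rep (k div 2))" using "1.prems" b by simp
      then show ?thesis using b by simp
    qed
  qed
qed

lemma length_enc_query:
  "length (enc_query a b k) = length a + length b + 3 + floorlog 2 (nat \<bar>k\<bar>)"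
  by (simp add: enc_query_def length_bin_rep)

text \<open>The cases follow the layout: \<open>a\<close> in cells 1 to n, separators at n + 1 and 2
  * n + 2 with \<open>b\<close> between them, the sign at 2 * n + 3, then the digits of the absolute
  value.\<close>

lemma cell_at_enc_query:
  fixes a b :: "bool list" and k :: int
  assumes "length a = n" "length b = n"
  defines "x \<equiv> enc_query a b k"
  shows "cell_at n (k < 0) (nat \<bar>k\<bar>) (length x + 1) j ((False # a @ False # b) ! j) i =
    (if 0 < i \<and> i < 2 * n + 2 \<and> i \<noteq> n + 1 \<and> i \<noteq> j then 0 else cell_code (input_cell x i))"
proof -
  have len: "length x = 2 * n + 3 + floorlog 2 (nat \<bar>k\<bar>)"
    using assms by (simp add: length_enc_query)
  have x: "x = map Bit a @ [Hash] @ map Bit b @ [Hash] @ [Bit (k < 0)] @ map Bit (bin_rep (nat \<bar>k\<bar>))"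
    by (simp add: x_def enc_query_def)
  consider "i = 0" | "0 < i" "i \<le> n" | "i = n + 1" | "n + 1 < i" "i < 2 * n + 2" | "i = 2 * n + 2"
    | "i = 2 * n + 3" | "2 * n + 3 < i" "i < length x + 1" | "length x + 1 \<le> i" "2 * n + 3 < i"
    using len by linarith
  then show ?thesis
  proof cases
    case 1
    then show ?thesis by (simp add: cell_at_def input_cell_def)
  next
    case 2
    have "input_cell x i = Sym (Bit (a ! (i - 1)))"
      using 2 assms(1) len by (auto simp: input_cell_def x nth_append)
    moreover have "(False # a @ False # b) ! i = a ! (i - 1)"
      using 2 assms(1) by (auto simp: nth_append nth_Cons')
    ultimately show ?thesis using 2 by (auto simp: cell_at_def)
  next
    case 3
    then have "input_cell x i = Sym Hash"
      using assms(1,2) len by (auto simp: input_cell_def x nth_append)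
    then show ?thesis using 3 by (auto simp: cell_at_def)
  next
    case 4
    have "i - 1 - n = Suc (i - 2 - n)" "i - 2 - n < n" using 4 by auto
    then have "input_cell x i = Sym (Bit (b ! (i - 2 - n)))"
      using 4 assms(1,2) len by (auto simp: input_cell_def x nth_append)
    moreover have "(False # a @ False # b) ! i = b ! (i - 2 - n)"
      using 4 assms(1) by (auto simp: nth_append nth_Cons')
    ultimately show ?thesis using 4 by (auto simp: cell_at_def)
  next
    case 5
    then have "input_cell x i = Sym Hash"
      using assms(1,2) len by (auto simp: input_cell_def x nth_append nth_Cons')
    then show ?thesis using 5 by (auto simp: cell_at_def)
  next
    case 6
    then have "input_cell x i = Sym (Bit (k < 0))"
      using assms(1,2) len by (auto simp: input_cell_def x nth_append nth_Cons')
    then show ?thesis using 6 by (auto simp: cell_at_def)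
  next
    case 7
    define r where "r = i - 2 * n - 4"
    have i: "i = 2 * n + 4 + r" using 7 by (simp add: r_def)
    have r: "r < length (bin_rep (nat \<bar>k\<bar>))" using 7 i len by (simp add: length_bin_rep)
    have "x ! (i - 1) = Bit (bin_rep (nat \<bar>k\<bar>) ! r)"
      using assms(1,2) r i by (auto simp: x nth_append nth_Cons')
    then have "input_cell x i = Sym (Bit (bin_rep (nat \<bar>k\<bar>) ! r))"
      using 7 by (simp add: input_cell_def)
    moreover have "length x + 1 - 1 - i = length (bin_rep (nat \<bar>k\<bar>)) - 1 - r"
      using i len by (simp add: length_bin_rep)
    ultimately show ?thesis using 7 bin_rep_nth[OF r] by (auto simp: cell_at_def mod_2_eq_odd)
  next
    case 8
    then have "input_cell x i = RightEnd" using len by (auto simp: input_cell_def)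
    then show ?thesis using 8 by (auto simp: cell_at_def)
  qed
qed

text \<open>No cell has code 0, so an unrevealed cell permits nothing but the jump from an accepting
  state, and this jump ignores the cell.\<close>

lemma code_step_cell_0: "code_step ts Q I Z G RE u 0 v \<Longrightarrow> code_step ts Q I Z G RE u cl v"
proof -
  have "\<not> code_trans Q I Z G RE q i h tp 0 v tr" for q i h tp tr
    using not_sym[OF cell_code_pos] by (cases tr) auto
  moreover assume "code_step ts Q I Z G RE u 0 v"
  ultimately show ?thesis by (auto simp: code_step_def)
qed

text \<open>This provides the hypothesis on bit 0 in \<open>walk_accepts\<close>. If the head scans
  a string cell, bit 0 does not reveal it and \<open>code_step_cell_0\<close> applies; otherwise the
  scanned cell does not depend on the layer.\<close>

lemma query_step_0:
  fixes a b :: "bool list" and k :: int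
  assumes "length a = n" "length b = n"
  defines "x \<equiv> False # a @ False # b" and "RE \<equiv> length (enc_query a b k) + 1"
  assumes "query_step ts Q I Z G RE n (k < 0) (nat \<bar>k\<bar>) u v 0 (x ! 0)"
  shows "query_step ts Q I Z G RE n (k < 0) (nat \<bar>k\<bar>) u v 1 (x ! 1)"
proof (cases "0 < u div Q mod I \<and> u div Q mod I < 2 * n + 2 \<and> u div Q mod I \<noteq> n + 1")
  case True
  then have "code_step ts Q I Z G RE u 0 v"
    using assms(5) unfolding query_step_def x_def RE_def cell_at_enc_query[OF assms(1,2)] by simp
  then show ?thesis unfolding query_step_def by (rule code_step_cell_0)
next
  case False
  then have "\<And>j. \<not> (0 < u div Q mod I \<and> u div Q mod I < 2 * n + 2 \<and> u div Q mod I \<noteq> n + 1 \<and> u div Q mod I \<noteq> j)"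
    by blast
  then show ?thesis
    using assms(5) unfolding query_step_def x_def RE_def cell_at_enc_query[OF assms(1,2)]
    by (simp only: if_False)
qed

lemma bit_rel_query_step:
  fixes a b :: "bool list" and k :: int
  assumes "length a = n" "length b = n"
  defines "x \<equiv> enc_query a b k"
  shows "bit_rel (query_step ts Q I Z G (length x + 1) n (k < 0) (nat \<bar>k\<bar>)) (2 * n + 2) S (False # a @ False # b) u v \<longleftrightarrow>
    u < S \<and> v < S \<and> code_step ts Q I Z G (length x + 1) u (cell_code (input_cell x (u div Q mod I))) v"
proof -
  define i where "i = u div Q mod I"
  define D where "D j \<longleftrightarrow> 0 < i \<and> i < 2 * n + 2 \<and> i \<noteq> n + 1 \<and> i \<noteq> j" for j
  define C where "C = cell_code (input_cell x i)"
  define P where "P cl \<longleftrightarrow> code_step ts Q I Z G (length x + 1) u cl v" for cl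
  have q: "query_step ts Q I Z G (length x + 1) n (k < 0) (nat \<bar>k\<bar>) u v j ((False # a @ False # b) ! j)
    \<longleftrightarrow> P (if D j then 0 else C)" for j
    unfolding query_step_def x_def cell_at_enc_query[OF assms(1,2)] P_def D_def C_def i_def ..
  have P0: "P 0 \<Longrightarrow> P C" unfolding P_def by (rule code_step_cell_0)
  \<comment> \<open>A layer that reveals the scanned cell: the position of the head on a string
    cell, and an arbitrary one otherwise.\<close>
  define j0 where "j0 = (if 0 < i \<and> i < 2 * n + 2 \<and> i \<noteq> n + 1 then i else 1)"
  have j0: "0 < j0" "j0 < 2 * n + 2" "\<not> D j0" by (auto simp: j0_def D_def)
  have "(\<exists>j. 0 < j \<and> j < 2 * n + 2 \<and> P (if D j then 0 else C)) \<longleftrightarrow> P C"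
  proof
    assume "\<exists>j. 0 < j \<and> j < 2 * n + 2 \<and> P (if D j then 0 else C)"
    then show "P C" using P0 by (auto split: if_splits)
  next
    assume "P C"
    then show "\<exists>j. 0 < j \<and> j < 2 * n + 2 \<and> P (if D j then 0 else C)"
      using j0 by (intro exI[of _ j0]) simp
  qed
  then show ?thesis unfolding bit_rel_def q unfolding P_def C_def i_def by simp
qed

section \<open>Work tapes as numbers to base \<open>G\<close>, and simulation of the machine on
  codes\<close>

definition tape_num :: "nat \<Rightarrow> nat \<Rightarrow> (nat \<Rightarrow> nat) \<Rightarrow> nat" where
  "tape_num G s f = (\<Sum>i<s. f i * G ^ i)"

lemma tape_num_less:
  assumes "\<And>i. f i < G"
  shows "tape_num G s f < G ^ s"
proof (induction s)
  case (Suc s)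
  have "tape_num G (Suc s) f < G ^ s + f s * G ^ s" using Suc by (simp add: tape_num_def)
  also have "\<dots> = (f s + 1) * G ^ s" by simp
  also have "\<dots> \<le> G * G ^ s" using assms[of s] by (intro mult_le_mono1) simp
  finally show ?case by simp
qed (simp add: tape_num_def)

lemma tape_num_digit:
  assumes "\<And>i. f i < G" "w < s"
  shows "tape_num G s f div G ^ w mod G = f w"
  using assms(2)
proof (induction s)
  case (Suc s)
  have G: "G > 0" using assms(1)[of 0] by simp
  have num: "tape_num G (Suc s) f = tape_num G s f + f s * G ^ s" by (simp add: tape_num_def)
  show ?case
  proof (cases "w = s")
    case True
    then show ?thesis using tape_num_less[of f G s] assms(1)[of s] G by (simp add: num assms(1))
  next
    case False
    then have w: "w < s" using Suc.prems by simp
    then have "G ^ s = G ^ (s - w - 1) * G * G ^ w"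
      by (metis Suc_diff_Suc diff_Suc_1 le_add_diff_inverse2 less_imp_le_nat minus_nat.diff_0 power_Suc2 power_add diff_diff_left add.commute plus_1_eq_Suc)
    then have "tape_num G (Suc s) f = tape_num G s f + (f s * G ^ (s - w - 1) * G) * G ^ w"
      by (simp add: num)
    then have "tape_num G (Suc s) f div G ^ w = tape_num G s f div G ^ w + f s * G ^ (s - w - 1) * G"
      using G by simp
    then show ?thesis using Suc.IH[OF w] by simp
  qed
qed simp

lemma tape_num_upd:
  assumes "w < s"
  shows "tape_num G s (f(w := v)) + f w * G ^ w = tape_num G s f + v * G ^ w"
proof -
  have "tape_num G s g = g w * G ^ w + (\<Sum>i \<in> {..<s} - {w}. g i * G ^ i)" for g
    unfolding tape_num_def using assms by (intro sum.remove) auto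
  moreover have "(\<Sum>i \<in> {..<s} - {w}. (f(w := v)) i * G ^ i) = (\<Sum>i \<in> {..<s} - {w}. f i * G ^ i)"
    by (intro sum.cong) auto
  ultimately show ?thesis by simp
qed

lemma move_code_power:
  assumes "G \<ge> 2"
  shows "move_code G dw (G ^ w - 1) = G ^ move_head dw w - 1"
proof (cases dw)
  case MLeft
  then show ?thesis using assms by (cases w) auto
qed (use assms in \<open>auto simp: mult.commute\<close>)

text \<open>\<open>Q\<close> bounds states, \<open>I\<close> input positions, \<open>G\<close> work
  symbols and \<open>s\<close> work head positions. Only new states and written symbols need a
  bound, since a run starts in state 0 on a blank tape; cells from \<open>s\<close> on stay blank,
  so \<open>s\<close> digits describe the tape.\<close>

locale ntm_coding =
  fixes ts :: "trans list" and x :: "sym list" and Q I G s :: nat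
  assumes Q: "Q \<ge> 2" and G: "G \<ge> 2" and I: "length x + 1 < I"
    and ts: "\<And>q c t q' t' di dw. (q, c, t, q', t', di, dw) \<in> set ts \<Longrightarrow> q' < Q \<and> t' < G"
    and space: "\<And>c. ntm_reach (set ts) x c \<Longrightarrow> whead c < s"
begin

definition code :: "config \<Rightarrow> nat" where
  "code c = cfg_code Q I (G ^ s) (cstate c) (ihead c) (G ^ whead c - 1) (tape_num G s (wtape c))"

lemma reach_bounds:
  assumes "ntm_reach (set ts) x c"
  shows "cstate c < Q \<and> ihead c < I \<and> whead c < s \<and> (\<forall>i. wtape c i < G)"
proof -
  have "cstate c < Q \<and> ihead c < I \<and> (\<forall>i. wtape c i < G)"
    using assms unfolding ntm_reach_def
  proof (induction rule: rtranclp_induct)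
    case base
    then show ?case using Q G I by (simp add: init_config_def)
  next
    case (step c c')
    then show ?case using ts I by (fastforce simp: ntm_step_def)
  qed
  then show ?thesis using space[OF assms] by simp
qed

lemma head_code_less: "whead c < s \<Longrightarrow> G ^ whead c - 1 < G ^ s"
  using G power_strict_increasing[of "whead c" s G] by linarith

lemma code_less:
  assumes "ntm_reach (set ts) x c"
  shows "code c < Q * (I * (G ^ s * G ^ s))"
  unfolding code_def using reach_bounds[OF assms] head_code_less tape_num_less
  by (intro cfg_code_less) auto

lemma code_step_code:
  assumes "ntm_reach (set ts) x c"
  shows "code_step ts Q I (G ^ s) G (length x + 1) (code c) (cell_code (input_cell x (code c div Q mod I))) v \<longleftrightarrow>
    (\<exists>c'. ntm_step (set ts) x c c' \<and> v = code c') \<or> (cstate c = 1 \<and> v = 1)"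
proof -
  note b = reach_bounds[OF assms]
  have d: "code c mod Q = cstate c" "code c div Q mod I = ihead c"
    "code c div Q div I mod G ^ s = G ^ whead c - 1"
    "code c div Q div I div G ^ s = tape_num G s (wtape c)"
    unfolding code_def using b by (intro cfg_code_decode head_code_less; simp)+
  have h1: "G ^ whead c - 1 + 1 = G ^ whead c" using G by simp
  have sym: "tape_num G s (wtape c) div G ^ whead c mod G = wtape c (whead c)"
    using b by (intro tape_num_digit) auto
  have tr: "code_trans Q I (G ^ s) G (length x + 1) (cstate c) (ihead c) (G ^ whead c - 1)
      (tape_num G s (wtape c)) (cell_code (input_cell x (ihead c))) v (q0, c0, s0, q1, s1, di, dw) \<longleftrightarrow>
    q0 = cstate c \<and> c0 = input_cell x (ihead c) \<and> s0 = wtape c (whead c) \<and>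
    v = code \<lparr>cstate = q1, ihead = min (length x + 1) (move_head di (ihead c)),
           whead = move_head dw (whead c), wtape = (wtape c)(whead c := s1)\<rparr>"
    for q0 c0 s0 q1 s1 di dw
  proof -
    have "tape_num G s (wtape c) + s1 * G ^ whead c - wtape c (whead c) * G ^ whead c
      = tape_num G s ((wtape c)(whead c := s1))"
      using tape_num_upd[of "whead c" s G "wtape c" s1] b by simp
    then show ?thesis
      unfolding code_trans.simps h1 sym cell_code_inject
      by (auto simp: code_def move_code_power[OF G, unfolded One_nat_def])
  qed
  have "(\<exists>tr \<in> set ts. code_trans Q I (G ^ s) G (length x + 1) (cstate c) (ihead c) (G ^ whead c - 1)
      (tape_num G s (wtape c)) (cell_code (input_cell x (ihead c))) v tr) \<longleftrightarrow>
    (\<exists>c'. ntm_step (set ts) x c c' \<and> v = code c')" (is "?L \<longleftrightarrow> ?R")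
  proof
    assume ?L
    then obtain q0 c0 s0 q1 s1 di dw where "(q0, c0, s0, q1, s1, di, dw) \<in> set ts"
      "code_trans Q I (G ^ s) G (length x + 1) (cstate c) (ihead c) (G ^ whead c - 1)
      (tape_num G s (wtape c)) (cell_code (input_cell x (ihead c))) v (q0, c0, s0, q1, s1, di, dw)"
      by (auto simp del: code_trans.simps)
    then show ?R unfolding tr ntm_step_def by blast
  next
    assume ?R
    then obtain q1 s1 di dw where
      *: "(cstate c, input_cell x (ihead c), wtape c (whead c), q1, s1, di, dw) \<in> set ts"
      "v = code \<lparr>cstate = q1, ihead = min (length x + 1) (move_head di (ihead c)),
           whead = move_head dw (whead c), wtape = (wtape c)(whead c := s1)\<rparr>"
      unfolding ntm_step_def by blast
    show ?L using *(1) by (rule bexI[rotated]) (use *(2) in \<open>unfold tr, blast\<close>)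
  qed
  then show ?thesis unfolding code_step_def d by blast
qed

text \<open>Not every number below \<open>S\<close> need code a configuration, but along a path from
  0 every node codes a reachable one until an accepting configuration has been met. If 1 is such a
  code, its remainder modulo \<open>Q\<close> >= 2 is the accepting state; otherwise it was entered
  by the jump.\<close>

lemma ntm_accepts_iff_code_reach:
  assumes S: "S = Q * (I * (G ^ s * G ^ s))"
    and r: "\<And>u v. r u v \<longleftrightarrow> u < S \<and> v < S \<and>
      code_step ts Q I (G ^ s) G (length x + 1) u (cell_code (input_cell x (u div Q mod I))) v"
  shows "r\<^sup>*\<^sup>* 0 1 \<longleftrightarrow> ntm_accepts (set ts) x"
proof -
  have init: "code init_config = 0"
    by (simp add: code_def init_config_def cfg_code_def tape_num_def)
  have reach_init: "ntm_reach (set ts) x init_config" by (simp add: ntm_reach_def)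
  have reach_step: "ntm_reach (set ts) x c'" if "ntm_reach (set ts) x c" "ntm_step (set ts) x c c'" for c c'
    using that by (simp add: ntm_reach_def)
  have G0: "G ^ s \<ge> 1" "I \<ge> 1" using G I by auto
  have S1: "1 < S"
  proof -
    have "2 * (1 * (1 * 1)) \<le> Q * (I * (G ^ s * G ^ s))" using Q G0 by (intro mult_le_mono)
    then show ?thesis using S by simp
  qed
  show ?thesis
  proof
    assume "r\<^sup>*\<^sup>* 0 1"
    then have "ntm_accepts (set ts) x \<or> (\<exists>c. ntm_reach (set ts) x c \<and> code c = 1)"
    proof (induction rule: rtranclp_induct)
      case base
      then show ?case using init reach_init by blast
    next
      case (step u v)
      show ?case
      proof (cases "ntm_accepts (set ts) x")
        case False
        then obtain c where c: "ntm_reach (set ts) x c" "code c = u" using step.IH by blast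
        have "(\<exists>c'. ntm_step (set ts) x c c' \<and> v = code c') \<or> (cstate c = 1 \<and> v = 1)"
          using step.hyps(2) unfolding r c(2)[symmetric] code_step_code[OF c(1)] by blast
        then show ?thesis using reach_step[OF c(1)] c(1) unfolding ntm_accepts_def by blast
      qed simp
    qed
    moreover have "cstate c = 1" if "ntm_reach (set ts) x c" "code c = 1" for c
    proof -
      have "cstate c = code c mod Q"
        unfolding code_def using reach_bounds[OF that(1)] head_code_less
        by (subst cfg_code_decode) auto
      then show ?thesis using that Q by simp
    qed
    ultimately show "ntm_accepts (set ts) x" unfolding ntm_accepts_def by blast
  next
    assume "ntm_accepts (set ts) x"
    then obtain c where c: "ntm_reach (set ts) x c" "cstate c = 1"
      unfolding ntm_accepts_def by blast
    have "r\<^sup>*\<^sup>* 0 (code c)" if "ntm_reach (set ts) x c" for c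
      using that unfolding ntm_reach_def
    proof (induction rule: rtranclp_induct)
      case base
      then show ?case by (simp add: init)
    next
      case (step c c')
      then have "ntm_reach (set ts) x c" "ntm_reach (set ts) x c'"
        using reach_step by (auto simp: ntm_reach_def)
      then have "r (code c) (code c')"
        using step.hyps(2) code_less unfolding r S code_step_code[OF \<open>ntm_reach (set ts) x c\<close>] by blast
      then show ?case using step.IH by (rule rtranclp.rtrancl_into_rtrancl[rotated])
    qed
    moreover have "r (code c) 1"
      using c(2) code_less[OF c(1)] S1 unfolding r S code_step_code[OF c(1)] by blast
    ultimately show "r\<^sup>*\<^sup>* 0 1" using c(1) by (meson rtranclp.rtrancl_into_rtrancl)
  qed
qed

end

section \<open>Unique readability of queries\<close>

fun bin_val :: "bool list \<Rightarrow> nat" where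
  "bin_val bs = fold (\<lambda>b v. 2 * v + of_bool b) bs 0"

lemma bin_val_bin_rep: "bin_val (bin_rep k) = k"
proof (induction k rule: bin_rep.induct)
  case (1 k)
  show ?case
  proof (cases "k = 0")
    case False
    then have "bin_rep k = bin_rep (k div 2) @ [odd k]" by (simp add: bin_rep.simps)
    then show ?thesis using 1[OF False] by simp
  qed (simp add: bin_rep.simps)
qed

text \<open>A string of bits ends at the first separator, so the two strings can be split off one
  after the other; sign and magnitude then determine the threshold.\<close>

lemma enc_query_inject:
  assumes "enc_query a b k = enc_query a' b' k'"
  shows "a = a' \<and> b = b' \<and> k = k'"
proof -
  have split: "u = u' \<and> w = w'"
    if "map Bit u @ Hash # w = map Bit u' @ Hash # w'" for u u' w w'
    using that
  proof (induction u arbitrary: u')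
    case Nil
    then show ?case by (cases u') auto
  next
    case (Cons p u)
    then show ?case by (cases u') auto
  qed
  have "a = a' \<and> map Bit b @ Hash # Bit (k < 0) # map Bit (bin_rep (nat \<bar>k\<bar>))
      = map Bit b' @ Hash # Bit (k' < 0) # map Bit (bin_rep (nat \<bar>k'\<bar>))"
    using assms by (intro split) (simp add: enc_query_def)
  moreover from this have "b = b' \<and> Bit (k < 0) # map Bit (bin_rep (nat \<bar>k\<bar>))
      = Bit (k' < 0) # map Bit (bin_rep (nat \<bar>k'\<bar>))"
    by (intro split) simp
  ultimately have *: "a = a'" "b = b'" "(k < 0) = (k' < 0)" "map Bit (bin_rep (nat \<bar>k\<bar>)) = map Bit (bin_rep (nat \<bar>k'\<bar>))"
    by auto
  have "inj Bit" by (auto simp: inj_def)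
  then have "bin_rep (nat \<bar>k\<bar>) = bin_rep (nat \<bar>k'\<bar>)" using *(4) by (simp add: inj_map_eq_map)
  then have "nat \<bar>k\<bar> = nat \<bar>k'\<bar>" using bin_val_bin_rep by metis
  then show ?thesis using * by auto
qed

lemma enc_query_in_decision_version:
  assumes "length a = length b"
  shows "enc_query a b k \<in> decision_version \<A> \<longleftrightarrow> \<A> a b > k"
proof
  assume "enc_query a b k \<in> decision_version \<A>"
  then obtain a' b' k' where "enc_query a b k = enc_query a' b' k'" "\<A> a' b' > k'"
    unfolding decision_version_def by blast
  then show "\<A> a b > k" using enc_query_inject by metis
next
  assume "\<A> a b > k"
  then show "enc_query a b k \<in> decision_version \<A>"
    unfolding decision_version_def using assms by blast
qed

section \<open>Arithmetic expressions for the transition relation\<close>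

abbreviation ePlus (infixl "\<oplus>" 65) where "a \<oplus> b \<equiv> EBin Plus a b"
abbreviation eMinus (infixl "\<ominus>" 65) where "a \<ominus> b \<equiv> EBin Minus a b"
abbreviation eTimes (infixl "\<otimes>" 70) where "a \<otimes> b \<equiv> EBin Times a b"
abbreviation eDiv (infixl "\<oslash>" 70) where "a \<oslash> b \<equiv> EBin Divide a b"

definition eMod :: "exp \<Rightarrow> exp \<Rightarrow> exp" where "eMod a b = a \<ominus> (a \<oslash> b) \<otimes> b"
text \<open>Truncated subtraction supplies truth values: 1 - x is 1 if x = 0 and 0 otherwise.
  Conditionals then become arithmetic that evaluates both branches, so expressions need no
  jumps.\<close>

definition eLess :: "exp \<Rightarrow> exp \<Rightarrow> exp" where "eLess a b = ECst 1 \<ominus> (ECst 1 \<ominus> (b \<ominus> a))"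
definition eEq :: "exp \<Rightarrow> exp \<Rightarrow> exp" where "eEq a b = ECst 1 \<ominus> ((a \<ominus> b) \<oplus> (b \<ominus> a))"
definition eOr :: "exp \<Rightarrow> exp \<Rightarrow> exp" where "eOr a b = eLess (ECst 0) (a \<oplus> b)"
definition eCond :: "exp \<Rightarrow> exp \<Rightarrow> exp \<Rightarrow> exp" where
  "eCond c a b = c \<otimes> a \<oplus> (ECst 1 \<ominus> c) \<otimes> b"

lemma of_bool_cond [simp]: "of_bool P * x + (1 - of_bool P) * y = (if P then x else y :: nat)"
  "of_bool P * x + (Suc 0 - of_bool P) * y = (if P then x else y)"
  by auto

lemma eval_derived [simp]:
  "eval xs (eMod a b) env = eval xs a env mod eval xs b env"
  "eval xs (eLess a b) env = of_bool (eval xs a env < eval xs b env)"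
  "eval xs (eEq a b) env = of_bool (eval xs a env = eval xs b env)"
  "eval xs (eOr a b) env = of_bool (eval xs a env > 0 \<or> eval xs b env > 0)"
  "eval xs (eCond c a b) env = eval xs c env * eval xs a env + (1 - eval xs c env) * eval xs b env"
  by (auto simp: eMod_def eLess_def eEq_def eOr_def eCond_def minus_div_mult_eq_mod)

lemma vbound_derived [simp]:
  "vbound xs X C (eMod a b) env \<longleftrightarrow> vbound xs X C a env \<and> vbound xs X C b env"
  "vbound xs X C (eLess a b) env \<longleftrightarrow> vbound xs X C a env \<and> vbound xs X C b env"
  "vbound xs X C (eEq a b) env \<longleftrightarrow> vbound xs X C a env \<and> vbound xs X C b env"
  "vbound xs X C (eOr a b) env \<longleftrightarrow> vbound xs X C a env \<and> vbound xs X C b env"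
  "vbound xs X C (eCond c a b) env \<longleftrightarrow> vbound xs X C c env \<and> vbound xs X C a env \<and> vbound xs X C b env"
  by (auto simp: eMod_def eLess_def eEq_def eOr_def eCond_def)

primrec ePowC :: "exp \<Rightarrow> nat \<Rightarrow> exp" where
  "ePowC e 0 = ECst 1"
| "ePowC e (Suc k) = e \<otimes> ePowC e k"

lemma eval_ePowC [simp]: "eval xs (ePowC e k) env = eval xs e env ^ k"
  by (induction k) auto

lemma vbound_ePowC [simp]: "vbound xs X C e env \<Longrightarrow> vbound xs X C (ePowC e k) env"
  by (induction k) auto

lemma power_le_bound: "b ^ n \<le> X \<Longrightarrow> k \<le> n \<Longrightarrow> b > 0 \<Longrightarrow> b ^ k \<le> X" for X b :: nat
  by (rule le_trans[OF power_increasing]) auto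

lemma le_power2: "k \<le> n \<Longrightarrow> k \<le> 2 ^ n" for k n :: nat
  by (rule le_trans[OF _ less_imp_le[OF less_exp]])

text \<open>The variables 0, 1 and 2 are reserved for accumulators and counters of folds.\<close>

definition ePow2 :: "exp \<Rightarrow> exp" where
  "ePow2 e = EFold 0 1 e (ECst 1) (ECst 2 \<otimes> EVar 0)"

definition ePow :: "nat \<Rightarrow> exp \<Rightarrow> exp" where
  "ePow b e = EFold 0 1 e (ECst 1) (EVar b \<otimes> EVar 0)"

text \<open>The bit length of a number v is the number of i < v with 2 ^ i <= v. The counter is
  variable 2 because the inner power binds 0 and 1. All powers below 2 ^ v are computed on the way,
  which is why \<open>X\<close> must be exponential in v.\<close>

definition eBitlen :: "nat \<Rightarrow> exp" where
  "eBitlen v = EFold 0 2 (EVar v) (ECst 0) (EVar 0 \<oplus> eLess (ePow2 (EVar 2)) (EVar v \<oplus> ECst 1))"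

lemma fold_times_const: "fold (\<lambda>k a. c * a) [0..<n] (x::nat) = c ^ n * x"
  by (induction n) (auto simp: algebra_simps)

lemma fold_plus_sum: "fold (\<lambda>k a. a + f k) [0..<n] (x::nat) = x + (\<Sum>k<n. f k)"
  by (induction n) auto

lemma eval_ePow2 [simp]: "eval xs (ePow2 e) env = 2 ^ eval xs e env"
  using fold_times_const[of 2] by (simp add: ePow2_def)

lemma vbound_ePow2 [simp]:
  "vbound xs X C (ePow2 e) env \<longleftrightarrow> vbound xs X C e env \<and> eval xs e env \<le> C \<and> 2 ^ eval xs e env \<le> X"
proof -
  have "2 ^ k \<le> X" if "2 ^ n \<le> X" "k \<le> n" for k n :: nat
    using that by (rule power_le_bound) simp
  then show ?thesis using fold_times_const[of 2] by (auto simp: ePow2_def)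
qed

lemma eval_ePow: "b \<notin> {0, 1} \<Longrightarrow> eval xs (ePow b e) env = env b ^ eval xs e env"
  using fold_times_const[of "env b"] by (simp add: ePow_def)

lemma vbound_ePow:
  assumes "b \<notin> {0, 1}" "env b > 0"
  shows "vbound xs X C (ePow b e) env \<longleftrightarrow> vbound xs X C e env \<and> eval xs e env \<le> C \<and> env b ^ eval xs e env \<le> X"
proof -
  have "env b ^ k \<le> X" if "env b ^ n \<le> X" "k \<le> n" for k n :: nat
    using that assms(2) by (rule power_le_bound)
  then show ?thesis using fold_times_const[of "env b"] assms(1) by (auto simp: ePow_def)
qed

lemma less_floorlog_iff: "i < floorlog 2 v \<longleftrightarrow> 2 ^ i \<le> v"
  using floorlog_le_iff[of 2 v i] by auto

lemma floorlog_le_self: "floorlog 2 v \<le> v"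
  by (rule floorlog_leI) (auto simp: less_exp)

lemma sum_power_le_floorlog:
  assumes "n \<ge> floorlog 2 v"
  shows "(\<Sum>i<n. of_bool (2 ^ i \<le> v)) = floorlog 2 v"
proof -
  have "(\<Sum>i<n. of_bool (2 ^ i \<le> v) :: nat) = (\<Sum>i<n. of_bool (i < floorlog 2 v))"
    by (simp add: less_floorlog_iff)
  also have "\<dots> = card {i. i < n \<and> i < floorlog 2 v}"
    by (simp add: of_bool_def sum.If_cases Int_def lessThan_def)
  also have "{i. i < n \<and> i < floorlog 2 v} = {..<floorlog 2 v}" using assms by auto
  finally show ?thesis by simp
qed

lemma eval_eBitlen [simp]:
  assumes "v \<notin> {0, 1, 2}"
  shows "eval xs (eBitlen v) env = floorlog 2 (env v)"
proof -
  have "fold (\<lambda>k a. a + of_bool (2 ^ k \<le> env v)) [0..<env v] 0 = floorlog 2 (env v)"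
    unfolding fold_plus_sum using sum_power_le_floorlog[OF floorlog_le_self] by simp
  then show ?thesis using assms by (simp add: eBitlen_def less_Suc_eq_le)
qed

lemma vbound_eBitlen [simp]:
  assumes "v \<notin> {0, 1, 2}" "env v \<le> C" "2 ^ env v \<le> X"
  shows "vbound xs X C (eBitlen v) env"
proof -
  have *: "fold (\<lambda>k a. a + of_bool (2 ^ k \<le> env v)) [0..<k] 0 \<le> X" if "k \<le> env v" for k
  proof -
    have "(\<Sum>i<k. of_bool (2 ^ i \<le> env v) :: nat) \<le> (\<Sum>i<k. 1)" by (intro sum_mono) auto
    also have "\<dots> \<le> 2 ^ env v" using le_power2[OF that] by simp
    finally show ?thesis unfolding fold_plus_sum using assms(3) by simp
  qed
  have "2 ^ k \<le> X" if "k < env v" for k :: nat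
    using power_le_bound[OF assms(3)] that by simp
  then show ?thesis using assms * by (auto simp: eBitlen_def less_Suc_eq_le)
qed

section \<open>Specifications with value bounds, and the variables of the generator\<close>

definition espec :: "nat list \<Rightarrow> nat \<Rightarrow> nat \<Rightarrow> exp \<Rightarrow> (nat \<Rightarrow> nat) \<Rightarrow> nat \<Rightarrow> bool" where
  "espec xs X C e env v \<longleftrightarrow> vbound xs X C e env \<and> eval xs e env = v"

definition sspec :: "nat list \<Rightarrow> nat \<Rightarrow> nat \<Rightarrow> stm \<Rightarrow> (nat \<Rightarrow> nat) \<Rightarrow> nat list \<Rightarrow> nat \<Rightarrow> bool" where
  "sspec xs X C c env ys k \<longleftrightarrow> svbound xs X C c env \<and> outp xs c env = ys \<and> ssteps xs c env \<le> k"

lemma sspec_SEmit: "espec xs X C e env v \<Longrightarrow> sspec xs X C (SEmit e) env [v] 1"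
  by (simp add: espec_def sspec_def)

lemma sspec_SSeq:
  "sspec xs X C b env ys k \<Longrightarrow> sspec xs X C c env zs l \<Longrightarrow> sspec xs X C (SSeq b c) env (ys @ zs) (k + l)"
  by (simp add: sspec_def)

lemma sspec_SLet:
  "espec xs X C e env v \<Longrightarrow> v \<le> X \<Longrightarrow> sspec xs X C c (env(r := v)) ys k \<Longrightarrow>
    sspec xs X C (SLet r e c) env ys (k + 1)"
  by (simp add: espec_def sspec_def)

lemma sspec_SFor:
  assumes "espec xs X C e env n" "n \<le> X" "\<And>k. k < n \<Longrightarrow> sspec xs X C c (env(i := k)) (f k) l"
  shows "sspec xs X C (SFor i e c) env (concat (map f [0..<n])) (1 + n * (1 + l))"
proof -
  have "(\<Sum>k<n. 1 + ssteps xs c (env(i := k))) \<le> (\<Sum>k<n. 1 + l)"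
    using assms(3) by (intro sum_mono) (auto simp: sspec_def)
  moreover have "concat (map (\<lambda>k. outp xs c (env(i := k))) [0..<n]) = concat (map f [0..<n])"
    using assms(3) by (intro arg_cong[where f = concat] map_cong) (auto simp: sspec_def)
  moreover have "\<And>k. k < n \<Longrightarrow> svbound xs X C c (env(i := k))"
    using assms(3) by (simp add: sspec_def)
  ultimately show ?thesis
    using assms(1,2) unfolding sspec_def espec_def by simp
qed

abbreviation (input) "vN \<equiv> 3 :: nat"
abbreviation (input) "vn \<equiv> 4 :: nat"
abbreviation (input) "vV \<equiv> 5 :: nat"
abbreviation (input) "vK \<equiv> 6 :: nat"
abbreviation (input) "vM \<equiv> 7 :: nat"
abbreviation (input) "vs \<equiv> 8 :: nat"
abbreviation (input) "vL \<equiv> 9 :: nat"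
abbreviation (input) "vS \<equiv> 10 :: nat"
abbreviation (input) "vI \<equiv> 11 :: nat"
abbreviation (input) "vZ \<equiv> 12 :: nat"
abbreviation (input) "vT \<equiv> 13 :: nat"
abbreviation (input) "vkap \<equiv> 14 :: nat"
abbreviation (input) "vneg \<equiv> 15 :: nat"
abbreviation (input) "vak \<equiv> 16 :: nat"
abbreviation (input) "vRE \<equiv> 17 :: nat"
abbreviation (input) "ve \<equiv> 18 :: nat"
abbreviation (input) "vm \<equiv> 19 :: nat"
abbreviation (input) "vc' \<equiv> 20 :: nat"
abbreviation (input) "vc \<equiv> 21 :: nat"
abbreviation (input) "vt \<equiv> 22 :: nat"
abbreviation (input) "vi \<equiv> 23 :: nat"
abbreviation (input) "vj \<equiv> 24 :: nat"
abbreviation (input) "vlf \<equiv> 25 :: nat"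
abbreviation (input) "vu \<equiv> 26 :: nat"
abbreviation (input) "vv \<equiv> 27 :: nat"
abbreviation (input) "vq \<equiv> 28 :: nat"
abbreviation (input) "vih \<equiv> 29 :: nat"
abbreviation (input) "vh \<equiv> 30 :: nat"
abbreviation (input) "vtp \<equiv> 31 :: nat"
abbreviation (input) "vcl \<equiv> 32 :: nat"
abbreviation (input) "vfl \<equiv> 33 :: nat"

text \<open>The fold counts the levels at which a claim changes without permission; agreement means
  that there are none.\<close>

definition agree_exp :: exp where
  "agree_exp = eEq (EFold 0 2 (EVar vL) (ECst 0) (EVar 0 \<oplus>
     eLess (ECst 0) (eMod (EVar vi) (ePow vS (EVar 2))) \<otimes>
     (ECst 1 \<ominus> eEq (EVar vc \<oslash> ePow2 (EVar 2)) (EVar vc' \<oslash> ePow2 (EVar 2))))) (ECst 0)"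

lemma espec_agree_exp:
  assumes "env vL = L" "env vS = S" "env vi = i" "env vc = c" "env vc' = c'"
    and "L \<le> C" "2 ^ L \<le> X" "S ^ L \<le> X" "S > 0"
  shows "espec xs X C agree_exp env (of_bool (savitch_agree S L i c c'))"
proof -
  define f :: "nat \<Rightarrow> nat" where "f k = of_bool (0 < i mod S ^ k) * (1 - of_bool (c div 2 ^ k = c' div 2 ^ k))" for k
  define body where "body = EVar 0 \<oplus> eLess (ECst 0) (eMod (EVar vi) (ePow vS (EVar 2))) \<otimes>
     (ECst 1 \<ominus> eEq (EVar vc \<oslash> ePow2 (EVar 2)) (EVar vc' \<oslash> ePow2 (EVar 2)))"
  have eb: "eval xs body (env(0 := a, 2 := k)) = a + f k" for a k
    using assms by (simp add: body_def f_def eval_ePow)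
  have ef: "eval xs (EFold 0 2 e (ECst 0) body) env = (\<Sum>k<eval xs e env. f k)" for e
    by (simp only: eval.simps eb fold_plus_sum add_0)
  have zero: "(\<Sum>k<L. f k) = 0 \<longleftrightarrow> savitch_agree S L i c c'"
    by (auto simp: savitch_agree_def dvd_eq_mod_eq_0 f_def)
  have le: "(\<Sum>k<n. f k) \<le> X" if "n \<le> L" for n
  proof -
    have "(\<Sum>k<n. f k) \<le> (\<Sum>k<n. 1)" by (intro sum_mono) (auto simp: f_def)
    also have "\<dots> \<le> 2 ^ L" using le_power2[OF that] by simp
    finally show ?thesis using assms by simp
  qed
  have "2 ^ k \<le> X" "S ^ k \<le> X" if "k < L" for k :: nat
    using that power_le_bound[of 2 L X k] power_le_bound[of S L X k] assms by simp_all
  then have vb: "vbound xs X C body (env(0 := a, 2 := k))" if "k < L" for a k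
    using that assms by (simp add: body_def vbound_ePow)
  have "vbound xs X C (EFold 0 2 (EVar vL) (ECst 0) body) env"
    unfolding vbound.simps ef using le vb assms(1,6) by simp
  then show ?thesis
    unfolding espec_def agree_exp_def body_def[symmetric] vbound_derived eval_derived ef
    using zero assms(1) by simp
qed

text \<open>A fold has one accumulator, so a pair (u, v) is packed as u * S + v, starting from 1 for
  (0, 1). Counters ascend while the recursion descends from level L - 1, whence the reversed level
  \<open>l\<close>.\<close>

definition leaf_exp :: exp where
  "leaf_exp = (let l = EVar vL \<ominus> ECst 1 \<ominus> EVar 2; w = eMod (EVar vi \<oslash> ePow vS l) (EVar vS) in
     EFold 0 2 (EVar vL) (ECst 1) (eCond (eEq (eMod (EVar vc \<oslash> ePow2 l) (ECst 2)) (ECst 0))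
       (EVar 0 \<oslash> EVar vS \<otimes> EVar vS \<oplus> w) (w \<otimes> EVar vS \<oplus> eMod (EVar 0) (EVar vS))))"

definition leaf_step :: "nat \<Rightarrow> nat \<Rightarrow> nat \<Rightarrow> nat \<Rightarrow> nat \<Rightarrow> nat" where
  "leaf_step S i c l a = (if c div 2 ^ l mod 2 = 0
     then a div S * S + i div S ^ l mod S else i div S ^ l mod S * S + a mod S)"

lemma fold_leaf_step:
  assumes "u < S" "v < S"
  shows "fold (\<lambda>k. leaf_step S i c (L - 1 - k)) [0..<L] (u * S + v) =
    (case savitch_leaf S L i c (u, v) of (u', v') \<Rightarrow> u' * S + v')"
  using assms
proof (induction L arbitrary: u v)
  case (Suc L)
  have "[0..<Suc L] = 0 # map Suc [0..<L]" by (simp add: upt_conv_Cons map_Suc_upt del: upt_Suc)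
  then have "fold (\<lambda>k. leaf_step S i c (Suc L - 1 - k)) [0..<Suc L] (u * S + v) =
    fold (\<lambda>k. leaf_step S i c (L - 1 - k)) [0..<L] (leaf_step S i c L (u * S + v))"
    by (simp add: fold_map o_def)
  also have "leaf_step S i c L (u * S + v) = (if even (c div 2 ^ L) then u * S + i div S ^ L mod S
      else i div S ^ L mod S * S + v)"
    using Suc.prems by (simp add: leaf_step_def even_iff_mod_2_eq_zero)
  finally show ?case using Suc.IH Suc.prems by simp
qed simp

lemma leaf_step_less:
  assumes "S > 0" "a < S * S"
  shows "leaf_step S i c l a < S * S"
proof -
  have *: "x * S + y < S * S" if "x < S" "y < S" for x y
  proof -
    have "x * S + y < (x + 1) * S" using that by simp
    also have "\<dots> \<le> S * S" using that by (intro mult_le_mono1) simp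
    finally show ?thesis .
  qed
  have "a div S < S" using assms by (simp add: less_mult_imp_div_less)
  then show ?thesis using * assms(1) by (simp add: leaf_step_def)
qed

lemma espec_leaf_exp:
  assumes "env vL = L" "env vS = S" "env vi = i" "env vc = c"
    and "L \<le> C" "2 ^ L \<le> X" "S ^ L \<le> X" "S > 1" "S * S \<le> X"
  shows "espec xs X C leaf_exp env (case savitch_leaf S L i c (0, 1) of (u, v) \<Rightarrow> u * S + v)"
proof -
  have fold: "fold (\<lambda>k. leaf_step S i c (L - 1 - k)) [0..<L] 1 =
    (case savitch_leaf S L i c (0, 1) of (u, v) \<Rightarrow> u * S + v)"
    using fold_leaf_step[of 0 S 1 i c L] assms by simp
  have less: "fold (\<lambda>k. leaf_step S i c (L - 1 - k)) [0..<n] 1 < S * S" for n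
  proof (induction n)
    case 0
    have "1 * 1 < S * S" using assms by (intro mult_strict_mono) auto
    then show ?case by simp
  next
    case (Suc n)
    then show ?case using leaf_step_less[of S] assms by simp
  qed
  have le: "fold (\<lambda>k. leaf_step S i c (L - 1 - k)) [0..<n] 1 \<le> X" for n
    using less[of n] assms by simp
  define l where "l = EVar vL \<ominus> ECst 1 \<ominus> EVar 2"
  define w where "w = eMod (EVar vi \<oslash> ePow vS l) (EVar vS)"
  define body where "body = eCond (eEq (eMod (EVar vc \<oslash> ePow2 l) (ECst 2)) (ECst 0))
       (EVar 0 \<oslash> EVar vS \<otimes> EVar vS \<oplus> w) (w \<otimes> EVar vS \<oplus> eMod (EVar 0) (EVar vS))"
  have el: "eval xs l (env(0 := a, 2 := k)) = L - 1 - k" for a k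
    using assms by (simp add: l_def)
  have eb: "eval xs body (env(0 := a, 2 := k)) = leaf_step S i c (L - 1 - k) a" for a k
    unfolding body_def w_def leaf_step_def using assms by (simp add: eval_ePow el)
  have ef: "eval xs (EFold 0 2 e (ECst 1) body) env =
      fold (\<lambda>k. leaf_step S i c (L - 1 - k)) [0..<eval xs e env] 1" for e
    by (simp only: eval.simps eb)
  have "2 ^ (L - 1 - k) \<le> X" "S ^ (L - 1 - k) \<le> X" "L - 1 - k \<le> C" for k :: nat
    using power_le_bound[of 2 L X "L - 1 - k"] power_le_bound[of S L X "L - 1 - k"] assms by simp_all
  moreover have "vbound xs X C l env'" for env' by (simp add: l_def)
  ultimately have vb: "vbound xs X C body (env(0 := a, 2 := k))" for a k
    unfolding body_def w_def using assms by (simp add: vbound_ePow el)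
  have vf: "vbound xs X C (EFold 0 2 (EVar vL) (ECst 1) body) env"
    unfolding vbound.simps ef using le vb assms(1,5) by simp
  have lexp: "leaf_exp = EFold 0 2 (EVar vL) (ECst 1) body"
    unfolding leaf_exp_def Let_def body_def w_def l_def ..
  have "eval xs leaf_exp env = (case savitch_leaf S L i c (0, 1) of (u, v) \<Rightarrow> u * S + v)"
    unfolding lexp ef using fold assms(1) by simp
  then show ?thesis unfolding espec_def lexp using vf by blast
qed

definition cell_exp :: exp where
  "cell_exp = (let n2 = ECst 2 \<otimes> EVar vn in
     eCond (eEq (EVar vih) (ECst 0)) (ECst 1)
    (eCond (eOr (eEq (EVar vih) (EVar vn \<oplus> ECst 1)) (eEq (EVar vih) (n2 \<oplus> ECst 2))) (ECst 5)
    (eCond (eLess (EVar vih) (n2 \<oplus> ECst 2)) (eCond (eEq (EVar vih) (EVar vj)) (ECst 3 \<oplus> EVar vm) (ECst 0))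
    (eCond (eEq (EVar vih) (n2 \<oplus> ECst 3)) (ECst 3 \<oplus> EVar vneg)
    (eCond (eLess (EVar vih) (EVar vRE))
       (ECst 3 \<oplus> eMod (EVar vak \<oslash> ePow2 (EVar vRE \<ominus> ECst 1 \<ominus> EVar vih)) (ECst 2)) (ECst 2))))))"

lemma espec_cell_exp:
  assumes "env vn = n" "env vih = i" "env vj = j" "env vm = of_bool m" "env vneg = of_bool neg"
    "env vRE = RE" "env vak = ak" "RE \<le> C" "2 ^ RE \<le> X"
  shows "espec xs X C cell_exp env (cell_at n neg ak RE j m i)"
proof -
  have "2 ^ (RE - 1 - i) \<le> X"
    using assms power_le_bound[of 2 RE X "RE - 1 - i"] by simp
  moreover have "RE - Suc i \<le> C" using assms by simp
  ultimately show ?thesis using assms unfolding espec_def cell_exp_def Let_def cell_at_def by simp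
qed

fun move_head_exp :: "move \<Rightarrow> exp \<Rightarrow> exp" where
  "move_head_exp MLeft e = e \<ominus> ECst 1"
| "move_head_exp MStay e = e"
| "move_head_exp MRight e = e \<oplus> ECst 1"

fun move_code_exp :: "nat \<Rightarrow> move \<Rightarrow> exp \<Rightarrow> exp" where
  "move_code_exp G MLeft e = (e \<oplus> ECst 1) \<oslash> ECst G \<ominus> ECst 1"
| "move_code_exp G MStay e = e"
| "move_code_exp G MRight e = (e \<oplus> ECst 1) \<otimes> ECst G \<ominus> ECst 1"

text \<open>The machine is fixed, so its transitions become constants of the expression. The form x
  - (x - y) is the minimum of x and y under truncated subtraction.\<close>

fun trans_exp :: "nat \<Rightarrow> nat \<Rightarrow> trans \<Rightarrow> exp" where
  "trans_exp Q G (q0, c0, s0, q1, s1, di, dw) =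
     eEq (EVar vq) (ECst q0) \<otimes> (eEq (EVar vcl) (ECst (cell_code c0)) \<otimes>
     (eEq (eMod (EVar vtp \<oslash> (EVar vh \<oplus> ECst 1)) (ECst G)) (ECst s0) \<otimes>
      eEq (EVar vv) (ECst q1 \<oplus> ECst Q \<otimes>
        ((move_head_exp di (EVar vih) \<ominus> (move_head_exp di (EVar vih) \<ominus> EVar vRE)) \<oplus> EVar vI \<otimes>
        (move_code_exp G dw (EVar vh) \<oplus> EVar vZ \<otimes>
        (EVar vtp \<oplus> ECst s1 \<otimes> (EVar vh \<oplus> ECst 1) \<ominus> ECst s0 \<otimes> (EVar vh \<oplus> ECst 1)))))))"

lemma espec_trans_exp:
  assumes "env vI = I" "env vZ = Z" "env vRE = RE"
  shows "espec xs X C (trans_exp Q G tr) env (of_bool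
    (code_trans Q I Z G RE (env vq) (env vih) (env vh) (env vtp) (env vcl) (env vv) tr))"
proof (cases tr)
  case (fields q0 c0 s0 q1 s1 di dw)
  have mh: "eval xs (move_head_exp di e) env = move_head di (eval xs e env)"
    "vbound xs X C (move_head_exp di e) env = vbound xs X C e env" for e
    by (cases di; simp)+
  have mc: "eval xs (move_code_exp G dw e) env = move_code G dw (eval xs e env)"
    "vbound xs X C (move_code_exp G dw e) env = vbound xs X C e env" for e
    by (cases dw; simp)+
  have min: "a - (a - b) = min b a" for a b :: nat by simp
  show ?thesis
    using assms unfolding espec_def fields trans_exp.simps code_trans.simps
    by (simp add: mh mc min cfg_code_def of_bool_conj)
qed

text \<open>The disjunction over transitions is a sum of truth values. The case u = v is included
  because both kinds of program test for at most one step.\<close>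

definition step_exp :: "trans list \<Rightarrow> nat \<Rightarrow> nat \<Rightarrow> exp" where
  "step_exp ts Q G = eOr (foldr (\<lambda>tr e. trans_exp Q G tr \<oplus> e) ts (ECst 0))
     (eOr (eEq (EVar vq) (ECst 1) \<otimes> eEq (EVar vv) (ECst 1)) (eEq (EVar vu) (EVar vv)))"

lemma espec_step_exp:
  assumes "env vI = I" "env vZ = Z" "env vRE = RE" "env vu = u" "env vv = v"
    "env vq = u mod Q" "env vih = u div Q mod I" "env vh = u div Q div I mod Z"
    "env vtp = u div Q div I div Z" "env vcl = cl"
  shows "espec xs X C (step_exp ts Q G) env (of_bool (u = v \<or> code_step ts Q I Z G RE u cl v))"
proof -
  define F where "F = foldr (\<lambda>tr e. trans_exp Q G tr \<oplus> e) ts (ECst 0)"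
  define B where "B \<longleftrightarrow> (\<exists>tr \<in> set ts.
    code_trans Q I Z G RE (env vq) (env vih) (env vh) (env vtp) (env vcl) (env vv) tr)"
  have F: "vbound xs X C F env \<and> (eval xs F env > 0 \<longleftrightarrow> B)"
    unfolding F_def B_def
  proof (induction ts)
    case (Cons tr ts)
    then show ?case using espec_trans_exp[OF assms(1-3), of xs X C Q G tr]
      by (simp add: espec_def)
  qed simp
  have "code_step ts Q I Z G RE u cl v \<longleftrightarrow> B \<or> (env vq = 1 \<and> env vv = 1)"
    unfolding code_step_def B_def assms ..
  then show ?thesis using F assms(4,5) unfolding espec_def step_exp_def F_def[symmetric] by auto
qed

lemma sspec_mono:
  "sspec xs X C c env ys k \<Longrightarrow> ys = ys' \<Longrightarrow> k \<le> k' \<Longrightarrow> sspec xs X C c env ys' k'"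
  by (auto simp: sspec_def)

definition edge_exp :: "trans list \<Rightarrow> nat \<Rightarrow> nat \<Rightarrow> bool \<Rightarrow> exp" where
  "edge_exp ts Q G mx =
     (if mx then eCond (eLess (EVar vt \<oplus> ECst 1) (EVar vT)) (step_exp ts Q G) (eEq (EVar vc) (ECst 1))
      else eCond (eEq (EVar vj) (ECst 0)) agree_exp
        (eEq (EVar vc) (EVar vc') \<otimes> (ECst 1 \<ominus> step_exp ts Q G)))"

text \<open>For the maximum the two nodes of an edge are the configurations to compare. For the
  minimum they are claim strings, and the configurations are the endpoints of the leaf selected by
  claims and time.\<close>

definition endpoints_exp :: "bool \<Rightarrow> exp" where
  "endpoints_exp mx = (if mx then EVar vc \<otimes> EVar vS \<oplus> EVar vc' else leaf_exp)"

definition edge_stm :: "trans list \<Rightarrow> nat \<Rightarrow> nat \<Rightarrow> bool \<Rightarrow> stm" where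
  "edge_stm ts Q G mx =
     SLet vm (eMod (EVar ve) (ECst 2)) (
     SLet vc' (eMod (EVar ve \<oslash> ECst 2) (EVar vS)) (
     SLet vc (eMod (EVar ve \<oslash> ECst 2 \<oslash> EVar vS) (EVar vS)) (
     SLet vt (EVar ve \<oslash> ECst 2 \<oslash> EVar vS \<oslash> EVar vS) (
     SLet vi (EVar vt \<oslash> EVar vV) (
     SLet vj (eMod (EVar vt) (EVar vV)) (
     SLet vlf (endpoints_exp mx) (
     SLet vu (EVar vlf \<oslash> EVar vS) (
     SLet vv (eMod (EVar vlf) (EVar vS)) (
     SLet vq (eMod (EVar vu) (ECst Q)) (
     SLet vih (eMod (EVar vu \<oslash> ECst Q) (EVar vI)) (
     SLet vh (eMod (EVar vu \<oslash> ECst Q \<oslash> EVar vI) (EVar vZ)) (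
     SLet vtp (EVar vu \<oslash> ECst Q \<oslash> EVar vI \<oslash> EVar vZ) (
     SLet vcl cell_exp (
     SLet vfl (edge_exp ts Q G mx) (
     SSeq (SEmit (EVar vt)) (
     SSeq (SEmit (EVar vc)) (
     SSeq (SEmit (EVar vc' \<oplus> EVar vS \<otimes> (ECst 1 \<ominus> EVar vfl)))
       (SEmit (EVar vm)))))))))))))))))))"

definition edge_rel :: "bool \<Rightarrow> (nat \<Rightarrow> nat \<Rightarrow> nat \<Rightarrow> bool \<Rightarrow> bool) \<Rightarrow> nat \<Rightarrow> nat \<Rightarrow> nat \<Rightarrow> nat \<Rightarrow> nat \<Rightarrow> nat \<Rightarrow> bool \<Rightarrow> bool" where
  "edge_rel mx ok V S L = (if mx then walk_edge ok V S else savitch_edge ok V S L)"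

definition layers :: "bool \<Rightarrow> nat \<Rightarrow> nat \<Rightarrow> nat \<Rightarrow> nat" where
  "layers mx V S L = (if mx then V * S + 1 else V * S ^ L + 1)"

fun enc_edge :: "nat \<times> nat \<times> nat \<times> bool \<Rightarrow> nat list" where
  "enc_edge (i, u, v, m) = [i, u, v, of_bool m]"

text \<open>The 19 steps are 15 bindings and 4 emitted numbers, the same for every edge of both
  kinds of program.\<close>

lemma sspec_edge_stm:
  fixes n L S I Z RE ak :: nat
  assumes env: "env vn = n" "env vV = V" "env vL = L" "env vS = S" "env vI = I" "env vZ = Z"
      "env vT = T" "env vneg = of_bool neg" "env vak = ak" "env vRE = RE" "env ve = e"
    and T: "T = layers mx V S L" and e: "e < 2 * (S * (S * T))" and S: "S > 1" "S = 2 ^ L"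
    and X: "2 * (S * (S * T)) \<le> X" "2 ^ RE \<le> X" "\<not> mx \<Longrightarrow> S ^ L \<le> X" "5 \<le> X"
    and C: "L \<le> C" "RE \<le> C"
  shows "sspec xs X C (edge_stm ts Q G mx) env
    (enc_edge (bp_edge S (edge_rel mx (query_step ts Q I Z G RE n neg ak) V S L) e)) 19"
proof -
  define m where "m = odd e"
  define c' where "c' = e div 2 mod S"
  define c where "c = e div 2 div S mod S"
  define t where "t = e div 2 div S div S"
  define lf where "lf = (if mx then (c, c') else savitch_leaf S L (t div V) c (0, 1))"
  define u where "u = fst lf"
  define v where "v = snd lf"
  define cl where "cl = cell_at n neg ak RE (t mod V) m (u div Q mod I)"
  define ok where "ok = query_step ts Q I Z G RE n neg ak"
  define b where "b \<longleftrightarrow> edge_rel mx ok V S L t c c' m"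
  have lt: "c < S" "c' < S" using S by (auto simp: c_def c'_def)
  have tT: "t < T"
  proof -
    have "e div 2 < S * (S * T)" using e by auto
    then have "e div 2 div S < S * T" by (simp add: less_mult_imp_div_less mult.commute)
    then show ?thesis unfolding t_def by (simp add: less_mult_imp_div_less mult.commute)
  qed
  have T1: "T \<ge> 1" using T by (simp add: layers_def)
  have SS: "S * S \<le> X"
  proof -
    have "S * S * 1 \<le> S * S * T" using T1 by (rule mult_le_mono2)
    then show ?thesis using X(1) unfolding mult.assoc mult_1_right by linarith
  qed
  have SX: "S \<le> X" using SS S by (meson le_trans le_square)
  have TX: "T \<le> X"
  proof -
    have "1 * (1 * T) \<le> S * (S * T)" using S(1) by (intro mult_le_mono) auto
    then show ?thesis using X(1) unfolding mult_1_left by linarith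
  qed
  have uv: "u < S" "v < S"
    using lt savitch_leaf_less[of S "(0, 1)" L "t div V" c] S by (auto simp: u_def v_def lf_def)
  have lfX: "u * S + v < S * S"
  proof -
    have "u * S + v < (u + 1) * S" using uv by simp
    also have "\<dots> \<le> S * S" using uv by (intro mult_le_mono1) simp
    finally show ?thesis .
  qed
  have code: "code_step ts Q I Z G RE u cl v = ok u v (t mod V) m"
    by (simp add: ok_def query_step_def cl_def)
  have edge: "bp_edge S (edge_rel mx ok V S L) e = (t, c, c' + S * (1 - of_bool b), m)"
    by (simp add: bp_edge_def Let_def m_def c'_def c_def t_def b_def)
  define env1 where "env1 = env(vm := of_bool m, vc' := c', vc := c, vt := t, vi := t div V, vj := t mod V)"
  have env1: "env1 vn = n" "env1 vV = V" "env1 vL = L" "env1 vS = S" "env1 vI = I" "env1 vZ = Z"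
      "env1 vT = T" "env1 vneg = of_bool neg" "env1 vak = ak" "env1 vRE = RE"
      "env1 vm = of_bool m" "env1 vc' = c'" "env1 vc = c" "env1 vt = t" "env1 vi = t div V" "env1 vj = t mod V"
    using env by (simp_all add: env1_def)
  have lf: "espec xs X C (endpoints_exp mx) env1 (u * S + v)"
  proof (cases mx)
    case True
    then show ?thesis using env1 by (simp add: espec_def endpoints_exp_def u_def v_def lf_def)
  next
    case False
    have "espec xs X C leaf_exp env1 (case savitch_leaf S L (t div V) c (0, 1) of (u, v) \<Rightarrow> u * S + v)"
      using env1 C S SX SS X(3) False by (intro espec_leaf_exp) auto
    then show ?thesis using False by (simp add: endpoints_exp_def u_def v_def lf_def case_prod_beta)
  qed
  define env2 where "env2 = env1(vlf := u * S + v, vu := u, vv := v, vq := u mod Q,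
    vih := u div Q mod I, vh := u div Q div I mod Z, vtp := u div Q div I div Z)"
  have env2: "env2 vn = n" "env2 vV = V" "env2 vL = L" "env2 vS = S" "env2 vI = I" "env2 vZ = Z"
      "env2 vT = T" "env2 vneg = of_bool neg" "env2 vak = ak" "env2 vRE = RE"
      "env2 vm = of_bool m" "env2 vc' = c'" "env2 vc = c" "env2 vt = t" "env2 vi = t div V" "env2 vj = t mod V"
      "env2 vu = u" "env2 vv = v" "env2 vq = u mod Q"
      "env2 vih = u div Q mod I" "env2 vh = u div Q div I mod Z" "env2 vtp = u div Q div I div Z"
    using env1 by (simp_all add: env2_def)
  have cell: "espec xs X C cell_exp env2 cl"
    unfolding cl_def using env2 C X by (intro espec_cell_exp) auto
  have clX: "cl \<le> X"
  proof -
    have "ak div 2 ^ (RE - 1 - u div Q mod I) mod 2 < 2" by simp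
    then have "cl \<le> 5" unfolding cl_def cell_at_def by (simp only: split: if_splits) auto
    then show ?thesis using X by simp
  qed
  define env3 where "env3 = env2(vcl := cl)"
  have env3: "env3 vL = L" "env3 vS = S" "env3 vI = I" "env3 vZ = Z"
      "env3 vT = T" "env3 vRE = RE"
      "env3 vm = of_bool m" "env3 vc' = c'" "env3 vc = c" "env3 vt = t" "env3 vi = t div V" "env3 vj = t mod V"
      "env3 vu = u" "env3 vv = v" "env3 vq = u mod Q" "env3 vcl = cl"
      "env3 vih = u div Q mod I" "env3 vh = u div Q div I mod Z" "env3 vtp = u div Q div I div Z"
    using env2 by (simp_all add: env3_def)
  have step: "espec xs X C (step_exp ts Q G) env3 (of_bool (u = v \<or> ok u v (t mod V) m))"
    unfolding code[symmetric] using env3 by (intro espec_step_exp) auto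
  have flag: "espec xs X C (edge_exp ts Q G mx) env3 (of_bool b)"
  proof (cases mx)
    case True
    have "t + 1 < T \<longleftrightarrow> t < V * S" using True T by (simp add: layers_def)
    then show ?thesis using True step env3
      by (simp add: espec_def edge_exp_def b_def edge_rel_def walk_edge_def u_def v_def lf_def)
  next
    case False
    have "espec xs X C agree_exp env3 (of_bool (savitch_agree S L (t div V) c c'))"
      using env3 C S SX X(3) False by (intro espec_agree_exp) auto
    moreover have "b \<longleftrightarrow> (if t mod V = 0 then savitch_agree S L (t div V) c c'
        else c = c' \<and> \<not> (u = v \<or> ok u v (t mod V) m))"
      using False by (simp add: b_def edge_rel_def savitch_edge_def u_def v_def lf_def case_prod_beta)
    ultimately show ?thesis using False step env3
      by (simp add: espec_def edge_exp_def)
  qed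
  have tX: "t \<le> X" using tT TX by simp
  have divX: "t div V \<le> X" using tX by (meson div_le_dividend le_trans)
  have modX: "t mod V \<le> X" using tX by (meson mod_less_eq_dividend le_trans)
  have uX: "u \<le> X" using uv SX by simp
  have uX': "u mod Q \<le> X" "u div Q mod I \<le> X" "u div Q div I mod Z \<le> X" "u div Q div I div Z \<le> X"
    using uX by (meson div_le_dividend mod_less_eq_dividend le_trans)+
  let ?E1 = "env(vm := of_bool m, vc' := c', vc := c, vt := t, vi := t div V, vj := t mod V)"
  let ?E2 = "?E1(vlf := u * S + v, vu := u, vv := v, vq := u mod Q, vih := u div Q mod I,
    vh := u div Q div I mod Z, vtp := u div Q div I div Z)"
  have emits: "sspec xs X C (SSeq (SEmit (EVar vt)) (SSeq (SEmit (EVar vc))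
     (SSeq (SEmit (EVar vc' \<oplus> EVar vS \<otimes> (ECst 1 \<ominus> EVar vfl))) (SEmit (EVar vm)))))
     (env3(vfl := of_bool b)) ([t] @ [c] @ [c' + S * (1 - of_bool b)] @ [of_bool m]) (1 + (1 + (1 + 1)))"
    by (intro sspec_SSeq sspec_SEmit) (auto simp: espec_def env3)
  have "sspec xs X C (edge_stm ts Q G mx) env ([t] @ [c] @ [c' + S * (1 - of_bool b)] @ [of_bool m])
     ((1 + (1 + (1 + 1))) + 1 + 1 + 1 + 1 + 1 + 1 + 1 + 1 + 1 + 1 + 1 + 1 + 1 + 1 + 1)"
    unfolding edge_stm_def
  proof (intro sspec_SLet)
    show "espec xs X C (eMod (EVar ve) (ECst 2)) env (of_bool m)"
      using env by (simp add: espec_def m_def mod_2_eq_odd)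
    show "espec xs X C (eMod (EVar ve \<oslash> ECst 2) (EVar vS)) (env(vm := of_bool m)) c'"
      using env by (simp add: espec_def c'_def)
    show "espec xs X C (eMod (EVar ve \<oslash> ECst 2 \<oslash> EVar vS) (EVar vS)) (env(vm := of_bool m, vc' := c')) c"
      using env by (simp add: espec_def c_def)
    show "espec xs X C (EVar ve \<oslash> ECst 2 \<oslash> EVar vS \<oslash> EVar vS) (env(vm := of_bool m, vc' := c', vc := c)) t"
      using env by (simp add: espec_def t_def)
    show "espec xs X C (EVar vt \<oslash> EVar vV) (env(vm := of_bool m, vc' := c', vc := c, vt := t)) (t div V)"
      using env by (simp add: espec_def)
    show "espec xs X C (eMod (EVar vt) (EVar vV)) (env(vm := of_bool m, vc' := c', vc := c, vt := t, vi := t div V)) (t mod V)"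
      using env by (simp add: espec_def)
    show "espec xs X C (endpoints_exp mx) ?E1 (u * S + v)"
      using lf unfolding env1_def .
    show "espec xs X C (EVar vlf \<oslash> EVar vS) (?E1(vlf := u * S + v)) u"
      using env uv by (simp add: espec_def)
    show "espec xs X C (eMod (EVar vlf) (EVar vS)) (?E1(vlf := u * S + v, vu := u)) v"
      using env uv by (simp add: espec_def)
    show "espec xs X C (eMod (EVar vu) (ECst Q)) (?E1(vlf := u * S + v, vu := u, vv := v)) (u mod Q)"
      by (simp add: espec_def)
    show "espec xs X C (eMod (EVar vu \<oslash> ECst Q) (EVar vI)) (?E1(vlf := u * S + v, vu := u, vv := v, vq := u mod Q)) (u div Q mod I)"
      using env by (simp add: espec_def)
    show "espec xs X C (eMod (EVar vu \<oslash> ECst Q \<oslash> EVar vI) (EVar vZ))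
      (?E1(vlf := u * S + v, vu := u, vv := v, vq := u mod Q, vih := u div Q mod I)) (u div Q div I mod Z)"
      using env by (simp add: espec_def)
    show "espec xs X C (EVar vu \<oslash> ECst Q \<oslash> EVar vI \<oslash> EVar vZ)
      (?E1(vlf := u * S + v, vu := u, vv := v, vq := u mod Q, vih := u div Q mod I, vh := u div Q div I mod Z)) (u div Q div I div Z)"
      using env by (simp add: espec_def)
    show "espec xs X C cell_exp ?E2 cl"
      using cell unfolding env2_def env1_def .
    show "espec xs X C (edge_exp ts Q G mx) (?E2(vcl := cl)) (of_bool b)"
      using flag unfolding env3_def env2_def env1_def .
    show "sspec xs X C (SSeq (SEmit (EVar vt)) (SSeq (SEmit (EVar vc))
     (SSeq (SEmit (EVar vc' \<oplus> EVar vS \<otimes> (ECst 1 \<ominus> EVar vfl))) (SEmit (EVar vm)))))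
      (?E2(vcl := cl, vfl := of_bool b)) ([t] @ [c] @ [c' + S * (1 - of_bool b)] @ [of_bool m]) (1 + (1 + (1 + 1)))"
      using emits unfolding env3_def env2_def env1_def .
    show "of_bool m \<le> X" "of_bool b \<le> X" using X(4) by (auto simp: of_bool_def)
    show "c' \<le> X" "c \<le> X" "v \<le> X" using lt uv SX by auto
    show "u * S + v \<le> X" using lfX SS by simp
  qed (fact tX divX modX uX uX' clX)+
  then show ?thesis
    unfolding ok_def[symmetric] edge by (rule sspec_mono) auto
qed

section \<open>The program that produces the instances\<close>

definition bp_stm :: "trans list \<Rightarrow> nat \<Rightarrow> nat \<Rightarrow> bool \<Rightarrow> stm" where
  "bp_stm ts Q G mx =
     SSeq (SEmit (EVar vV)) (SSeq (SEmit (EVar vT \<oplus> ECst 1)) (SSeq (SEmit (ECst 2 \<otimes> EVar vS))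
    (SSeq (SFor ve (EVar vT) (SEmit (eMod (EVar ve) (EVar vV))))
    (SSeq (SEmit (ECst 2 \<otimes> (EVar vS \<otimes> (EVar vS \<otimes> EVar vT))))
      (SFor ve (ECst 2 \<otimes> (EVar vS \<otimes> (EVar vS \<otimes> EVar vT))) (edge_stm ts Q G mx))))))"

lemma enc_bp_mk_bp:
  "enc_bp (mk_bp V W T ed) = [V] @ [T + 1] @ [2 * W] @ concat (map (\<lambda>t. [t mod V]) [0..<T]) @
     [2 * (W * (W * T))] @ concat (map (\<lambda>e. enc_edge (bp_edge W ed e)) [0..<2 * (W * (W * T))])"
proof -
  have "(\<lambda>(i, u, v, m). [i, u, v, of_bool m]) = enc_edge" by auto
  then show ?thesis by (simp add: enc_bp_def mk_bp_def o_def concat_map_singleton)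
qed

lemma sspec_bp_stm:
  fixes n L S I Z RE ak :: nat
  assumes env: "env vn = n" "env vV = V" "env vL = L" "env vS = S" "env vI = I" "env vZ = Z"
      "env vT = T" "env vneg = of_bool neg" "env vak = ak" "env vRE = RE"
    and T: "T = layers mx V S L" and S: "S > 1" "S = 2 ^ L"
    and X: "2 * (S * (S * T)) \<le> X" "2 ^ RE \<le> X" "\<not> mx \<Longrightarrow> S ^ L \<le> X" "5 \<le> X" "T \<le> X"
    and C: "L \<le> C" "RE \<le> C"
  shows "sspec xs X C (bp_stm ts Q G mx) env
    (enc_bp (mk_bp V S T (edge_rel mx (query_step ts Q I Z G RE n neg ak) V S L)))
    (1 + (1 + (1 + ((1 + T * (1 + 1)) + (1 + (1 + 2 * (S * (S * T)) * (1 + 19)))))))"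
  unfolding bp_stm_def enc_bp_mk_bp
proof (intro sspec_SSeq sspec_SEmit sspec_SFor)
  fix e assume "e < 2 * (S * (S * T))"
  then show "sspec xs X C (edge_stm ts Q G mx) (env(ve := e))
    (enc_edge (bp_edge S (edge_rel mx (query_step ts Q I Z G RE n neg ak) V S L) e)) 19"
    by (intro sspec_edge_stm) (use assms in simp_all)
qed (use env X in \<open>simp_all add: espec_def\<close>)

text \<open>\<open>off\<close> is the position of the number of strings. Block e starts at
  \<open>off\<close> + 1 + e * (n + 1) with the length of its string and the bits follow, hence the
  2. The constant 0 that is emitted is the prepended bit.\<close>

definition strings_stm :: "exp \<Rightarrow> stm" where
  "strings_stm off = SSeq (SEmit (EVar vN)) (SFor ve (EVar vN)
     (SSeq (SEmit (EVar vn \<oplus> ECst 1)) (SSeq (SEmit (ECst 0))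
       (SFor vm (EVar vn) (SEmit (EIn (off \<oplus> ECst 2 \<oplus> EVar ve \<otimes> (EVar vn \<oplus> ECst 1) \<oplus> EVar vm)))))))"

lemma map_nth_upt: "length a = n \<Longrightarrow> map (\<lambda>j. f (a ! j)) [0..<n] = map f a"
  by (auto intro: nth_equalityI)

lemma enc_strings_pad:
  assumes "string_set N n as"
  shows "enc_strings (map ((#) False) as) = [N] @ concat (map (\<lambda>e. [n + 1] @ [0] @
    concat (map (\<lambda>j. [of_bool (as ! e ! j)]) [0..<n])) [0..<N])"
proof -
  have "map (\<lambda>e. [n + 1] @ [0] @ concat (map (\<lambda>j. [of_bool (as ! e ! j)]) [0..<n])) [0..<N] =
    map enc_bools (map ((#) False) as)"
  proof (rule nth_equalityI)
    show "length (map (\<lambda>e. [n + 1] @ [0] @ concat (map (\<lambda>j. [of_bool (as ! e ! j)]) [0..<n])) [0..<N]) =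
      length (map enc_bools (map ((#) False) as))"
      using assms by (simp add: string_set_def)
    fix e assume "e < length (map (\<lambda>e. [n + 1] @ [0] @ concat (map (\<lambda>j. [of_bool (as ! e ! j)]) [0..<n])) [0..<N])"
    then have e: "e < N" "length (as ! e) = n" "length as = N"
      using assms by (auto simp: string_set_def)
    then show "map (\<lambda>e. [n + 1] @ [0] @ concat (map (\<lambda>j. [of_bool (as ! e ! j)]) [0..<n])) [0..<N] ! e =
      map enc_bools (map ((#) False) as) ! e"
      by (simp add: enc_bools_def concat_map_singleton map_nth_upt)
  qed
  then show ?thesis using assms by (simp add: enc_strings_def string_set_def)
qed

lemma sspec_strings_stm:
  assumes env: "env vN = N" "env vn = n"
    and as: "string_set N n as"
    and off: "\<And>e j. espec xs X C off (env(ve := e, vm := j)) b"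
    and inp: "\<And>e j. e < N \<Longrightarrow> j < n \<Longrightarrow> input_at xs (b + 2 + e * (n + 1) + j) = of_bool (as ! e ! j)"
    and X: "N \<le> X" "n \<le> X"
  shows "sspec xs X C (strings_stm off) env (enc_strings (map ((#) False) as))
    (1 + (1 + N * (1 + (1 + (1 + (1 + n * (1 + 1)))))))"
  unfolding strings_stm_def enc_strings_pad[OF as]
proof (intro sspec_SSeq sspec_SEmit sspec_SFor)
  fix e j assume "e < N" "j < n"
  then show "espec xs X C (EIn (off \<oplus> ECst 2 \<oplus> EVar ve \<otimes> (EVar vn \<oplus> ECst 1) \<oplus> EVar vm))
      (env(ve := e, vm := j)) (of_bool (as ! e ! j))"
    using off[of e j] inp[of e j] env by (simp add: espec_def)
qed (use env X in \<open>simp_all add: espec_def\<close>)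

lemma nth_concat_blocks:
  assumes "\<And>x. x \<in> set xss \<Longrightarrow> length x = k" "e < length xss" "j < k"
  shows "concat xss ! (e * k + j) = xss ! e ! j"
  using assms
proof (induction xss arbitrary: e)
  case (Cons x xss)
  then show ?case by (cases e) (auto simp: nth_append)
qed simp

lemma length_enc_strings:
  assumes "string_set N n as"
  shows "length (enc_strings as) = 1 + N * (n + 1)"
proof -
  have "map (length \<circ> enc_bools) as = map (\<lambda>_. n + 1) as"
    using assms by (auto simp: string_set_def enc_bools_def)
  then have "sum_list (map (length \<circ> enc_bools) as) = sum_list (map (\<lambda>_. n + 1) as)"
    by (rule arg_cong)
  also have "\<dots> = N * (n + 1)" using assms by (simp add: string_set_def sum_list_triv)
  finally have "sum_list (map (length \<circ> enc_bools) as) = N * (n + 1)" .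
  then show ?thesis by (simp add: enc_strings_def length_concat)
qed

lemma nth_enc_strings:
  assumes "string_set N n as" "e < N" "j < n + 1"
  shows "enc_strings as ! (1 + e * (n + 1) + j) = enc_bools (as ! e) ! j"
proof -
  have "concat (map enc_bools as) ! (e * (n + 1) + j) = map enc_bools as ! e ! j"
    using assms by (intro nth_concat_blocks) (auto simp: string_set_def enc_bools_def)
  then show ?thesis using assms by (simp add: enc_strings_def string_set_def)
qed

lemma enc_strings_index_less:
  fixes N n e j :: nat
  assumes "e < N" "j < n + 1"
  shows "1 + e * (n + 1) + j < 1 + N * (n + 1)"
proof -
  have "e * (n + 1) + j < (e + 1) * (n + 1)" using assms by simp
  also have "\<dots> \<le> N * (n + 1)" using assms by (intro mult_le_mono1) simp
  finally show ?thesis by simp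
qed

text \<open>Equal lengths make the position of a bit affine in the indices. The common length is
  read from the header of the first string, which exists because N >= 1.\<close>

lemma input_at_enc_strings:
  assumes as: "string_set N n as" and "N \<ge> 1"
  shows "input_at (enc_strings as @ ys) 0 = N" "input_at (enc_strings as @ ys) 1 = n"
    "\<And>e j. e < N \<Longrightarrow> j < n \<Longrightarrow> input_at (ys @ enc_strings as @ zs) (length ys + 2 + e * (n + 1) + j) = of_bool (as ! e ! j)"
proof -
  note len = length_enc_strings[OF as]
  show "input_at (enc_strings as @ ys) 0 = N"
    using as by (simp add: input_at_def enc_strings_def string_set_def)
  have "enc_strings as ! (1 + 0 * (n + 1) + 0) = enc_bools (as ! 0) ! 0"
    using as assms(2) by (intro nth_enc_strings) auto
  moreover have "length (as ! 0) = n" using as assms(2) by (auto simp: string_set_def)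
  moreover have "1 < length (enc_strings as)" using len assms(2) by simp
  ultimately show "input_at (enc_strings as @ ys) 1 = n"
    by (simp add: input_at_def nth_append enc_bools_def)
  fix e j assume e: "e < N" "j < n"
  have "1 + e * (n + 1) + Suc j < 1 + N * (n + 1)"
    using e by (intro enc_strings_index_less) auto
  moreover have "enc_strings as ! (1 + e * (n + 1) + Suc j) = enc_bools (as ! e) ! Suc j"
    using as e by (intro nth_enc_strings) auto
  moreover have "length (as ! e) = n" using as e by (auto simp: string_set_def)
  moreover have "length ys + 2 + e * (n + 1) + j = length ys + (1 + e * (n + 1) + Suc j)" by simp
  ultimately show "input_at (ys @ enc_strings as @ zs) (length ys + 2 + e * (n + 1) + j) = of_bool (as ! e ! j)"
    using e len unfolding input_at_def by (simp add: nth_append enc_bools_def add.assoc)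
qed

text \<open>\<open>q0\<close> and \<open>g\<close> are bit lengths for states and work symbols,
  \<open>c\<close> and \<open>d\<close> come from the bound on the answers, \<open>e0\<close> is the
  additive constant in the bit length of input positions, and \<open>Cs\<close> and \<open>D\<close>
  come from the space bound.\<close>

locale reduction_params =
  fixes ts :: "trans list" and q0 g c d e0 Cs D :: nat
begin

definition answer_bound :: "nat \<Rightarrow> nat" where
  "answer_bound n = c * n ^ d + c"

definition log_len :: "nat \<Rightarrow> nat" where
  "log_len n = e0 + floorlog 2 n * (d + 1)"

definition space :: "nat \<Rightarrow> nat" where
  "space n = Cs * log_len n ^ D + Cs"

text \<open>The bits of a configuration: state, input position, and two fields of g * space n bits
  for the power that represents the work head and for the tape. All radices are powers of two, so
  \<open>states\<close> is exactly the product of the ranges.\<close>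

definition levels :: "nat \<Rightarrow> nat" where
  "levels n = q0 + log_len n + 2 * (g * space n)"

definition states :: "nat \<Rightarrow> nat" where
  "states n = 2 ^ levels n"

text \<open>Instance \<kappa> asks about the threshold \<kappa> - K with K =
  \<open>answer_bound n\<close>. This is its absolute value, since one of the two truncated
  differences is always 0.\<close>

definition ak :: "nat \<Rightarrow> nat \<Rightarrow> nat" where
  "ak n \<kappa> = (\<kappa> - answer_bound n) + (answer_bound n - \<kappa>)"

definition right_end :: "nat \<Rightarrow> nat \<Rightarrow> nat" where
  "right_end n \<kappa> = 2 * n + 4 + floorlog 2 (ak n \<kappa>)"

definition inst_step :: "nat \<Rightarrow> nat \<Rightarrow> nat \<Rightarrow> nat \<Rightarrow> nat \<Rightarrow> bool \<Rightarrow> bool" where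
  "inst_step n \<kappa> = query_step ts (2 ^ q0) (2 ^ log_len n) (2 ^ (g * space n)) (2 ^ g) (right_end n \<kappa>) n
     (\<kappa> < answer_bound n) (ak n \<kappa>)"

definition inst_bp :: "bool \<Rightarrow> nat \<Rightarrow> nat \<Rightarrow> bp" where
  "inst_bp mx n \<kappa> = mk_bp (2 * n + 2) (states n) (layers mx (2 * n + 2) (states n) (levels n))
     (edge_rel mx (inst_step n \<kappa>) (2 * n + 2) (states n) (levels n))"

definition inst :: "bool \<Rightarrow> nat \<Rightarrow> bool list list \<Rightarrow> bool list list \<Rightarrow> nat \<Rightarrow> bp_instance" where
  "inst mx n as bs \<kappa> = (inst_bp mx n \<kappa>, map ((#) False) as, map ((#) False) bs)"

definition inst_stm :: "bool \<Rightarrow> stm" where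
  "inst_stm mx = SLet vneg (eLess (EVar vkap) (EVar vK))
    (SLet vak ((EVar vkap \<ominus> EVar vK) \<oplus> (EVar vK \<ominus> EVar vkap))
    (SLet vRE (ECst 2 \<otimes> EVar vn \<oplus> ECst 4 \<oplus> eBitlen vak)
    (SSeq (bp_stm ts (2 ^ q0) (2 ^ g) mx)
    (SSeq (strings_stm (ECst 0)) (strings_stm (ECst 1 \<oplus> EVar vN \<otimes> (EVar vn \<oplus> ECst 1)))))))"

definition gen_stm :: "bool \<Rightarrow> stm" where
  "gen_stm mx = SLet vN (EIn (ECst 0)) (SLet vn (EIn (ECst 1)) (SLet vV (ECst 2 \<otimes> EVar vn \<oplus> ECst 2)
    (SLet vK (ECst c \<otimes> ePowC (EVar vn) d \<oplus> ECst c)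
    (SLet vM (ECst e0 \<oplus> eBitlen vn \<otimes> ECst (d + 1))
    (SLet vs (ECst Cs \<otimes> ePowC (EVar vM) D \<oplus> ECst Cs)
    (SLet vL (ECst q0 \<oplus> EVar vM \<oplus> ECst 2 \<otimes> (ECst g \<otimes> EVar vs))
    (SLet vS (ePow2 (EVar vL)) (SLet vI (ePow2 (EVar vM)) (SLet vZ (ePow2 (ECst g \<otimes> EVar vs))
    (SLet vT (if mx then EVar vV \<otimes> EVar vS \<oplus> ECst 1 else EVar vV \<otimes> ePow vS (EVar vL) \<oplus> ECst 1)
    (SSeq (SEmit (ECst 2 \<otimes> EVar vK)) (SFor vkap (ECst 2 \<otimes> EVar vK) (inst_stm mx)))))))))))))"

definition inst_steps :: "bool \<Rightarrow> nat \<Rightarrow> nat \<Rightarrow> nat" where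
  "inst_steps mx N n = (let T = layers mx (2 * n + 2) (states n) (levels n); S = states n in
    ((1 + (1 + (1 + ((1 + T * (1 + 1)) + (1 + (1 + 2 * (S * (S * T)) * (1 + 19)))))))
     + ((1 + (1 + N * (1 + (1 + (1 + (1 + n * (1 + 1)))))))
     + (1 + (1 + N * (1 + (1 + (1 + (1 + n * (1 + 1))))))))) + 1 + 1 + 1)"

text \<open>The exponential term covers the powers of two that occur in computing bit lengths and
  digits of the threshold. The last term is the number of edges, which dominates the numbers of
  layers and configurations and, for the minimum, S ^ L.\<close>

definition max_val :: "bool \<Rightarrow> nat \<Rightarrow> nat \<Rightarrow> nat" where
  "max_val mx N n = N + 2 ^ (2 * n + answer_bound n + 5) +
     2 * (states n * (states n * layers mx (2 * n + 2) (states n) (levels n)))"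

text \<open>Folds run over levels, exponents and bit lengths in the generator and over the 2 * K
  answers in the decoder. None of them runs over the \<open>N\<close> strings, so the bound depends
  on \<open>n\<close> alone.\<close>

definition max_count :: "nat \<Rightarrow> nat" where
  "max_count n = 2 * n + 2 * answer_bound n + levels n + 5"

end

locale reduction_params_pos = reduction_params +
  assumes q0: "q0 \<ge> 1" and g: "g \<ge> 1"
begin

lemma states_gt_1: "states n > 1"
proof -
  have "levels n \<ge> 1" using q0 by (simp add: levels_def)
  then show ?thesis unfolding states_def by (intro one_less_power) auto
qed

lemma max_val_bounds:
  fixes n N :: nat and mx :: bool
  defines "S \<equiv> states n" and "L \<equiv> levels n" and "X \<equiv> max_val mx N n"
  defines "T \<equiv> layers mx (2 * n + 2) S L"
  shows "N \<le> X" "n \<le> X" "2 * n + 2 \<le> X" "2 * answer_bound n \<le> X" "2 * (S * (S * T)) \<le> X" "S \<le> X" "T \<le> X"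
    "log_len n \<le> X" "space n \<le> X" "L \<le> X" "2 ^ log_len n \<le> X" "2 ^ (g * space n) \<le> X" "5 \<le> X"
    "\<not> mx \<Longrightarrow> S ^ L \<le> X" "2 ^ (2 * n + answer_bound n + 5) \<le> X"
proof -
  let ?K = "answer_bound n"
  have S1: "S > 1" unfolding S_def by (rule states_gt_1)
  show "N \<le> X" "2 * (S * (S * T)) \<le> X" "2 ^ (2 * n + ?K + 5) \<le> X"
    by (simp_all add: X_def max_val_def S_def T_def L_def)
  note big = this
  have "2 * n + ?K + 5 < 2 ^ (2 * n + ?K + 5)" by (rule less_exp)
  then show "n \<le> X" "2 * n + 2 \<le> X" "5 \<le> X" using big(3) by linarith+
  have "2 * ?K \<le> 2 * 2 ^ ?K" using less_imp_le[OF less_exp[of ?K]] by simp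
  also have "\<dots> = 2 ^ (?K + 1)" by simp
  also have "\<dots> \<le> 2 ^ (2 * n + ?K + 5)" by (rule power_increasing) auto
  finally show "2 * ?K \<le> X" using big(3) by linarith
  have T1: "T \<ge> 1" by (simp add: T_def layers_def)
  have "S * (1 * 1) \<le> S * (S * T)" using S1 T1 by (intro mult_le_mono) auto
  then show SX: "S \<le> X" using big(2) by linarith
  have "1 * (1 * T) \<le> S * (S * T)" using S1 by (intro mult_le_mono) auto
  then show TX: "T \<le> X" using big(2) by linarith
  have LS: "L < S" unfolding S_def states_def L_def by (rule less_exp)
  then show LX: "L \<le> X" using SX by simp
  have "log_len n \<le> L" by (simp add: L_def levels_def)
  then show "log_len n \<le> X" using LX by simp
  have "1 * space n \<le> g * space n" using g by (intro mult_le_mono) auto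
  moreover have gL: "g * space n \<le> L" by (simp add: L_def levels_def)
  ultimately show "space n \<le> X" using LX by linarith
  have "2 ^ log_len n \<le> S" "2 ^ (g * space n) \<le> S"
    unfolding S_def states_def levels_def by (intro power_increasing; simp)+
  then show "2 ^ log_len n \<le> X" "2 ^ (g * space n) \<le> X" using SX by linarith+
  show "S ^ L \<le> X" if "\<not> mx"
  proof -
    have "1 * S ^ L \<le> (2 * n + 2) * S ^ L" by (intro mult_le_mono) auto
    then have "S ^ L \<le> T" using that unfolding T_def layers_def by simp
    then show ?thesis using TX by simp
  qed
qed

lemma max_count_le_max_val: "max_count n \<le> max_val mx N n"
proof -
  have "2 * n + answer_bound n < 2 ^ (2 * n + answer_bound n)" by (rule less_exp)
  then have "2 * n + 2 * answer_bound n + 5 \<le> 32 * 2 ^ (2 * n + answer_bound n)" by linarith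
  also have "\<dots> = 2 ^ (2 * n + answer_bound n + 5)" by (simp add: power_add)
  finally have "2 * n + 2 * answer_bound n + 5 \<le> 2 ^ (2 * n + answer_bound n + 5)" .
  moreover have "levels n \<le> 2 * (states n * (states n * layers mx (2 * n + 2) (states n) (levels n)))"
  proof -
    have "levels n < states n" unfolding states_def by (rule less_exp)
    moreover have "states n * (1 * 1) \<le> states n * (states n * layers mx (2 * n + 2) (states n) (levels n))"
      using states_gt_1[of n] by (intro mult_le_mono) (auto simp: layers_def)
    ultimately show ?thesis unfolding mult_1_right by linarith
  qed
  ultimately show ?thesis unfolding max_count_def max_val_def by linarith
qed

lemma sspec_inst_stm:
  fixes n N :: nat and mx :: bool
  defines "S \<equiv> states n" and "L \<equiv> levels n" and "X \<equiv> max_val mx N n" and "C \<equiv> max_count n"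
  assumes as: "string_set N n as" and bs: "string_set N n bs" and N: "N \<ge> 1"
    and xs: "xs = enc_strings as @ enc_strings bs"
    and env: "env vN = N" "env vn = n" "env vV = 2 * n + 2" "env vK = answer_bound n" "env vL = L" "env vS = S"
      "env vI = 2 ^ log_len n" "env vZ = 2 ^ (g * space n)" "env vT = layers mx (2 * n + 2) S L" "env vkap = \<kappa>"
    and \<kappa>: "\<kappa> < 2 * answer_bound n"
  shows "sspec xs X C (inst_stm mx) env (enc_bp_instance (inst mx n as bs \<kappa>)) (inst_steps mx N n)"
proof -
  note mv = max_val_bounds[where N = N and mx = mx and n = n, folded S_def L_def X_def]
  let ?K = "answer_bound n"
  let ?RE = "right_end n \<kappa>"
  have ak: "ak n \<kappa> \<le> ?K" using \<kappa> by (simp add: ak_def)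
  have RE: "?RE \<le> 2 * n + 4 + ?K"
    using floorlog_le_self[of "ak n \<kappa>"] ak by (simp add: right_end_def)
  have pow: "2 ^ k \<le> X" if "k \<le> 2 * n + ?K + 5" for k
    using mv(15) that by (rule power_le_bound) simp
  define env' where "env' = env(vneg := of_bool (\<kappa> < ?K), vak := ak n \<kappa>, vRE := ?RE)"
  have env': "env' vN = N" "env' vn = n" "env' vV = 2 * n + 2" "env' vK = answer_bound n" "env' vL = L" "env' vS = S"
      "env' vI = 2 ^ log_len n" "env' vZ = 2 ^ (g * space n)" "env' vT = layers mx (2 * n + 2) S L"
      "env' vneg = of_bool (\<kappa> < ?K)" "env' vak = ak n \<kappa>" "env' vRE = ?RE"
    using env by (simp_all add: env'_def)
  have 1: "sspec xs X C (bp_stm ts (2 ^ q0) (2 ^ g) mx) env' (enc_bp (inst_bp mx n \<kappa>))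
     (1 + (1 + (1 + ((1 + layers mx (2 * n + 2) S L * (1 + 1)) + (1 + (1 + 2 * (S * (S * layers mx (2 * n + 2) S L)) * (1 + 19)))))))"
    unfolding inst_bp_def inst_step_def S_def[symmetric] L_def[symmetric]
  proof (rule sspec_bp_stm[OF env'(2,3,5-8,9,10,11,12) refl])
    show "S > 1" "S = 2 ^ L" unfolding S_def L_def by (rule states_gt_1, rule states_def)
    show "L \<le> C" "?RE \<le> C" using RE by (simp_all add: C_def max_count_def L_def)
    show "2 ^ ?RE \<le> X" using RE by (intro pow) simp
  qed (use mv in auto)
  have 2: "sspec xs X C (strings_stm (ECst 0)) env' (enc_strings (map ((#) False) as))
    (1 + (1 + N * (1 + (1 + (1 + (1 + n * (1 + 1)))))))"
    using env'(1,2) as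
  proof (rule sspec_strings_stm)
    show "espec xs X C (ECst 0) (env'(ve := e, vm := j)) 0" for e j by (simp add: espec_def)
    show "input_at xs (0 + 2 + e * (n + 1) + j) = of_bool (as ! e ! j)" if "e < N" "j < n" for e j
      using input_at_enc_strings(3)[OF as N that, of "[]" "enc_strings bs"] by (simp add: xs)
  qed (use mv in auto)
  have 3: "sspec xs X C (strings_stm (ECst 1 \<oplus> EVar vN \<otimes> (EVar vn \<oplus> ECst 1))) env' (enc_strings (map ((#) False) bs))
    (1 + (1 + N * (1 + (1 + (1 + (1 + n * (1 + 1)))))))"
    using env'(1,2) bs
  proof (rule sspec_strings_stm)
    show "espec xs X C (ECst 1 \<oplus> EVar vN \<otimes> (EVar vn \<oplus> ECst 1)) (env'(ve := e, vm := j)) (1 + N * (n + 1))" for e j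
      using env' by (simp add: espec_def)
    show "input_at xs (1 + N * (n + 1) + 2 + e * (n + 1) + j) = of_bool (bs ! e ! j)" if "e < N" "j < n" for e j
      using input_at_enc_strings(3)[OF bs N that, of "enc_strings as" "[]"]
      unfolding xs length_enc_strings[OF as] append_Nil2 .
  qed (use mv in auto)
  show ?thesis
    unfolding inst_stm_def inst_def enc_bp_instance.simps inst_steps_def Let_def S_def[symmetric] L_def[symmetric]
  proof (intro sspec_SLet)
    show "espec xs X C (eLess (EVar vkap) (EVar vK)) env (of_bool (\<kappa> < ?K))"
      using env by (simp add: espec_def)
    show "espec xs X C ((EVar vkap \<ominus> EVar vK) \<oplus> (EVar vK \<ominus> EVar vkap)) (env(vneg := of_bool (\<kappa> < ?K))) (ak n \<kappa>)"
      using env by (simp add: espec_def ak_def)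
    have "ak n \<kappa> \<le> C" "2 ^ ak n \<kappa> \<le> X" using ak pow[of "ak n \<kappa>"] by (simp_all add: C_def max_count_def)
    then show "espec xs X C (ECst 2 \<otimes> EVar vn \<oplus> ECst 4 \<oplus> eBitlen vak) (env(vneg := of_bool (\<kappa> < ?K), vak := ak n \<kappa>)) ?RE"
      using env by (simp add: espec_def right_end_def)
    show "of_bool (\<kappa> < ?K) \<le> X" using mv(13) by (simp add: of_bool_def)
    show "ak n \<kappa> \<le> X" using ak mv(4) by simp
    show "?RE \<le> X" using RE le_power2[of ?RE "2 * n + ?K + 5"] mv(15) by simp
    show "sspec xs X C (SSeq (bp_stm ts (2 ^ q0) (2 ^ g) mx)
      (SSeq (strings_stm (ECst 0)) (strings_stm (ECst 1 \<oplus> EVar vN \<otimes> (EVar vn \<oplus> ECst 1)))))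
      (env(vneg := of_bool (\<kappa> < ?K), vak := ak n \<kappa>, vRE := ?RE))
      (enc_bp (inst_bp mx n \<kappa>) @ enc_strings (map ((#) False) as) @ enc_strings (map ((#) False) bs))
      ((1 + (1 + (1 + ((1 + layers mx (2 * n + 2) S L * (1 + 1)) + (1 + (1 + 2 * (S * (S * layers mx (2 * n + 2) S L)) * (1 + 19)))))))
     + ((1 + (1 + N * (1 + (1 + (1 + (1 + n * (1 + 1)))))))
     + (1 + (1 + N * (1 + (1 + (1 + (1 + n * (1 + 1)))))))))"
      using sspec_SSeq[OF 1 sspec_SSeq[OF 2 3]] unfolding env'_def .
  qed
qed

lemma sspec_gen_stm:
  fixes n N :: nat and mx :: bool
  defines "X \<equiv> max_val mx N n" and "C \<equiv> max_count n"
  assumes as: "string_set N n as" and bs: "string_set N n bs" and N: "N \<ge> 1"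
    and xs: "xs = enc_strings as @ enc_strings bs"
  shows "sspec xs X C (gen_stm mx) (\<lambda>_. 0)
    (enc_bp_instances (map (inst mx n as bs) [0..<2 * answer_bound n]))
    (1 + (1 + 2 * answer_bound n * (1 + inst_steps mx N n)) + 1 + 1 + 1 + 1 + 1 + 1 + 1 + 1 + 1 + 1 + 1)"
proof -
  define S L T K where "S = states n" and "L = levels n" and "T = layers mx (2 * n + 2) S L" and "K = answer_bound n"
  note mv = max_val_bounds[where N = N and mx = mx and n = n, folded S_def L_def X_def, folded T_def K_def]
  have pow: "2 ^ k \<le> X" if "k \<le> 2 * n + K + 5" for k
    using mv(15) that by (rule power_le_bound) simp
  have S1: "S > 0" using states_gt_1[of n] by (simp add: S_def)
  have CL: "L \<le> C" "log_len n \<le> C" "g * space n \<le> C" "n \<le> C"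
    by (simp_all add: C_def max_count_def L_def levels_def)
  define env1 :: "nat \<Rightarrow> nat" where "env1 = (\<lambda>_. 0)(vN := N, vn := n, vV := 2 * n + 2, vK := K, vM := log_len n, vs := space n,
    vL := L, vS := S, vI := 2 ^ log_len n, vZ := 2 ^ (g * space n), vT := T)"
  have env1: "env1 vN = N" "env1 vn = n" "env1 vV = 2 * n + 2" "env1 vK = K" "env1 vL = L" "env1 vS = S"
      "env1 vI = 2 ^ log_len n" "env1 vZ = 2 ^ (g * space n)" "env1 vT = T"
    by (simp_all add: env1_def)
  have emit: "espec xs X C (ECst 2 \<otimes> EVar vK) env1 (2 * K)" using env1 by (simp add: espec_def)
  have inst: "sspec xs X C (inst_stm mx) (env1(vkap := \<kappa>)) (enc_bp_instance (inst mx n as bs \<kappa>)) (inst_steps mx N n)"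
    if "\<kappa> < 2 * K" for \<kappa>
    unfolding X_def C_def using as bs N xs
    by (rule sspec_inst_stm) (use env1 that in \<open>simp_all add: S_def L_def T_def K_def\<close>)
  note body = sspec_SSeq[OF sspec_SEmit[OF emit] sspec_SFor[OF emit mv(4) inst]]
  let ?E1 = "(\<lambda>_. 0)(vN := N, vn := n, vV := 2 * n + 2, vK := K)"
  let ?E2 = "?E1(vM := log_len n, vs := space n, vL := L, vS := S)"
  have out: "enc_bp_instances (map (inst mx n as bs) [0..<2 * K]) =
    [2 * K] @ concat (map (\<lambda>\<kappa>. enc_bp_instance (inst mx n as bs \<kappa>)) [0..<2 * K])"
    by (simp add: enc_bp_instances_def o_def)
  show ?thesis
    unfolding gen_stm_def K_def[symmetric] out
  proof (intro sspec_SLet)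
    show "espec xs X C (EIn (ECst 0)) (\<lambda>_. 0) N"
      using input_at_enc_strings(1)[OF as N] by (simp add: espec_def xs)
    show "espec xs X C (EIn (ECst 1)) ((\<lambda>_. 0)(vN := N)) n"
      using input_at_enc_strings(2)[OF as N] by (simp add: espec_def xs)
    show "espec xs X C (ECst 2 \<otimes> EVar vn \<oplus> ECst 2) ((\<lambda>_. 0)(vN := N, vn := n)) (2 * n + 2)"
      by (simp add: espec_def)
    show "espec xs X C (ECst c \<otimes> ePowC (EVar vn) d \<oplus> ECst c) ((\<lambda>_. 0)(vN := N, vn := n, vV := 2 * n + 2)) K"
      by (simp add: espec_def K_def answer_bound_def)
    show "espec xs X C (ECst e0 \<oplus> eBitlen vn \<otimes> ECst (d + 1)) ?E1 (log_len n)"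
      using CL pow[of n] by (simp add: espec_def log_len_def)
    show "espec xs X C (ECst Cs \<otimes> ePowC (EVar vM) D \<oplus> ECst Cs) (?E1(vM := log_len n)) (space n)"
      by (simp add: espec_def space_def)
    show "espec xs X C (ECst q0 \<oplus> EVar vM \<oplus> ECst 2 \<otimes> (ECst g \<otimes> EVar vs)) (?E1(vM := log_len n, vs := space n)) L"
      by (simp add: espec_def L_def levels_def)
    show "espec xs X C (ePow2 (EVar vL)) (?E1(vM := log_len n, vs := space n, vL := L)) S"
      using CL mv(6) by (simp add: espec_def S_def states_def L_def)
    show "espec xs X C (ePow2 (EVar vM)) ?E2 (2 ^ log_len n)"
      using CL mv(11) by (simp add: espec_def)
    show "espec xs X C (ePow2 (ECst g \<otimes> EVar vs)) (?E2(vI := 2 ^ log_len n)) (2 ^ (g * space n))"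
      using CL mv(12) by (simp add: espec_def)
    show "espec xs X C (if mx then EVar vV \<otimes> EVar vS \<oplus> ECst 1 else EVar vV \<otimes> ePow vS (EVar vL) \<oplus> ECst 1)
       (?E2(vI := 2 ^ log_len n, vZ := 2 ^ (g * space n))) T"
      using CL mv(14) S1 by (simp add: espec_def eval_ePow vbound_ePow T_def layers_def)
    show "sspec xs X C (SSeq (SEmit (ECst 2 \<otimes> EVar vK)) (SFor vkap (ECst 2 \<otimes> EVar vK) (inst_stm mx)))
       (?E2(vI := 2 ^ log_len n, vZ := 2 ^ (g * space n), vT := T))
       ([2 * K] @ concat (map (\<lambda>\<kappa>. enc_bp_instance (inst mx n as bs \<kappa>)) [0..<2 * K]))
       (1 + (1 + 2 * K * (1 + inst_steps mx N n)))"
      using body unfolding env1_def .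
    show "K \<le> X" using mv(4) by simp
  qed (use mv in auto)
qed

end

section \<open>Correctness and running time\<close>

text \<open>There are 2 * K answers, so \<open>K\<close> is recovered as half their number. The
  output is the sign and the absolute value of the difference between the count of positive answers
  and \<open>K\<close>.\<close>

definition dec_stm :: "bool \<Rightarrow> stm" where
  "dec_stm mx = SLet 3 (EIn (ECst 0))
    (SLet 4 (EFold 0 2 (EVar 3) (ECst 0) (EVar 0 \<oplus> EIn (EVar 2 \<oplus> ECst 1)))
    (SLet 5 (EVar 3 \<oslash> ECst 2)
    (SSeq (SEmit (if mx then eLess (EVar 4) (EVar 5) else eLess (EVar 5) (EVar 4)))
      (SEmit ((EVar 4 \<ominus> EVar 5) \<oplus> (EVar 5 \<ominus> EVar 4))))))"

lemma sspec_dec_stm: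
  assumes len: "length ans = 2 * K" and X: "2 * K \<le> X" "2 * K \<le> C"
    and cnt: "cnt = card {i. i < 2 * K \<and> ans ! i}"
  shows "sspec (enc_bools ans @ ys) X C (dec_stm mx) (\<lambda>_. 0)
    (enc_int (if mx then int cnt - int K else int K - int cnt)) 5"
proof -
  let ?xs = "enc_bools ans @ ys"
  let ?body = "EVar 0 \<oplus> EIn (EVar 2 \<oplus> ECst 1)"
  have in0: "input_at ?xs 0 = 2 * K" using len by (simp add: input_at_def enc_bools_def)
  have inp: "input_at ?xs (k + 1) = of_bool (ans ! k)" if "k < 2 * K" for k
    using that len by (simp add: input_at_def enc_bools_def nth_append)
  define f where "f k = input_at ?xs (k + 1)" for k
  have ef: "eval ?xs (EFold 0 2 e (ECst 0) ?body) env = (\<Sum>k<eval ?xs e env. f k)" for e env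
    using fold_plus_sum[of f _ 0] by (simp add: f_def)
  have sumf: "(\<Sum>k<n. f k) \<le> 2 * K" if "n \<le> 2 * K" for n
  proof -
    have "(\<Sum>k<n. f k) \<le> (\<Sum>k<n. 1)"
      using that inp by (intro sum_mono) (auto simp: f_def)
    then show ?thesis using that by simp
  qed
  have "(\<Sum>k<2 * K. f k) = (\<Sum>k<2 * K. of_bool (ans ! k))"
    using inp by (intro sum.cong) (auto simp: f_def)
  also have "\<dots> = cnt" unfolding cnt
    by (simp add: of_bool_def sum.If_cases Int_def lessThan_def)
  finally have sum: "(\<Sum>k<2 * K. f k) = cnt" .
  have cntX: "cnt \<le> X" using sumf[of "2 * K"] sum X by simp
  have fold: "espec ?xs X C (EFold 0 2 (EVar 3) (ECst 0) ?body) ((\<lambda>_. 0)(3 := 2 * K)) cnt"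
  proof -
    have "vbound ?xs X C (EFold 0 2 (EVar 3) (ECst 0) ?body) ((\<lambda>_. 0)(3 := 2 * K))"
      unfolding vbound.simps ef using sumf X by (auto intro: le_trans)
    then show ?thesis unfolding espec_def ef using sum by simp
  qed
  have enc: "enc_int (if mx then int cnt - int K else int K - int cnt) =
    [of_bool (if mx then cnt < K else K < cnt)] @ [cnt - K + (K - cnt)]"
    by (auto simp: enc_int_def)
  have "sspec ?xs X C (dec_stm mx) (\<lambda>_. 0)
    ([of_bool (if mx then cnt < K else K < cnt)] @ [cnt - K + (K - cnt)]) (1 + 1 + 1 + 1 + 1)"
    unfolding dec_stm_def
  proof (intro sspec_SLet sspec_SSeq sspec_SEmit)
    show "espec ?xs X C (EIn (ECst 0)) (\<lambda>_. 0) (2 * K)" using in0 by (simp add: espec_def)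
    show "espec ?xs X C (EFold 0 2 (EVar 3) (ECst 0) ?body) ((\<lambda>_. 0)(3 := 2 * K)) cnt" by (rule fold)
    show "espec ?xs X C (EVar 3 \<oslash> ECst 2) ((\<lambda>_. 0)(3 := 2 * K, 4 := cnt)) K" by (simp add: espec_def)
  qed (use X cntX in \<open>simp_all add: espec_def\<close>)
  then show ?thesis unfolding enc by (rule sspec_mono) auto
qed

lemma computes_sspec:
  assumes "sspec xs X C c (\<lambda>_. 0) ys k" "X \<ge> 2" "C \<le> X" "\<forall>v \<in> set xs. v \<le> X"
  shows "\<exists>t. computes (compile_stm c (\<lambda>_. 0) 1) xs ys t \<and> t \<le> k * scoef C c * lcost X"
proof -
  obtain t where t: "computes (compile_stm c (\<lambda>_. 0) 1) xs (outp xs c (\<lambda>_. 0)) t"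
    "t \<le> ssteps xs c (\<lambda>_. 0) * scoef C c * lcost X"
    using computes_compile_stm[OF assms(2-4), of c] assms(1) by (auto simp: sspec_def)
  moreover have "ssteps xs c (\<lambda>_. 0) * scoef C c * lcost X \<le> k * scoef C c * lcost X"
    using assms(1) by (intro mult_le_mono) (auto simp: sspec_def)
  ultimately have "t \<le> k * scoef C c * lcost X" using t(2) by (meson le_trans)
  moreover have "outp xs c (\<lambda>_. 0) = ys" using assms(1) by (simp add: sspec_def)
  ultimately show ?thesis using t by blast
qed

section \<open>Quasi-polynomial bounds on the parameters\<close>

context reduction_params
begin

lemma quasi_poly_bounded_answer_bound: "quasi_poly_bounded answer_bound"
  unfolding answer_bound_def[abs_def] by (intro quasi_poly_bounded_intros)

text \<open>\<open>n\<close> enters \<open>levels\<close> only through its bit length. This is the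
  effect of polylogarithmic space, and it makes 2 ^ levels n quasi-polynomial.\<close>

definition level_fun :: "nat \<Rightarrow> nat" where
  "level_fun b = q0 + (e0 + b * (d + 1)) + 2 * (g * (Cs * (e0 + b * (d + 1)) ^ D + Cs))"

lemma levels_eq: "levels n = level_fun (floorlog 2 n)"
  by (simp add: levels_def level_fun_def space_def log_len_def)

lemma poly_growth_power: "poly_growth f \<Longrightarrow> poly_growth (\<lambda>b. f b ^ k)"
  by (induction k) (auto intro: poly_growth_intros)

lemma poly_growth_level_fun: "poly_growth level_fun"
  unfolding level_fun_def[abs_def] by (intro poly_growth_intros poly_growth_power)

lemma quasi_poly_bounded_states: "quasi_poly_bounded states"
  unfolding states_def[abs_def] levels_eq
  by (intro quasi_poly_bounded_exp2 poly_growth_level_fun)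

lemma quasi_poly_bounded_levels: "quasi_poly_bounded levels"
  using quasi_poly_bounded_states
  by (rule quasi_poly_bounded_mono) (simp add: states_def less_imp_le)

lemma quasi_poly_bounded_layers:
  "quasi_poly_bounded (\<lambda>n. layers mx (2 * n + 2) (states n) (levels n))"
proof -
  \<comment> \<open>S ^ L = 2 ^ (L * L), and the square of a polylogarithmic bound is
    polylogarithmic.\<close>
  have "quasi_poly_bounded (\<lambda>n. 2 ^ (level_fun (floorlog 2 n) * level_fun (floorlog 2 n)))"
    by (intro quasi_poly_bounded_exp2[of "\<lambda>b. level_fun b * level_fun b"] poly_growth_mult poly_growth_level_fun)
  then have "quasi_poly_bounded (\<lambda>n. states n ^ levels n)"
    by (simp add: states_def levels_eq power_mult)
  then show ?thesis unfolding layers_def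
    by (cases mx; simp only: if_True if_False; intro quasi_poly_bounded_intros quasi_poly_bounded_states)
qed

definition num_edges :: "bool \<Rightarrow> nat \<Rightarrow> nat" where
  "num_edges mx n = 2 * (states n * (states n * layers mx (2 * n + 2) (states n) (levels n)))"

lemma quasi_poly_bounded_num_edges: "quasi_poly_bounded (num_edges mx)"
  unfolding num_edges_def[abs_def]
  by (intro quasi_poly_bounded_intros quasi_poly_bounded_states quasi_poly_bounded_layers)

lemma quasi_poly_bounded_max_count: "quasi_poly_bounded max_count"
  unfolding max_count_def[abs_def]
  by (intro quasi_poly_bounded_intros quasi_poly_bounded_answer_bound quasi_poly_bounded_levels)

lemma quasi_poly_bounded_scoef: "quasi_poly_bounded (\<lambda>n. scoef (max_count n) p)"
proof -
  obtain A where A: "\<And>C. scoef C p \<le> A * (C + 1) ^ A"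
    using poly_growth_scoef[of p] unfolding poly_growth_def by blast
  have "quasi_poly_bounded (\<lambda>n. A * (max_count n + 1) ^ A)"
    by (intro quasi_poly_bounded_intros quasi_poly_bounded_max_count)
  then show ?thesis by (rule quasi_poly_bounded_mono) (rule A)
qed

text \<open>The step count with one factor \<open>N\<close> taken out; work independent of the
  strings is charged to each of them. The 13 and 14 collect the fixed steps of the generator and of
  one instance with its loop step, and 8 + 4 * n comes from copying one string of each set.\<close>

definition steps_per_string :: "bool \<Rightarrow> nat \<Rightarrow> nat" where
  "steps_per_string mx n = 13 + 2 * answer_bound n *
     (14 + 2 * layers mx (2 * n + 2) (states n) (levels n) + 20 * num_edges mx n + 8 + 4 * n)"

lemma quasi_poly_bounded_steps_per_string: "quasi_poly_bounded (steps_per_string mx)"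
  unfolding steps_per_string_def[abs_def]
  by (intro quasi_poly_bounded_intros quasi_poly_bounded_answer_bound quasi_poly_bounded_layers
      quasi_poly_bounded_num_edges)

lemma gen_steps_le:
  assumes "N \<ge> 1"
  shows "1 + (1 + 2 * answer_bound n * (1 + inst_steps mx N n)) + 1 + 1 + 1 + 1 + 1 + 1 + 1 + 1 + 1 + 1 + 1
    \<le> N * steps_per_string mx n"
proof -
  let ?T = "layers mx (2 * n + 2) (states n) (levels n)"
  let ?a = "14 + 2 * ?T + 20 * num_edges mx n"
  have "1 + inst_steps mx N n = ?a + N * (8 + 4 * n)"
    by (simp add: inst_steps_def num_edges_def Let_def algebra_simps)
  also have "\<dots> \<le> N * ?a + N * (8 + 4 * n)" using assms by simp
  also have "\<dots> = N * (?a + 8 + 4 * n)" by (simp add: algebra_simps)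
  finally have "2 * answer_bound n * (1 + inst_steps mx N n) \<le> 2 * answer_bound n * (N * (?a + 8 + 4 * n))"
    by (rule mult_le_mono2)
  also have "\<dots> = N * (2 * answer_bound n * (?a + 8 + 4 * n))" by (simp add: algebra_simps)
  finally have *: "2 * answer_bound n * (1 + inst_steps mx N n) \<le> N * (2 * answer_bound n * (?a + 8 + 4 * n))" .
  have "N * steps_per_string mx n = N * 13 + N * (2 * answer_bound n * (?a + 8 + 4 * n))"
    by (simp only: steps_per_string_def add_mult_distrib2)
  then show ?thesis using * assms by linarith
qed

definition log_max :: "bool \<Rightarrow> nat \<Rightarrow> nat" where
  "log_max mx n = 2 * n + answer_bound n + num_edges mx n + 8"

lemma quasi_poly_bounded_log_max: "quasi_poly_bounded (log_max mx)"
  unfolding log_max_def[abs_def]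
  by (intro quasi_poly_bounded_intros quasi_poly_bounded_answer_bound quasi_poly_bounded_num_edges)

text \<open>Bounding the sum by a product with factor \<open>N\<close> separates \<open>N\<close>
  from \<open>n\<close>: bit lengths then add, and the result is a bit length of \<open>N\<close>
  times a quasi-polynomial in \<open>n\<close>.\<close>

lemma lcost_max_val_le:
  assumes "N \<ge> 1"
  shows "lcost (max_val mx N n) \<le> (floorlog 2 N + 1) * (log_max mx n + 1)"
proof -
  define p where "p = 2 * n + answer_bound n + 5"
  define E where "E = num_edges mx n"
  have p1: "1 \<le> (2::nat) ^ p" by simp
  have "max_val mx N n = N * 1 + (2 ^ p + E)"
    by (simp add: max_val_def p_def E_def num_edges_def)
  also have "\<dots> \<le> N * 1 + N * (2 ^ p + E)" using assms by simp
  also have "\<dots> = N * (1 + 2 ^ p + E)" by (simp add: algebra_simps)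
  also have "\<dots> \<le> N * (2 ^ p * (E + 2))"
  proof (rule mult_le_mono2)
    have "1 * E \<le> 2 ^ p * E" using p1 by (rule mult_le_mono1)
    then have "1 + 2 ^ p + E \<le> 2 ^ p + 2 ^ p + 2 ^ p * E" using p1 by linarith
    then show "1 + 2 ^ p + E \<le> 2 ^ p * (E + 2)" by (simp add: algebra_simps)
  qed
  also have "\<dots> < 2 ^ floorlog 2 N * (2 ^ p * 2 ^ (E + 2))"
  proof (rule mult_strict_mono)
    show "N < 2 ^ floorlog 2 N" using assms by (simp add: floorlog_bounds)
    show "2 ^ p * (E + 2) < 2 ^ p * 2 ^ (E + 2)"
      using less_exp[of "E + 2"] by (intro mult_strict_left_mono) auto
  qed auto
  also have "\<dots> = 2 ^ (floorlog 2 N + (p + (E + 2)))" by (simp only: power_add)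
  finally have "floorlog 2 (max_val mx N n) \<le> floorlog 2 N + (p + (E + 2))"
    by (intro floorlog_leI) auto
  then have "lcost (max_val mx N n) \<le> floorlog 2 N + log_max mx n + 1"
    by (simp add: lcost_def p_def E_def log_max_def)
  also have "\<dots> \<le> (floorlog 2 N + 1) * (log_max mx n + 1)" by (simp add: algebra_simps)
  finally show ?thesis .
qed

end

section \<open>Correctness of the instances for a fixed machine\<close>

locale reduction_machine = reduction_params_pos +
  fixes \<A> :: pair_problem
  assumes trans_bound: "\<And>q c t q' t' di dw. (q, c, t, q', t', di, dw) \<in> set ts \<Longrightarrow> q' < 2 ^ q0 \<and> t' < 2 ^ g"
    and length_bound: "\<And>n k. k \<le> answer_bound n \<Longrightarrow> 2 * n + 4 + floorlog 2 k < 2 ^ log_len n"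
    and space_bound: "\<And>a b k cf. length a = length b \<Longrightarrow> \<bar>k\<bar> \<le> int (answer_bound (length a)) \<Longrightarrow>
      ntm_reach (set ts) (enc_query a b k) cf \<Longrightarrow> whead cf < space (length a)"
    and accepts_iff: "\<And>a b k. length a = length b \<Longrightarrow> ntm_accepts (set ts) (enc_query a b k) \<longleftrightarrow> \<A> a b > k"
    and answer_bound: "\<And>a b. length a = length b \<Longrightarrow> \<bar>\<A> a b\<bar> \<le> int (answer_bound (length a))"
begin

lemma bp_accepts_inst_bp:
  assumes ab: "length a = n" "length b = n" and \<kappa>: "\<kappa> < 2 * answer_bound n"
  defines "k \<equiv> int \<kappa> - int (answer_bound n)"
  shows "bp_accepts (inst_bp mx n \<kappa>) (False # a @ False # b) \<longleftrightarrow> (if mx then \<A> a b > k else \<A> a b \<le> k)"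
proof -
  define x where "x = enc_query a b k"
  have k: "(\<kappa> < answer_bound n) = (k < 0)" "ak n \<kappa> = nat \<bar>k\<bar>" "\<bar>k\<bar> \<le> int (answer_bound n)"
    using \<kappa> by (auto simp: k_def ak_def)
  have len: "length x + 1 = right_end n \<kappa>"
    using ab by (simp add: x_def length_enc_query right_end_def k(2))
  interpret ntm_coding ts x "2 ^ q0" "2 ^ log_len n" "2 ^ g" "space n"
  proof
    show "(2::nat) \<le> 2 ^ q0" "(2::nat) \<le> 2 ^ g"
      using q0 g power_increasing[of 1 q0 "2::nat"] power_increasing[of 1 g "2::nat"] by auto
    have "ak n \<kappa> \<le> answer_bound n" using \<kappa> by (simp add: ak_def)
    then show "length x + 1 < 2 ^ log_len n"
      using length_bound[of "ak n \<kappa>" n] unfolding len by (simp add: right_end_def)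
    show "\<And>cf. ntm_reach (set ts) x cf \<Longrightarrow> whead cf < space n"
      using space_bound[of a b k] ab k(3) by (simp add: x_def)
  qed (use trans_bound in blast)+
  have ok: "inst_step n \<kappa> = query_step ts (2 ^ q0) (2 ^ log_len n) ((2 ^ g) ^ space n) (2 ^ g) (length x + 1) n (k < 0) (nat \<bar>k\<bar>)"
    unfolding inst_step_def len k(1,2) by (simp add: power_mult)
  let ?V = "2 * n + 2"
  let ?x = "False # a @ False # b"
  have S: "states n = 2 ^ q0 * (2 ^ log_len n * ((2 ^ g) ^ space n * (2 ^ g) ^ space n))"
    unfolding states_def levels_def by (simp add: power_add power_mult mult_2)
  \<comment> \<open>Both programs are built on this relation; the cases below differ only in testing
    reachability or its failure.\<close>
  have reach: "(bit_rel (inst_step n \<kappa>) ?V (states n) ?x)\<^sup>*\<^sup>* 0 1 \<longleftrightarrow> \<A> a b > k"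
  proof -
    have "(bit_rel (inst_step n \<kappa>) ?V (states n) ?x)\<^sup>*\<^sup>* 0 1 \<longleftrightarrow> ntm_accepts (set ts) x"
      by (rule ntm_accepts_iff_code_reach[OF S]) (simp only: ok x_def bit_rel_query_step[OF ab])
    then show ?thesis using accepts_iff[of a b k] ab by (simp add: x_def)
  qed
  show ?thesis
  proof (cases mx)
    case True
    have "bp_accepts (inst_bp mx n \<kappa>) ?x \<longleftrightarrow> (bit_rel (inst_step n \<kappa>) ?V (states n) ?x)\<^sup>*\<^sup>* 0 1"
      unfolding inst_bp_def edge_rel_def layers_def if_P[OF True]
    proof (rule walk_accepts)
      show "inst_step n \<kappa> u v 1 (?x ! 1)" if "inst_step n \<kappa> u v 0 (?x ! 0)" for u v
        using that unfolding ok x_def by (rule query_step_0[OF ab])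
    qed (simp_all add: states_gt_1[unfolded One_nat_def])
    then show ?thesis using reach True by simp
  next
    case False
    have "bp_accepts (inst_bp mx n \<kappa>) ?x \<longleftrightarrow> \<not> (bit_rel (inst_step n \<kappa>) ?V (states n) ?x)\<^sup>*\<^sup>* 0 1"
      unfolding inst_bp_def edge_rel_def layers_def if_not_P[OF False]
      by (rule savitch_accepts) (simp_all add: states_def states_gt_1[unfolded One_nat_def states_def])
    then show ?thesis using reach False by auto
  qed
qed

lemma bp_satisfying_pair_inst:
  assumes as: "string_set N n as" and bs: "string_set N n bs" and \<kappa>: "\<kappa> < 2 * answer_bound n"
  shows "bp_satisfying_pair (inst mx n as bs \<kappa>) \<longleftrightarrow> (\<exists>a \<in> set as. \<exists>b \<in> set bs.
    if mx then \<A> a b > int \<kappa> - int (answer_bound n) else \<A> a b \<le> int \<kappa> - int (answer_bound n))"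
proof -
  have "bp_accepts (inst_bp mx n \<kappa>) (False # a @ False # b) \<longleftrightarrow>
    (if mx then \<A> a b > int \<kappa> - int (answer_bound n) else \<A> a b \<le> int \<kappa> - int (answer_bound n))"
    if "a \<in> set as" "b \<in> set bs" for a b
    using that as bs \<kappa> by (intro bp_accepts_inst_bp) (auto simp: string_set_def)
  then show ?thesis unfolding inst_def by auto
qed

definition opt :: "bool \<Rightarrow> bool list set \<Rightarrow> bool list set \<Rightarrow> int" where
  "opt mx A B = (if mx then max_pair \<A> A B else min_pair \<A> A B)"

text \<open>The answers are monotone in \<kappa>. For an optimum m, the accepted \<kappa> are those
  below m + K for the maximum and those from m + K on for the minimum, so their numbers are m + K
  and K - m.\<close>

lemma count_satisfied:
  fixes mx :: bool
  assumes as: "string_set N n as" and bs: "string_set N n bs" and N: "N \<ge> 1"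
  defines "K \<equiv> answer_bound n"
  defines "cnt \<equiv> card {\<kappa>. \<kappa> < 2 * K \<and> bp_satisfying_pair (inst mx n as bs \<kappa>)}"
  shows "opt mx (set as) (set bs) = (if mx then int cnt - int K else int K - int cnt)"
proof -
  define V where "V = {\<A> a b | a b. a \<in> set as \<and> b \<in> set bs}"
  have V: "V = (\<lambda>(a, b). \<A> a b) ` (set as \<times> set bs)" by (auto simp: V_def)
  have fin: "finite V" unfolding V by simp
  have "as \<noteq> []" "bs \<noteq> []" using as bs N by (auto simp: string_set_def)
  then have ne: "V \<noteq> {}" unfolding V by auto
  have bound: "- int K \<le> z \<and> z \<le> int K" if z: "z \<in> V" for z
  proof -
    obtain a b where "z = \<A> a b" "a \<in> set as" "b \<in> set bs" using z by (auto simp: V_def)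
    then show ?thesis using answer_bound[of a b] as bs by (auto simp: string_set_def K_def)
  qed
  have sat: "bp_satisfying_pair (inst mx n as bs \<kappa>) \<longleftrightarrow>
      (\<exists>z \<in> V. if mx then z > int \<kappa> - int K else z \<le> int \<kappa> - int K)" if "\<kappa> < 2 * K" for \<kappa>
    using that unfolding K_def by (subst bp_satisfying_pair_inst[OF as bs]) (auto simp: V_def)
  show ?thesis
  proof (cases mx)
    case True
    define m where "m = Max V"
    have m: "m \<in> V" "\<And>z. z \<in> V \<Longrightarrow> z \<le> m" using fin ne by (auto simp: m_def)
    have "{\<kappa>. \<kappa> < 2 * K \<and> bp_satisfying_pair (inst mx n as bs \<kappa>)} = {..<nat (m + int K)}"
    proof (intro set_eqI iffI)
      fix \<kappa> assume "\<kappa> \<in> {\<kappa>. \<kappa> < 2 * K \<and> bp_satisfying_pair (inst mx n as bs \<kappa>)}"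
      then obtain z where "z \<in> V" "z > int \<kappa> - int K" using sat True by auto
      then show "\<kappa> \<in> {..<nat (m + int K)}" using m(2)[of z] by auto
    next
      fix \<kappa> assume "\<kappa> \<in> {..<nat (m + int K)}"
      then have "\<kappa> < 2 * K" "m > int \<kappa> - int K" using bound[OF m(1)] by auto
      then show "\<kappa> \<in> {\<kappa>. \<kappa> < 2 * K \<and> bp_satisfying_pair (inst mx n as bs \<kappa>)}" using sat True m(1) by auto
    qed
    then have "cnt = nat (m + int K)" by (simp add: cnt_def)
    then have "int cnt - int K = m" using bound[OF m(1)] by simp
    then show ?thesis using True by (simp add: opt_def max_pair_def m_def V_def)
  next
    case False
    define m where "m = Min V"
    have m: "m \<in> V" "\<And>z. z \<in> V \<Longrightarrow> m \<le> z" using fin ne by (auto simp: m_def)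
    have "{\<kappa>. \<kappa> < 2 * K \<and> bp_satisfying_pair (inst mx n as bs \<kappa>)} = {nat (m + int K)..<2 * K}"
    proof (intro set_eqI iffI)
      fix \<kappa> assume *: "\<kappa> \<in> {\<kappa>. \<kappa> < 2 * K \<and> bp_satisfying_pair (inst mx n as bs \<kappa>)}"
      then obtain z where "z \<in> V" "z \<le> int \<kappa> - int K" using sat False by auto
      then show "\<kappa> \<in> {nat (m + int K)..<2 * K}" using m(2)[of z] * by auto
    next
      fix \<kappa> assume "\<kappa> \<in> {nat (m + int K)..<2 * K}"
      then have "\<kappa> < 2 * K" "m \<le> int \<kappa> - int K" using bound[OF m(1)] by auto
      then show "\<kappa> \<in> {\<kappa>. \<kappa> < 2 * K \<and> bp_satisfying_pair (inst mx n as bs \<kappa>)}" using sat False m(1) by auto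
    qed
    then have "cnt = 2 * K - nat (m + int K)" by (simp add: cnt_def)
    then have "int K - int cnt = m" using bound[OF m(1)] by auto
    then show ?thesis using False by (simp add: opt_def min_pair_def m_def V_def)
  qed
qed

lemma bp_instance_wf_inst:
  assumes "string_set N n as" "string_set N n bs"
  shows "bp_instance_wf N (inst mx n as bs \<kappa>)"
proof -
  have "string_set N (n + 1) (map ((#) False) xs)" if "string_set N n xs" for xs
    using that by (auto simp: string_set_def distinct_map)
  moreover have "bp_wf (inst_bp mx n \<kappa>)"
    unfolding inst_bp_def using states_gt_1[of n] by (intro bp_wf_mk_bp) auto
  moreover have "bp_vars (inst_bp mx n \<kappa>) = 2 * (n + 1)" by (simp add: inst_bp_def mk_bp_def)
  ultimately show ?thesis using assms by (simp add: inst_def)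
qed

lemma enc_bools_elems: "v \<in> set (enc_bools x) \<Longrightarrow> v = length x \<or> v \<le> 1"
  by (auto simp: enc_bools_def of_bool_def split: if_splits)

lemma enc_strings_le:
  assumes "string_set N n as" "v \<in> set (enc_strings as)"
  shows "v \<le> max_val mx N n"
proof -
  have "v = N \<or> (\<exists>a \<in> set as. v \<in> set (enc_bools a))"
    using assms by (auto simp: enc_strings_def string_set_def)
  then have "v = N \<or> v = n \<or> v \<le> 1"
    using assms(1) enc_bools_elems by (metis string_set_def)
  then show ?thesis
    using max_val_bounds(1,2,13)[where N = N and mx = mx and n = n] by auto
qed

definition total_time :: "bool \<Rightarrow> nat \<Rightarrow> nat" where
  "total_time mx n = (log_max mx n + 1) *
     (steps_per_string mx n * scoef (max_count n) (gen_stm mx) + 5 * scoef (max_count n) (dec_stm mx))"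

lemma quasi_poly_bounded_total_time: "quasi_poly_bounded (total_time mx)"
  unfolding total_time_def[abs_def]
  by (intro quasi_poly_bounded_intros quasi_poly_bounded_log_max quasi_poly_bounded_steps_per_string
      quasi_poly_bounded_scoef)

lemma reduction_correct:
  fixes mx :: bool
  assumes as: "string_set N n as" and bs: "string_set N n bs" and N: "N \<ge> 1"
  defines "Is \<equiv> map (inst mx n as bs) [0..<2 * answer_bound n]"
  shows "\<exists>t\<^sub>1 t\<^sub>2.
    computes (compile_stm (gen_stm mx) (\<lambda>_. 0) 1) (enc_strings as @ enc_strings bs) (enc_bp_instances Is) t\<^sub>1 \<and>
    computes (compile_stm (dec_stm mx) (\<lambda>_. 0) 1)
      (enc_bools (map bp_satisfying_pair Is) @ enc_strings as @ enc_strings bs)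
      (enc_int (opt mx (set as) (set bs))) t\<^sub>2 \<and>
    t\<^sub>1 + t\<^sub>2 \<le> N * ((floorlog 2 N + 1) * total_time mx n)"
proof -
  let ?X = "max_val mx N n" and ?C = "max_count n" and ?K = "answer_bound n"
  note mv = max_val_bounds[where N = N and mx = mx and n = n]
  have X2: "2 \<le> ?X" using mv(13) by simp
  have CX: "?C \<le> ?X" by (rule max_count_le_max_val)
  obtain t1 where t1: "computes (compile_stm (gen_stm mx) (\<lambda>_. 0) 1) (enc_strings as @ enc_strings bs) (enc_bp_instances Is) t1"
    "t1 \<le> (1 + (1 + 2 * ?K * (1 + inst_steps mx N n)) + 1 + 1 + 1 + 1 + 1 + 1 + 1 + 1 + 1 + 1 + 1) *
       scoef ?C (gen_stm mx) * lcost ?X"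
    using computes_sspec[OF sspec_gen_stm[OF as bs N refl] X2 CX] enc_strings_le[OF as] enc_strings_le[OF bs]
    unfolding Is_def by (auto simp: ball_Un)
  let ?ans = "map bp_satisfying_pair Is"
  have len: "length ?ans = 2 * ?K" by (simp add: Is_def)
  have cnt: "{i. i < 2 * ?K \<and> ?ans ! i} = {\<kappa>. \<kappa> < 2 * ?K \<and> bp_satisfying_pair (inst mx n as bs \<kappa>)}"
    by (auto simp: Is_def)
  have "2 * ?K \<le> ?C" by (simp add: max_count_def)
  note D = sspec_dec_stm[OF len mv(4) this refl, of "enc_strings as @ enc_strings bs" mx,
      unfolded cnt, folded count_satisfied[OF as bs N]]
  have "v \<le> ?X" if "v \<in> set (enc_bools ?ans)" for v
  proof -
    have "v = 2 * ?K \<or> v \<le> 1" using enc_bools_elems[OF that] unfolding len .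
    then show ?thesis using mv(4) X2 by auto
  qed
  then obtain t2 where t2: "computes (compile_stm (dec_stm mx) (\<lambda>_. 0) 1)
      (enc_bools ?ans @ enc_strings as @ enc_strings bs) (enc_int (opt mx (set as) (set bs))) t2"
      "t2 \<le> 5 * scoef ?C (dec_stm mx) * lcost ?X"
    using computes_sspec[OF D X2 CX] enc_strings_le[OF as] enc_strings_le[OF bs]
    by (auto simp: ball_Un)
  let ?g = "scoef ?C (gen_stm mx)" and ?d = "scoef ?C (dec_stm mx)"
  have "t1 \<le> N * steps_per_string mx n * ?g * lcost ?X"
    by (rule le_trans[OF t1(2)]) (intro mult_le_mono gen_steps_le N order_refl)
  moreover have "t2 \<le> N * 5 * ?d * lcost ?X"
    by (rule le_trans[OF t2(2)]) (use N in \<open>intro mult_le_mono; simp\<close>)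
  ultimately have "t1 + t2 \<le> N * (steps_per_string mx n * ?g + 5 * ?d) * lcost ?X"
    by (simp add: algebra_simps)
  also have "\<dots> \<le> N * (steps_per_string mx n * ?g + 5 * ?d) * ((floorlog 2 N + 1) * (log_max mx n + 1))"
    by (intro mult_le_mono2 lcost_max_val_le N)
  also have "\<dots> = N * ((floorlog 2 N + 1) * total_time mx n)"
    unfolding total_time_def by (simp only: mult_ac)
  finally show ?thesis using t1(1) t2(1) by blast
qed

text \<open>The parameters of the quasi-polynomial bounds depend on the machine and \<A> but not on
  the instance, and by monotonicity \<open>n\<close> may be replaced by \<open>l N\<close>. The
  remaining dependence on \<open>N\<close> is the factor \<open>N\<close> times its bit
  length.\<close>

lemma near_linear_reducible_opt:
  assumes l: "quasi_const_exp l"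
  shows "near_linear_reducible_to_bp (opt mx) l"
proof -
  obtain A1 where A1: "\<And>n. total_time mx n \<le> quasi_poly A1 n"
    using quasi_poly_bounded_total_time unfolding quasi_poly_bounded_def by blast
  have "quasi_poly_bounded (\<lambda>n. 2 * answer_bound n)"
    by (intro quasi_poly_bounded_intros quasi_poly_bounded_answer_bound)
  then obtain A2 where A2: "\<And>n. 2 * answer_bound n \<le> quasi_poly A2 n"
    unfolding quasi_poly_bounded_def by blast
  obtain A3 where A3: "\<And>n. num_edges mx n \<le> quasi_poly A3 n"
    using quasi_poly_bounded_num_edges unfolding quasi_poly_bounded_def by blast
  define t where "t N = N * ((floorlog 2 N + 1) * quasi_poly A1 (l N))" for N
  have "near_linear t"
    unfolding t_def[abs_def]
    by (intro near_linear_mult_quasi_const_exp quasi_const_exp_mult quasi_const_exp_floorlog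
        quasi_const_exp_quasi_poly l)
  moreover have "bp_reduction (opt mx) l (compile_stm (gen_stm mx) (\<lambda>_. 0) 1) (compile_stm (dec_stm mx) (\<lambda>_. 0) 1) t
    (\<lambda>N. quasi_poly A2 (l N)) (\<lambda>N. quasi_poly A3 (l N))"
    unfolding bp_reduction_def
  proof (intro allI impI)
    fix N n as bs
    assume N: "1 \<le> N" and n: "n \<le> l N" and as: "string_set N n as" and bs: "string_set N n bs"
    define Is where "Is = map (inst mx n as bs) [0..<2 * answer_bound n]"
    obtain t1 t2 where t: "computes (compile_stm (gen_stm mx) (\<lambda>_. 0) 1) (enc_strings as @ enc_strings bs) (enc_bp_instances Is) t1"
      "computes (compile_stm (dec_stm mx) (\<lambda>_. 0) 1)
        (enc_bools (map bp_satisfying_pair Is) @ enc_strings as @ enc_strings bs)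
        (enc_int (opt mx (set as) (set bs))) t2"
      "t1 + t2 \<le> N * ((floorlog 2 N + 1) * total_time mx n)"
      using reduction_correct[OF as bs N] unfolding Is_def by blast
    have "total_time mx n \<le> quasi_poly A1 (l N)"
      using A1 quasi_poly_mono[OF n] by (rule le_trans)
    then have "N * ((floorlog 2 N + 1) * total_time mx n) \<le> t N"
      unfolding t_def by (intro mult_le_mono2)
    moreover have "length Is \<le> quasi_poly A2 (l N)"
      using le_trans[OF A2 quasi_poly_mono[OF n]] by (simp add: Is_def)
    moreover have "bp_size (fst (inst mx n as bs \<kappa>)) \<le> quasi_poly A3 (l N)" for \<kappa>
      using le_trans[OF A3 quasi_poly_mono[OF n]]
      by (simp add: inst_def inst_bp_def bp_size_mk_bp num_edges_def)
    then have "\<forall>I \<in> set Is. bp_instance_wf N I \<and> bp_size (fst I) \<le> quasi_poly A3 (l N)"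
      using bp_instance_wf_inst[OF as bs] by (auto simp: Is_def)
    ultimately show "\<exists>Is t\<^sub>1 t\<^sub>2.
           computes (compile_stm (gen_stm mx) (\<lambda>_. 0) 1) (enc_strings as @ enc_strings bs) (enc_bp_instances Is) t\<^sub>1 \<and>
           length Is \<le> quasi_poly A2 (l N) \<and>
           (\<forall>I \<in> set Is. bp_instance_wf N I \<and> bp_size (fst I) \<le> quasi_poly A3 (l N)) \<and>
           computes (compile_stm (dec_stm mx) (\<lambda>_. 0) 1)
             (enc_bools (map bp_satisfying_pair Is) @ enc_strings as @ enc_strings bs)
             (enc_int (opt mx (set as) (set bs))) t\<^sub>2 \<and>
           t\<^sub>1 + t\<^sub>2 \<le> t N"
      using t by (meson le_trans)
  qed
  ultimately show ?thesis
    unfolding near_linear_reducible_to_bp_def using quasi_const_exp_quasi_poly[OF l] by blast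
qed

end

text \<open>Origin of \<open>e0\<close>: both n and n ^ d are at most z = 2 ^ (floorlog 2 n * (d +
  1)), so the left side is at most (2 * c + 6) * z, and 2 * c + 6 < 2 ^ (2 * c + 6).\<close>

lemma length_bound_witness:
  fixes c d n k :: nat
  assumes "k \<le> c * n ^ d + c"
  shows "2 * n + 4 + floorlog 2 k < 2 ^ (2 * c + 6 + floorlog 2 n * (d + 1))"
proof -
  define y where "y = (2::nat) ^ floorlog 2 n"
  define z where "z = y ^ (d + 1)"
  have y: "n \<le> y" "1 \<le> y"
    using floorlog_bounds[of n 2] by (cases "n = 0"; simp add: y_def less_imp_le)+
  have "y ^ 1 \<le> z" unfolding z_def using y(2) by (intro power_increasing) auto
  then have nz: "n \<le> z" "1 \<le> z" using y by auto
  have "n ^ d \<le> y ^ d" using y by (intro power_mono) auto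
  also have "\<dots> \<le> z" unfolding z_def using y(2) by (intro power_increasing) auto
  finally have "c * n ^ d \<le> c * z" by (rule mult_le_mono2)
  moreover have "c * 1 \<le> c * z" using nz(2) by (rule mult_le_mono2)
  moreover have "floorlog 2 k \<le> c * n ^ d + c" using floorlog_le_self[of k] assms by linarith
  ultimately have "2 * n + 4 + floorlog 2 k \<le> 2 * z + 4 * z + (c * z + c * z)" using nz by linarith
  also have "\<dots> = (2 * c + 6) * z" by (simp add: algebra_simps)
  also have "\<dots> < 2 ^ (2 * c + 6) * z" using nz(2) less_exp[of "2 * c + 6"] by (intro mult_strict_right_mono) auto
  also have "\<dots> = 2 ^ (2 * c + 6 + floorlog 2 n * (d + 1))"
    unfolding z_def y_def by (simp only: power_add power_mult)
  finally show ?thesis .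
qed

theorem theorem4p2:
  fixes \<A> :: "bool list \<Rightarrow> bool list \<Rightarrow> int" and l :: "nat \<Rightarrow> nat"
  assumes "poly_bounded \<A>"
    and "decision_version \<A> \<in> NSPACE_polylog"
    and "quasi_const_exp l"
  shows "near_linear_reducible_to_bp (max_pair \<A>) l \<and>
         near_linear_reducible_to_bp (min_pair \<A>) l"
proof -
  obtain c d :: nat where cd: "\<And>n a b. length a = n \<Longrightarrow> length b = n \<Longrightarrow>
     - int (c * n ^ d + c) \<le> \<A> a b \<and> \<A> a b \<le> int (c * n ^ d + c)"
    using assms(1) unfolding poly_bounded_def by blast
  obtain D M Cs where M: "finite M"
    "\<And>x. x \<in> decision_version \<A> \<longleftrightarrow> ntm_accepts M x"
    "\<And>x cf. ntm_reach M x cf \<Longrightarrow> real (whead cf + 1) \<le> real Cs * log 2 (real (length x)) ^ D + real Cs"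
    using assms(2) unfolding NSPACE_polylog_def NSPACE_def by blast
  obtain ts where ts: "set ts = M" using M(1) finite_list by blast
  \<comment> \<open>The sum over the finitely many transitions bounds each new state, and in
    \<open>g\<close> each written symbol; the successor makes the number positive.\<close>
  define q0 where "q0 = Suc (\<Sum>(q, c, t, q', t', di, dw) \<in> M. q')"
  define g where "g = Suc (\<Sum>(q, c, t, q', t', di, dw) \<in> M. t')"
  define e0 where "e0 = 2 * c + 6"
  interpret reduction_params_pos ts q0 g c d e0 Cs D
    by unfold_locales (simp_all add: q0_def g_def)
  interpret reduction_machine ts q0 g c d e0 Cs D \<A>
  proof
    fix q cl t q' t' di dw assume tr: "(q, cl, t, q', t', di, dw) \<in> set ts"
    have "q' \<le> (\<Sum>(q, c, t, q', t', di, dw) \<in> M. q')"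
      using member_le_sum[of "(q, cl, t, q', t', di, dw)" M "\<lambda>(q, c, t, q', t', di, dw). q'"] tr M(1) ts by auto
    moreover have "t' \<le> (\<Sum>(q, c, t, q', t', di, dw) \<in> M. t')"
      using member_le_sum[of "(q, cl, t, q', t', di, dw)" M "\<lambda>(q, c, t, q', t', di, dw). t'"] tr M(1) ts by auto
    ultimately have "q' \<le> q0" "t' \<le> g" by (auto simp: q0_def g_def)
    then show "q' < 2 ^ q0 \<and> t' < 2 ^ g" using less_exp[of q0] less_exp[of g] by linarith
  next
    fix n k assume "k \<le> answer_bound n"
    then show "2 * n + 4 + floorlog 2 k < 2 ^ log_len n"
      unfolding answer_bound_def log_len_def unfolding e0_def by (rule length_bound_witness)
  next
    fix a b k cf
    assume ab: "length a = length b" and k: "\<bar>k\<bar> \<le> int (answer_bound (length a))"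
      and reach: "ntm_reach (set ts) (enc_query a b k) cf"
    let ?x = "enc_query a b k" and ?n = "length a"
    have "nat \<bar>k\<bar> \<le> c * ?n ^ d + c" using k unfolding answer_bound_def by linarith
    then have "2 * ?n + 4 + floorlog 2 (nat \<bar>k\<bar>) < 2 ^ log_len ?n"
      unfolding log_len_def unfolding e0_def by (rule length_bound_witness)
    then have "length ?x < 2 ^ log_len ?n" using ab by (simp add: length_enc_query)
    moreover have pos: "length ?x > 0" by (simp add: length_enc_query)
    ultimately have "log 2 (real (length ?x)) \<le> real (log_len ?n)"
      by (subst log_le_iff) (simp_all add: powr_realpow less_imp_le)
    \<comment> \<open>Needed for monotonicity of the power \<open>D\<close>; it holds because a
      query has length at least 3.\<close>
    moreover have "0 \<le> log 2 (real (length ?x))" by (simp add: length_enc_query)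
    ultimately have "log 2 (real (length ?x)) ^ D \<le> real (log_len ?n) ^ D" by (intro power_mono)
    then have "real Cs * log 2 (real (length ?x)) ^ D \<le> real Cs * real (log_len ?n) ^ D"
      by (rule mult_left_mono) simp
    then have "real (whead cf + 1) \<le> real Cs * real (log_len ?n) ^ D + real Cs"
      using M(3)[OF reach[unfolded ts]] by linarith
    also have "\<dots> = real (space ?n)" by (simp add: space_def)
    finally show "whead cf < space ?n" by linarith
  next
    fix a b :: "bool list" and k assume "length a = length b"
    then show "ntm_accepts (set ts) (enc_query a b k) \<longleftrightarrow> \<A> a b > k"
      unfolding ts M(2)[symmetric] by (rule enc_query_in_decision_version)
  next
    fix a b :: "bool list" assume "length a = length b"
    then show "\<bar>\<A> a b\<bar> \<le> int (answer_bound (length a))"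
      using cd[of a "length a" b] unfolding answer_bound_def by linarith
  qed
  have "opt True = max_pair \<A>" "opt False = min_pair \<A>" by (auto simp: opt_def fun_eq_iff)
  then show ?thesis
    using near_linear_reducible_opt[OF assms(3), of True] near_linear_reducible_opt[OF assms(3), of False] by simp
qed

end
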